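(* For each odd integer $d\ge 3$, the equation $D(pqr)=d$ is soluble for at least one odd prime $p$; that is, there exist an odd prime $p$ and primes $q,r$ with $r>q>p$ such that $D(pqr)=d$.
   Context: For distinct odd primes $p,q,r$, $D(pqr)$ denotes the diameter of the cyclotomic polynomial $\Phi_{pqr}$, i.e. the difference between its largest and its smallest coefficient. *)

theory Defs
  imports Complex_Main "HOL-Computational_Algebra.Computational_Algebra"
begin

definition primitive_roots_unity :: "nat \<Rightarrow> complex set" where
  "primitive_roots_unity n = {z. z ^ n = 1 \<and> (\<forall>k\<in>{0<..<n}. z ^ k \<noteq> 1)}"

definition complex_cyclotomic :: "nat \<Rightarrow> complex poly" where
  "complex_cyclotomic n = (\<Prod>z\<in>primitive_roots_unity n. [:- z, 1:])"

text \<open>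
  The coefficients are integers, so the polynomial is regarded as an integer polynomial; that the
  description below is proper for all positive \<open>n\<close> is the lemma \<open>of_int_cyclotomic\<close>.
\<close>
definition cyclotomic :: "nat \<Rightarrow> int poly" where
  "cyclotomic n = (THE P. map_poly of_int P = complex_cyclotomic n)"

definition coeff_set :: "int poly \<Rightarrow> int set" where
  "coeff_set P = coeff P ` {..degree P}"

definition cyclotomic_diameter :: "nat \<Rightarrow> int" where
  "cyclotomic_diameter n = Max (coeff_set (cyclotomic n)) - Min (coeff_set (cyclotomic n))"

lemma finite_primitive_roots_unity:
  assumes "n > 0"
  shows "finite (primitive_roots_unity n)"
proof (rule finite_subset)
  show "primitive_roots_unity n \<subseteq> {z. z ^ n = 1}"
    by (auto simp: primitive_roots_unity_def)
qed (use assms in \<open>intro finite_roots_unity; simp\<close>)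

lemma roots_unity_decompose:
  assumes "n > 0"
  shows "{z::complex. z ^ n = 1} = (\<Union>d\<in>{d. d dvd n}. primitive_roots_unity d)"
proof (intro set_eqI iffI)
  fix z :: complex
  assume "z \<in> {z. z ^ n = 1}"
  then have z: "z ^ n = 1" by simp
  define d where "d = (LEAST d. d > 0 \<and> z ^ d = 1)"
  have d: "d > 0 \<and> z ^ d = 1"
    unfolding d_def by (rule LeastI[of _ n]) (use assms z in auto)
  have least: "z ^ k \<noteq> 1" if "k > 0" "k < d" for k
    using not_less_Least[of k "\<lambda>d. d > 0 \<and> z ^ d = 1"] that unfolding d_def by blast
  have "z ^ n = z ^ (d * (n div d) + n mod d)" by simp
  also have "\<dots> = z ^ (n mod d)" using d by (simp only: power_add power_mult) simp
  finally have "z ^ (n mod d) = 1" using z by simp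
  then have "n mod d = 0" using least[of "n mod d"] d by auto
  then have "d dvd n" by auto
  moreover have "z \<in> primitive_roots_unity d"
    using d least by (auto simp: primitive_roots_unity_def)
  ultimately show "z \<in> (\<Union>d\<in>{d. d dvd n}. primitive_roots_unity d)" by blast
next
  fix z :: complex
  assume "z \<in> (\<Union>d\<in>{d. d dvd n}. primitive_roots_unity d)"
  then show "z \<in> {z. z ^ n = 1}"
    by (auto simp: primitive_roots_unity_def power_mult elim!: dvdE)
qed

lemma primitive_roots_unity_disjoint:
  assumes "d > 0" "e > 0" "d \<noteq> e"
  shows "primitive_roots_unity d \<inter> primitive_roots_unity e = {}"
  using assms by (cases d e rule: linorder_cases) (auto simp: primitive_roots_unity_def)

lemma prod_roots_unity:
  assumes "n > 0"
  shows "(\<Prod>z\<in>{z::complex. z ^ n = 1}. [:- z, 1:]) = monom 1 n - 1"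
proof (rule poly_eqI_degree_lead_coeff[where A = "{z::complex. z ^ n = 1}" and n = n])
  have fin: "finite {z::complex. z ^ n = 1}"
    using assms by (intro finite_roots_unity) simp
  have card: "card {z::complex. z ^ n = 1} = n"
    using assms by (rule card_roots_unity_eq)
  have deg: "degree (\<Prod>z\<in>{z::complex. z ^ n = 1}. [:- z, 1:]) = n"
    by (subst degree_prod_eq_sum_degree) (auto simp: card)
  show "degree (\<Prod>z\<in>{z::complex. z ^ n = 1}. [:- z, 1:]) \<le> n"
    using deg by simp
  show "degree (monom 1 n - 1 :: complex poly) \<le> n"
    by (intro degree_diff_le degree_monom_le) simp
  have "lead_coeff (\<Prod>z\<in>{z::complex. z ^ n = 1}. [:- z, 1:]) = 1"
    by (simp add: lead_coeff_prod)
  then show "coeff (\<Prod>z\<in>{z::complex. z ^ n = 1}. [:- z, 1:]) n = coeff (monom 1 n - 1) n"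
    using assms unfolding deg by (simp add: coeff_1)
  show "n \<le> card {z::complex. z ^ n = 1}" using card by simp
  fix z :: complex
  assume z: "z \<in> {z. z ^ n = 1}"
  then show "poly (\<Prod>z\<in>{z::complex. z ^ n = 1}. [:- z, 1:]) z = poly (monom 1 n - 1) z"
    using fin by (auto simp: poly_prod poly_monom prod_zero_iff)
qed

lemma prod_complex_cyclotomic:
  assumes "n > 0"
  shows "(\<Prod>d\<in>{d. d dvd n}. complex_cyclotomic d) = monom 1 n - 1"
proof -
  have pos: "d > 0" if "d dvd n" for d using that assms by (rule dvd_pos_nat[rotated])
  have "(\<Prod>d\<in>{d. d dvd n}. complex_cyclotomic d)
        = (\<Prod>z\<in>(\<Union>d\<in>{d. d dvd n}. primitive_roots_unity d). [:- z, 1:])"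
    unfolding complex_cyclotomic_def
    by (rule prod.UNION_disjoint[symmetric])
      (use assms pos finite_primitive_roots_unity primitive_roots_unity_disjoint in auto)
  then show ?thesis
    using assms by (simp add: roots_unity_decompose[symmetric] prod_roots_unity)
qed

abbreviation to_complex_poly :: "int poly \<Rightarrow> complex poly" where
  "to_complex_poly \<equiv> map_poly of_int"

lemma to_complex_poly_mult: "to_complex_poly (P * Q) = to_complex_poly P * to_complex_poly Q"
  by (rule poly_eqI) (simp add: coeff_map_poly coeff_mult)

lemma to_complex_poly_add: "to_complex_poly (P + Q) = to_complex_poly P + to_complex_poly Q"
  by (rule poly_eqI) (simp add: coeff_map_poly)

lemma to_complex_poly_prod: "to_complex_poly (prod f A) = (\<Prod>x\<in>A. to_complex_poly (f x))"
  by (induction A rule: infinite_finite_induct) (simp_all add: to_complex_poly_mult)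

lemma inj_to_complex_poly: "to_complex_poly P = to_complex_poly Q \<Longrightarrow> P = Q"
  by (simp add: poly_eq_iff coeff_map_poly)

lemma degree_to_complex_poly: "degree (to_complex_poly P) = degree P"
  by (rule degree_map_poly) simp

lemma lead_coeff_complex_cyclotomic: "lead_coeff (complex_cyclotomic n) = 1"
  unfolding complex_cyclotomic_def by (simp add: lead_coeff_prod)

lemma complex_cyclotomic_integral:
  assumes "n > 0"
  shows "\<exists>P. to_complex_poly P = complex_cyclotomic n"
  using assms
proof (induction n rule: less_induct)
  case (less n)
  define D where "D = {d. d dvd n} - {n}"
  have fin: "finite {d. d dvd n}" using less.prems by simp
  have "\<exists>P. to_complex_poly P = complex_cyclotomic d" if "d \<in> D" for d
    using that less dvd_imp_le[of d n] dvd_pos_nat[of n d]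
    unfolding D_def by (intro less.IH) auto
  then obtain f where f: "\<And>d. d \<in> D \<Longrightarrow> to_complex_poly (f d) = complex_cyclotomic d"
    by metis
  define Q where "Q = prod f D"
  have Q: "to_complex_poly Q = (\<Prod>d\<in>D. complex_cyclotomic d)"
    using f by (simp add: Q_def to_complex_poly_prod)
  have "lead_coeff (to_complex_poly Q) = 1"
    unfolding Q by (simp add: lead_coeff_prod lead_coeff_complex_cyclotomic)
  then have lc: "lead_coeff Q = 1"
    by (simp add: degree_to_complex_poly coeff_map_poly)
  then have Q0: "Q \<noteq> 0" by auto
  have eq: "to_complex_poly (monom 1 n - 1) = to_complex_poly Q * complex_cyclotomic n"
  proof -
    have "to_complex_poly (monom 1 n - 1) = (monom 1 n - 1 :: complex poly)"
      by (rule poly_eqI) (simp add: coeff_map_poly coeff_1)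
    also have "\<dots> = (\<Prod>d\<in>{d. d dvd n}. complex_cyclotomic d)"
      using less.prems by (simp add: prod_complex_cyclotomic)
    also have "\<dots> = complex_cyclotomic n * (\<Prod>d\<in>D. complex_cyclotomic d)"
      unfolding D_def by (rule prod.remove) (use fin in auto)
    finally show ?thesis by (simp add: Q mult.commute)
  qed
  obtain q r where qr: "pseudo_divmod (monom 1 n - 1) Q = (q, r)" by fastforce
  have div: "monom 1 n - 1 = Q * q + r" and r: "r = 0 \<or> degree r < degree Q"
    using pseudo_divmod[OF Q0 qr] lc by simp_all
  have rr: "to_complex_poly Q * (complex_cyclotomic n - to_complex_poly q) = to_complex_poly r"
    using eq unfolding div by (simp add: to_complex_poly_add to_complex_poly_mult algebra_simps)
  have "complex_cyclotomic n - to_complex_poly q = 0"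
  proof (rule ccontr)
    assume nz: "complex_cyclotomic n - to_complex_poly q \<noteq> 0"
    have Qc: "to_complex_poly Q \<noteq> 0" using Q0 inj_to_complex_poly[of Q 0] by auto
    have "degree (to_complex_poly r) \<ge> degree (to_complex_poly Q)"
      unfolding rr[symmetric] using nz Qc by (simp add: degree_mult_eq)
    moreover have "r \<noteq> 0" using rr nz Qc by auto
    ultimately show False using r by (simp add: degree_to_complex_poly)
  qed
  then show ?case by (metis eq_iff_diff_eq_0)
qed

lemma of_int_cyclotomic:
  assumes "n > 0"
  shows "map_poly of_int (cyclotomic n) = complex_cyclotomic n"
  unfolding cyclotomic_def
  by (rule theI') (metis complex_cyclotomic_integral[OF assms] inj_to_complex_poly)

end

theory Submission
  imports Defs "HOL-Number_Theory.Number_Theory"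
begin

text \<open>
  The polynomial \<open>\<Phi>\<^bsub>105\<^esub>\<close> has coefficient range \<open>[-2, 1]\<close>, which settles \<open>d = 3\<close>. For \<open>d = 2 * h + 1\<close>
  with \<open>h \<ge> 2\<close> choose \<open>1 \<le> e \<le> h\<close> and a prime \<open>p > 2 * h\<close> dividing \<open>h * e + 1\<close>, then by Dirichlet's
  theorem primes \<open>q \<equiv> h (mod p)\<close> with \<open>q \<ge> 2 * p\<^sup>2\<close> and \<open>r > p * q\<close> with \<open>r * (q - p) \<equiv> 1 (mod p * q)\<close>. The
  coefficient range of \<open>\<Phi>\<^bsub>p * q * r\<^esub>\<close> is then exactly \<open>[- h - 1, h]\<close>.

  To see this, write \<open>\<Phi>\<^bsub>p * q * r\<^esub>(X) = \<Phi>\<^bsub>p * q\<^esub>(X\<^sup>r) * (1 - X\<^sup>p) * (1 - X\<^sup>q) / ((1 - X) * (1 - X\<^bsup>p * q\<^esup>))\<close> as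
  power series. The coefficient of \<open>X\<^sup>n\<close> is a difference of two sums of \<open>p\<close> coefficients of
  \<open>\<Phi>\<^bsub>p * q\<^esub>\<close>, truncated at degree \<open>n div r\<close>. In the coordinates \<open>a * p + b * q\<close> of the exponents modulo
  \<open>p * q\<close>, the choice of \<open>r\<close> makes the exponents run along a diagonal of step \<open>(1, -1)\<close>, and
  \<open>q \<equiv> h (mod p)\<close> makes the second diagonal the translate of the first by \<open>(0, - h)\<close>. The nonzero
  coefficients of \<open>\<Phi>\<^bsub>p * q\<^esub>\<close> fill two rectangles of heights \<open>p - e\<close> and \<open>e\<close> in these coordinates.

  Dirichlet's theorem is needed only for moduli \<open>p\<close> and \<open>p * q\<close>. It is proved by Mertens' method from
  \<open>L(1, \<chi>) \<noteq> 0\<close>; at most one character can have \<open>L(1, \<chi>) = 0\<close>, so such a character is real, and for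
  real characters Monsky's argument applies.
\<close>

section \<open>Diagonal sums of binary cyclotomic coefficients\<close>

text \<open>The condition that p divides h * e + 1 makes - e the inverse of q modulo p, because q is
  congruent to h; this gives the rectangles their heights p - e and e, and e \<le> h keeps the rows
  of the small one from contributing more than h. For h = 1 it would force p to divide 2, which is
  why d = 3 stands apart. The asymmetric range comes from comparing the two diagonals row by row:
  they meet a row in columns that differ by a cyclic shift of h, so crossing an edge of a rectangle
  changes at most h rows, and the truncation cuts at most one further row, which can only lower the
  sum. The size of q makes one row outweigh all columns of a window, so the truncation keeps or
  drops whole rows with that single exception. The size of r lets the truncation degree and the
  position of the diagonal be prescribed independently, so that the extremal configurations really
  occur.\<close>

lemma sum_le_card_support:
  fixes f :: "'a \<Rightarrow> int"
  assumes "finite A" "S \<subseteq> A" "\<And>x. x \<in> S \<Longrightarrow> f x \<le> 1" "\<And>x. x \<in> A - S \<Longrightarrow> f x \<le> 0"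
  shows "sum f A \<le> int (card S)"
proof -
  have "sum f A = sum f S + sum f (A - S)"
    using assms by (metis add.commute sum.subset_diff)
  also have "\<dots> \<le> (\<Sum>x\<in>S. 1) + (\<Sum>x\<in>A - S. 0)"
    by (intro add_mono sum_mono) (use assms in auto)
  finally show ?thesis by simp
qed

lemma neg_card_support_le_sum:
  fixes f :: "'a \<Rightarrow> int"
  assumes "finite A" "S \<subseteq> A" "\<And>x. x \<in> S \<Longrightarrow> f x \<ge> - 1" "\<And>x. x \<in> A - S \<Longrightarrow> f x \<ge> 0"
  shows "sum f A \<ge> - int (card S)"
  using sum_le_card_support[of A S "\<lambda>x. - f x"] assms by (simp add: sum_negf)

lemma card_atMost_one_element:
  assumes "\<And>x y. x \<in> S \<Longrightarrow> y \<in> S \<Longrightarrow> x = y"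
  shows "card S \<le> 1"
  using assms by (metis card_le_Suc0_iff_eq One_nat_def card.infinite le0)

text \<open>\<open>mu\<close> and \<open>lam\<close> are the inverses of p modulo q and of q modulo
  p, the side lengths of the positive rectangle; the negative one has sides q - mu and e. The bound
  on \<open>q\<close> gives p * p < q and leaves room for the cutoff of the upper extremal
  window.\<close>

locale binary_window =
  fixes p q h e lam mu :: int
  assumes e: "0 < e" "e \<le> h" and h: "2 * h < p" and q: "2 * p ^ 2 \<le> q"
    and lam: "lam = p - e" and mu: "mu * p + lam * q = p * q + 1"
begin

text \<open>
  The coefficient of \<open>\<Phi>\<^bsub>p * q\<^esub>\<close> at the exponent congruent to \<open>a * p + b * q\<close>, where \<open>0 \<le> a < q\<close> and
  \<open>0 \<le> b < p\<close>, with exponents above \<open>M\<close> dropped; exponents in the negative rectangle are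
  \<open>a * p + b * q - p * q\<close>.
\<close>
definition trunc :: "int \<Rightarrow> int \<Rightarrow> int \<Rightarrow> int" where
  "trunc M a b = (if a < mu \<and> b < lam then of_bool (a * p + b * q \<le> M)
     else if a \<ge> mu \<and> b \<ge> lam then - of_bool (a * p + b * q \<le> M + p * q) else 0)"

definition window :: "int \<Rightarrow> int \<Rightarrow> int \<Rightarrow> int" where
  "window M s b =
     (\<Sum>j\<in>{0..<p}. trunc M ((s + j) mod q) ((b - j) mod p))
   - (\<Sum>j\<in>{0..<p}. trunc M ((s + j) mod q) ((b - h - j) mod p))"

lemma p_pos: "p > 2" and h_pos: "h > 0" and q_pos: "q > 0" and pp_q: "p * p < q"
proof -
  show p2: "p > 2" and "h > 0" using e h by auto
  have "p * p > 0" using p2 by simp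
  then show "q > 0" "p * p < q" using q unfolding power2_eq_square by linarith+
qed

lemma mu_eq: "mu * p = e * q + 1"
  using mu unfolding lam by (simp add: algebra_simps)

text \<open>Both sides of the edge a = mu are at least p columns wide, so p consecutive columns
  modulo q cannot meet that edge and the wrap at q together.\<close>

lemma mu_bounds: "p \<le> mu" "mu + p \<le> q"
proof -
  have "1 * q \<le> e * q" using e q_pos by (intro mult_right_mono) auto
  then have "p * p < mu * p" using mu_eq pp_q by simp
  then show "p \<le> mu" using p_pos by simp
  have "e * q \<le> (p - 2) * q" using e h q_pos h_pos by (intro mult_right_mono) auto
  then have "(mu + p) * p \<le> p * q - 2 * q + 1 + p * p" unfolding distrib_right mu_eq
    by (simp add: algebra_simps)
  also have "\<dots> \<le> q * p" using pp_q q_pos mult.commute[of p q] by linarith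
  finally show "mu + p \<le> q" using p_pos by simp
qed

text \<open>The cyclic shift by which the second diagonal differs from the first in a given row: it
  lowers a position by h, except that the first h positions move up by p - h.\<close>

definition shift :: "int \<Rightarrow> int" where "shift j = (j - h) mod p"

lemma shift_eq: "0 \<le> j \<Longrightarrow> j < p \<Longrightarrow> shift j = (if j < h then j - h + p else j - h)"
proof -
  assume j: "0 \<le> j" "j < p"
  show ?thesis
  proof (cases "j < h")
    case True
    have "shift j = (j - h + p) mod p" by (simp add: shift_def)
    also have "\<dots> = j - h + p"
      using True j h h_pos by (intro mod_pos_pos_trivial) auto
    finally show ?thesis using True by simp
  next
    case False
    then show ?thesis using j h_pos by (simp add: shift_def mod_pos_pos_trivial)
  qed
qed

text \<open>Reindexing the second sum by \<open>shift\<close> puts both terms of each difference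
  into the same row. All later counting compares \<open>j\<close> with \<open>shift j\<close> inside
  one row.\<close>

lemma window_eq:
  "window M s b = (\<Sum>j\<in>{0..<p}. trunc M ((s + j) mod q) ((b - j) mod p)
      - trunc M ((s + shift j) mod q) ((b - j) mod p))"
proof -
  have bij: "bij_betw shift {0..<p} {0..<p}"
  proof (rule bij_betw_byWitness[where f' = "\<lambda>j. (j + h) mod p"])
    show "\<forall>a\<in>{0..<p}. (shift a + h) mod p = a"
      by (auto simp: shift_def mod_simps)
    show "\<forall>a\<in>{0..<p}. shift ((a + h) mod p) = a"
      by (auto simp: shift_def mod_simps)
  qed (use p_pos in \<open>auto simp: shift_def\<close>)
  have "(\<Sum>j\<in>{0..<p}. trunc M ((s + j) mod q) ((b - h - j) mod p))
      = (\<Sum>j\<in>{0..<p}. trunc M ((s + shift j) mod q) ((b - h - shift j) mod p))"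
    by (rule sum.reindex_bij_betw[OF bij, symmetric])
  also have "\<dots> = (\<Sum>j\<in>{0..<p}. trunc M ((s + shift j) mod q) ((b - j) mod p))"
    by (intro sum.cong refl) (simp add: shift_def mod_simps)
  finally show ?thesis by (simp add: window_def sum_subtractf)
qed

lemma residue_eq:
  assumes "x \<in> {0..<p}" "y \<in> {0..<p}" "(b - x) mod p = (b - y) mod p"
  shows "x = y"
proof (rule ccontr)
  assume "x \<noteq> y"
  have "p dvd (b - x) - (b - y)" using assms(3) mod_eq_dvd_iff by blast
  then have "\<bar>p\<bar> \<le> \<bar>y - x\<bar>" using \<open>x \<noteq> y\<close> by (intro dvd_imp_le_int) auto
  then show False using assms(1,2) by auto
qed

text \<open>Distinct positions of a window lie in distinct rows, and only e \<le> h rows have index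
  at least \<open>lam\<close>.\<close>

lemma card_large_residue:
  "card {j\<in>{0..<p}. (b - j) mod p \<ge> lam} \<le> nat h"
proof -
  have "card {j\<in>{0..<p}. (b - j) mod p \<ge> lam} = card ((\<lambda>j. (b - j) mod p) ` {j\<in>{0..<p}. (b - j) mod p \<ge> lam})"
    by (rule card_image[symmetric], rule inj_onI) (rule residue_eq[of _ _ b], auto)
  also have "\<dots> \<le> card {lam..<p}"
    using p_pos by (intro card_mono) auto
  also have "\<dots> = nat e" by (simp add: lam)
  also have "\<dots> \<le> nat h" using e by simp
  finally show ?thesis .
qed

text \<open>One step up in \<open>b\<close> adds q > p * p, more than the columns of one window can
  take back, so exponents are ordered by rows.\<close>

lemma mult_q_gap: "b < b' \<Longrightarrow> x < p \<Longrightarrow> y \<ge> 0 \<Longrightarrow> x * p + b * q \<le> y * p + b' * q" for x y b b' :: int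
proof -
  assume a: "b < b'" "x < p" "y \<ge> 0"
  have "x * p \<le> p * p" "y * p \<ge> 0" using a p_pos by (auto intro: mult_right_mono)
  moreover have "(b + 1) * q \<le> b' * q" using a q_pos by (intro mult_right_mono) auto
  ultimately show ?thesis using pp_q by (simp add: algebra_simps)
qed

lemma shift_range: "0 \<le> j \<Longrightarrow> j < p \<Longrightarrow> 0 \<le> shift j \<and> shift j < p"
  using shift_eq h_pos h by auto

text \<open>At most one row of the rectangle is met by the line \<open>a * p + b * q = M\<close> within one window.\<close>
lemma card_partial_rows:
  "card {j\<in>{0..<p}. P ((b - j) mod p) \<and> (\<exists>x y. x < p \<and> 0 \<le> x \<and> 0 \<le> y \<and> y < p \<and> x * p + ((b - j) mod p) * q \<le> M
       \<and> M < y * p + ((b - j) mod p) * q)} \<le> 1" (is "card ?S \<le> 1")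
proof (rule card_atMost_one_element)
  fix i j assume ij: "i \<in> ?S" "j \<in> ?S"
  have "\<not> (b - i) mod p < (b - j) mod p" if "i \<in> ?S" "j \<in> ?S" for i j
  proof
    assume "(b - i) mod p < (b - j) mod p"
    moreover from that obtain x y where "x < p" "0 \<le> x" "0 \<le> y" "y < p"
      "x * p + ((b - j) mod p) * q \<le> M" "M < y * p + ((b - i) mod p) * q" by auto
    ultimately show False using mult_q_gap[of "(b - i) mod p" "(b - j) mod p" y x] by simp
  qed
  from this[OF ij] this[OF ij(2,1)] show "i = j"
    using ij by (intro residue_eq[of i j b]) auto
qed


lemma sum_shift: "(\<Sum>j\<in>{0..<p}. f (shift j)) = (\<Sum>j\<in>{0..<p}. f j)"
proof (rule sum.reindex_bij_betw)
  show "bij_betw shift {0..<p} {0..<p}"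
  proof (rule bij_betw_byWitness[where f' = "\<lambda>j. (j + h) mod p"])
    show "\<forall>a\<in>{0..<p}. (shift a + h) mod p = a"
      by (auto simp: shift_def mod_simps)
    show "\<forall>a\<in>{0..<p}. shift ((a + h) mod p) = a"
      by (auto simp: shift_def mod_simps)
  qed (use p_pos in \<open>auto simp: shift_def\<close>)
qed

lemma card_interval_le: "card ({t..<t + h} \<inter> {0..<p}) \<le> nat h"
proof -
  have "card ({t..<t + h} \<inter> {0..<p}) \<le> card {t..<t + h}" by (intro card_mono) auto
  then show ?thesis by simp
qed

lemma row_mono: "i \<le> j \<Longrightarrow> j * p + c \<le> K \<Longrightarrow> i * p + c \<le> K" for i j c K :: int
  using p_pos mult_right_mono[of i j p] by linarith

text \<open>
  Within a window the coordinate \<open>a\<close> either passes from the positive to the negative rectangle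
  (at \<open>a = mu\<close>) or wraps around from \<open>q - 1\<close> to \<open>0\<close>, but not both. The functions \<open>descent\<close> and
  \<open>ascent\<close> describe the two cases with the transition at position \<open>t\<close>.
\<close>
definition descent :: "int \<Rightarrow> int \<Rightarrow> int \<Rightarrow> int \<Rightarrow> int" where
  "descent K t j b = (if b < lam then of_bool (j < t \<and> j * p + b * q \<le> K)
     else - of_bool (t \<le> j \<and> j * p + (b - p) * q \<le> K))"

definition ascent :: "int \<Rightarrow> int \<Rightarrow> int \<Rightarrow> int \<Rightarrow> int" where
  "ascent K t j b = (if b < lam then of_bool (t \<le> j \<and> j * p + b * q \<le> K)
     else - of_bool (j < t \<and> j * p + b * q \<le> K))"

text \<open>If some position in a positive row is below the cutoff, every position in a negative row
  is, since the latter are lowered by p * q. Then \<open>descent\<close> is nonincreasing along each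
  row, so only the h positions moved up by \<open>shift\<close> can give +1, while a -1 takes a
  crossing of \<open>t\<close> within h steps or the single row cut by the cutoff. If no positive
  row survives, at most e rows remain for the upper bound, and they give -1 only within h steps from
  \<open>t\<close>.\<close>

lemma sum_descent_bounds:
  fixes K t b :: int
  assumes "t \<ge> 0"
  defines "D \<equiv> \<lambda>j. descent K t j ((b - j) mod p) - descent K t (shift j) ((b - j) mod p)"
  shows "sum D {0..<p} \<le> h" "sum D {0..<p} \<ge> - h - 1"
proof -
  have D1: "D j \<le> 1" "D j \<ge> -1" for j by (auto simp: D_def descent_def)
  define R where "R = (\<lambda>j. (b - j) mod p)"
  have R: "0 \<le> R j" "R j < p" for j using p_pos by (auto simp: R_def)
  have D: "D j = descent K t j (R j) - descent K t (shift j) (R j)" for j by (simp add: D_def R_def)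
  define part where "part = {j\<in>{0..<p}. R j < lam \<and> (\<exists>x y. x < p \<and> 0 \<le> x \<and> 0 \<le> y \<and> y < p \<and> x * p + R j * q \<le> K
       \<and> K < y * p + R j * q)}"
  have part: "card part \<le> 1" unfolding part_def R_def by (rule card_partial_rows)
  consider (full) b0 j0 where "0 \<le> b0" "b0 < lam" "0 \<le> j0" "j0 < p" "j0 * p + b0 * q \<le> K"
    | (empty) "\<And>b j. 0 \<le> b \<Longrightarrow> b < lam \<Longrightarrow> 0 \<le> j \<Longrightarrow> j < p \<Longrightarrow> \<not> j * p + b * q \<le> K" by blast
  then have "sum D {0..<p} \<le> h \<and> sum D {0..<p} \<ge> - h - 1"
  proof cases
    case full
    have c: "j * p + (b - p) * q \<le> K" if "0 \<le> j" "j < p" "b < p" for j b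
      using mult_q_gap[of "b - p" b0 j j0] full that by auto
    have g: "descent K t j b = - of_bool (t \<le> j)" if "0 \<le> j" "j < p" "lam \<le> b" "b < p" for j b
      using c that by (simp add: descent_def)
    have "sum D {0..<p} \<le> int (card {0..<h})"
    proof (rule sum_le_card_support)
      fix j assume "j \<in> {0..<p} - {0..<h}"
      then have j: "h \<le> j" "j < p" "shift j = j - h" "0 \<le> j - h" "0 \<le> j" "j - h < p"
        using shift_eq[of j] h_pos by auto
      show "D j \<le> 0"
      proof (cases "R j < lam")
        case True
        then show ?thesis using row_mono[of "j - h" j "R j * q" K] h_pos j by (auto simp: D descent_def)
      next
        case False
        then show ?thesis using g[of j "R j"] g[of "j - h" "R j"] j R[of j] h_pos by (auto simp: D)
      qed
    qed (use D1 h h_pos in auto)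
    moreover have "sum D {0..<p} \<ge> - int (card ({t..<t + h} \<inter> {0..<p} \<union> part))"
    proof (rule neg_card_support_le_sum)
      fix j assume "j \<in> {0..<p} - ({t..<t + h} \<inter> {0..<p} \<union> part)"
      then have j: "0 \<le> j" "j < p" "j \<notin> {t..<t + h}" and np: "j \<notin> part" by auto
      note sj = shift_range[OF j(1,2)] shift_eq[OF j(1,2)]
      show "D j \<ge> 0"
      proof (cases "R j < lam")
        case True
        have "j * p + R j * q \<le> K" if "shift j * p + R j * q \<le> K"
          using np that True j sj unfolding part_def by force
        then show ?thesis using True j sj by (auto simp: D descent_def split: if_splits)
      next
        case False
        then show ?thesis using g[of j "R j"] g[of "shift j" "R j"] j R[of j] sj h_pos
          by (auto simp: D split: if_splits)
      qed
    qed (use D1 in \<open>auto simp: part_def\<close>)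
    moreover have "card ({t..<t + h} \<inter> {0..<p} \<union> part) \<le> nat h + 1"
      using card_Un_le[of "{t..<t + h} \<inter> {0..<p}" part] card_interval_le[of t] part by linarith
    ultimately show ?thesis using h_pos by auto
  next
    case empty
    have g: "descent K t j b = 0" if "0 \<le> j" "j < p" "0 \<le> b" "b < lam" for j b
      using empty[of b j] that by (simp add: descent_def)
    have "sum D {0..<p} \<le> int (card {j\<in>{0..<p}. (b - j) mod p \<ge> lam})"
    proof (rule sum_le_card_support)
      fix j assume "j \<in> {0..<p} - {j\<in>{0..<p}. (b - j) mod p \<ge> lam}"
      then have "0 \<le> j" "j < p" "R j < lam" by (auto simp: R_def)
      then show "D j \<le> 0" using g[of j "R j"] g[of "shift j" "R j"] shift_range[of j] R[of j]
        by (auto simp: D)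
    qed (use D1 in auto)
    moreover have "sum D {0..<p} \<ge> - int (card ({t..<t + h} \<inter> {0..<p}))"
    proof (rule neg_card_support_le_sum)
      fix j assume "j \<in> {0..<p} - ({t..<t + h} \<inter> {0..<p})"
      then have j: "0 \<le> j" "j < p" "j \<notin> {t..<t + h}" by auto
      note sj = shift_range[OF j(1,2)] shift_eq[OF j(1,2)]
      show "D j \<ge> 0"
      proof (cases "R j < lam")
        case True
        then show ?thesis using g[of j "R j"] g[of "shift j" "R j"] j sj R[of j] by (auto simp: D)
      next
        case False
        \<comment> \<open>As \<open>t\<close> \<ge> 0, a position from \<open>t\<close> on outside
          the interval is at least h, so \<open>shift\<close> lowers it and the cutoff cannot
          separate the two terms.\<close>
        then show ?thesis using row_mono[of "shift j" j "(R j - p) * q" K] j sj h_pos \<open>t \<ge> 0\<close>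
          by (auto simp: D descent_def split: if_splits)
      qed
    qed (use D1 in auto)
    ultimately show ?thesis using card_large_residue[of b] card_interval_le[of t] h_pos by linarith
  qed
  then show "sum D {0..<p} \<le> h" "sum D {0..<p} \<ge> - h - 1" by auto
qed

text \<open>Here the upper rows carry -1 before \<open>t\<close> and the lower rows +1 from
  \<open>t\<close> on, with one common cutoff. If some upper position survives the cutoff, all lower
  rows are complete. Otherwise the upper rows are empty, +1 comes only from the h positions starting
  at \<open>t\<close>, and -1 only from the first h positions and the cut row.\<close>

lemma sum_ascent_bounds:
  fixes K t b :: int
  assumes "t \<ge> 0"
  defines "D \<equiv> \<lambda>j. ascent K t j ((b - j) mod p) - ascent K t (shift j) ((b - j) mod p)"
  shows "sum D {0..<p} \<le> h" "sum D {0..<p} \<ge> - h - 1"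
proof -
  have D1: "D j \<le> 1" "D j \<ge> -1" for j by (auto simp: D_def ascent_def)
  define R where "R = (\<lambda>j. (b - j) mod p)"
  have R: "0 \<le> R j" "R j < p" for j using p_pos by (auto simp: R_def)
  have D: "D j = ascent K t j (R j) - ascent K t (shift j) (R j)" for j by (simp add: D_def R_def)
  define part where "part = {j\<in>{0..<p}. R j < lam \<and> (\<exists>x y. x < p \<and> 0 \<le> x \<and> 0 \<le> y \<and> y < p \<and> x * p + R j * q \<le> K
       \<and> K < y * p + R j * q)}"
  have part: "card part \<le> 1" unfolding part_def R_def by (rule card_partial_rows)
  consider (full) b0 j0 where "lam \<le> b0" "b0 < p" "0 \<le> j0" "j0 < p" "j0 * p + b0 * q \<le> K"
    | (empty) "\<And>b j. lam \<le> b \<Longrightarrow> b < p \<Longrightarrow> 0 \<le> j \<Longrightarrow> j < p \<Longrightarrow> \<not> j * p + b * q \<le> K" by blast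
  then have "sum D {0..<p} \<le> h \<and> sum D {0..<p} \<ge> - h - 1"
  proof cases
    case full
    have c: "j * p + b * q \<le> K" if "0 \<le> j" "j < p" "b < lam" for j b
      using mult_q_gap[of b b0 j j0] full that by auto
    have g: "ascent K t j b = of_bool (t \<le> j)" if "0 \<le> j" "j < p" "b < lam" for j b
      using c that by (simp add: ascent_def)
    \<comment> \<open>The correction sums to zero because \<open>shift\<close> permutes the
      positions. Adding the indicator of j < t turns \<open>ascent\<close> into the constant 1 on
      the complete lower rows, so that only the at most e upper rows are left.\<close>
    define D' where "D' = (\<lambda>j. D j + of_bool (j < t) - of_bool (shift j < t))"
    have "sum D' {0..<p} = sum D {0..<p}"
      using sum_shift[of "\<lambda>j. of_bool (j < t) :: int"] by (simp add: D'_def sum.distrib sum_subtractf del: sum_of_bool_eq)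
    moreover have D'1: "D' j \<le> 1" "D' j \<ge> - 1" if "R j \<ge> lam" for j
      using that by (auto simp: D'_def D ascent_def)
    moreover have D'0: "D' j = 0" if "j \<in> {0..<p} - {j\<in>{0..<p}. (b - j) mod p \<ge> lam}" for j
    proof -
      have j: "0 \<le> j" "j < p" "R j < lam" using that by (auto simp: R_def)
      then show ?thesis using g[of j "R j"] g[of "shift j" "R j"] shift_range[of j]
        by (auto simp: D'_def D)
    qed
    have "sum D' {0..<p} \<le> int (card {j\<in>{0..<p}. (b - j) mod p \<ge> lam})"
      by (rule sum_le_card_support) (use D'1 D'0 in \<open>auto simp: R_def\<close>)
    moreover have "sum D' {0..<p} \<ge> - int (card {j\<in>{0..<p}. (b - j) mod p \<ge> lam})"
      by (rule neg_card_support_le_sum) (use D'1 D'0 in \<open>auto simp: R_def\<close>)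
    ultimately show ?thesis using card_large_residue[of b] h_pos by linarith
  next
    case empty
    have g: "ascent K t j b = 0" if "0 \<le> j" "j < p" "lam \<le> b" "b < p" for j b
      using empty[of b j] that by (simp add: ascent_def)
    have "sum D {0..<p} \<le> int (card ({t..<t + h} \<inter> {0..<p}))"
    proof (rule sum_le_card_support)
      fix j assume "j \<in> {0..<p} - ({t..<t + h} \<inter> {0..<p})"
      then have j: "0 \<le> j" "j < p" "j \<notin> {t..<t + h}" by auto
      note sj = shift_range[OF j(1,2)] shift_eq[OF j(1,2)]
      show "D j \<le> 0"
      proof (cases "R j < lam")
        case True
        then show ?thesis using row_mono[of "shift j" j "R j * q" K] j sj h_pos \<open>t \<ge> 0\<close>
          by (auto simp: D ascent_def split: if_splits)
      next
        case False
        then show ?thesis using g[of j "R j"] g[of "shift j" "R j"] j sj R[of j] by (auto simp: D)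
      qed
    qed (use D1 in auto)
    moreover have "sum D {0..<p} \<ge> - int (card ({0..<h} \<union> part))"
    proof (rule neg_card_support_le_sum)
      fix j assume "j \<in> {0..<p} - ({0..<h} \<union> part)"
      then have j: "0 \<le> j" "j < p" "\<not> j < h" and np: "j \<notin> part" by auto
      note sj = shift_range[OF j(1,2)] shift_eq[OF j(1,2)]
      show "D j \<ge> 0"
      proof (cases "R j < lam")
        case True
        have "j * p + R j * q \<le> K" if "shift j * p + R j * q \<le> K"
          using np that True j sj unfolding part_def by force
        then show ?thesis using True j sj h_pos by (auto simp: D ascent_def)
      next
        case False
        then show ?thesis using g[of j "R j"] g[of "shift j" "R j"] j R[of j] sj by (auto simp: D)
      qed
    qed (use D1 h h_pos in \<open>auto simp: part_def\<close>)
    moreover have "card ({0..<h} \<union> part) \<le> nat h + 1"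
      using card_Un_le[of "{0..<h}" part] part by simp
    ultimately show ?thesis using h_pos card_interval_le[of t] by linarith
  qed
  then show "sum D {0..<p} \<le> h" "sum D {0..<p} \<ge> - h - 1" by auto
qed

text \<open>Without a wrap the positive rectangle lies to the left of the transition at
  \<open>mu\<close>; the maximum with 0 covers windows that start to the right of it.\<close>

lemma trunc_descent:
  assumes "0 \<le> s" "s + p \<le> q" "0 \<le> j" "j < p" "0 \<le> b" "b < p"
  shows "trunc M ((s + j) mod q) b = descent (M - s * p) (max 0 (mu - s)) j b"
proof -
  have "(s + j) mod q = s + j" using assms by (intro mod_pos_pos_trivial) auto
  then show ?thesis using assms by (auto simp: trunc_def descent_def algebra_simps)
qed

text \<open>A wrap lowers a * p by p * q, exactly the amount by which exponents of the negative
  rectangle are reduced; hence one cutoff serves both branches of \<open>ascent\<close>.\<close>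

lemma trunc_ascent:
  assumes "s < q" "s + p > q" "0 \<le> j" "j < p" "0 \<le> b" "b < p"
  shows "trunc M ((s + j) mod q) b = ascent (M + (q - s) * p) (q - s) j b"
proof (cases "j < q - s")
  case True
  have "(s + j) mod q = s + j" using assms True mu_bounds p_pos by (intro mod_pos_pos_trivial) auto
  then show ?thesis using assms True mu_bounds by (auto simp: trunc_def ascent_def algebra_simps)
next
  case False
  have "(s + j) mod q = (s + j - q) mod q" by simp
  also have "\<dots> = s + j - q" using assms False mu_bounds p_pos by (intro mod_pos_pos_trivial) auto
  finally have *: "(s + j) mod q = s + j - q" .
  show ?thesis unfolding * using assms False mu_bounds by (auto simp: trunc_def ascent_def algebra_simps)
qed

lemma window_descent:
  assumes "0 \<le> s" "s + p \<le> q"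
  shows "window M s b = (\<Sum>j\<in>{0..<p}. descent (M - s * p) (max 0 (mu - s)) j ((b - j) mod p)
      - descent (M - s * p) (max 0 (mu - s)) (shift j) ((b - j) mod p))"
  unfolding window_eq
  by (intro sum.cong refl arg_cong2[where f = minus] trunc_descent assms)
    (use shift_range p_pos in auto)

lemma window_ascent:
  assumes "s < q" "s + p > q"
  shows "window M s b = (\<Sum>j\<in>{0..<p}. ascent (M + (q - s) * p) (q - s) j ((b - j) mod p)
      - ascent (M + (q - s) * p) (q - s) (shift j) ((b - j) mod p))"
  unfolding window_eq
  by (intro sum.cong refl arg_cong2[where f = minus] trunc_ascent assms)
    (use shift_range p_pos in auto)

lemma window_bounds:
  assumes "0 \<le> s" "s < q"
  shows "window M s b \<le> h" "window M s b \<ge> - h - 1"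
proof -
  have "window M s b \<le> h \<and> window M s b \<ge> - h - 1"
  proof (cases "s + p \<le> q")
    case True
    show ?thesis unfolding window_descent[OF assms(1) True]
      by (intro conjI sum_descent_bounds) auto
  next
    case False
    then have False': "s + p > q" by simp
    show ?thesis unfolding window_ascent[OF assms(2) False']
      by (intro conjI sum_ascent_bounds) (use assms in auto)
  qed
  then show "window M s b \<le> h" "window M s b \<ge> - h - 1" by auto
qed

section \<open>Windows that attain the two bounds\<close>

text \<open>The cutoff separates the rows p - h - 1 and p - h, and the wrap occurs at position h.
  The positions from h on lie in surviving rows; those with h \<le> j < 2 * h have their shifted
  partner before the wrap, where the value is 0, and each of them gains 1.\<close>

lemma window_attains_upper: "window ((p - h) * q - p ^ 2) (q - h) (p - 1) = h"
proof -
  define M where "M = (p - h) * q - p ^ 2"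
  have *: "window M (q - h) (p - 1) = (\<Sum>j\<in>{0..<p}. ascent (M + h * p) h j ((p - 1 - j) mod p)
      - ascent (M + h * p) h (shift j) ((p - 1 - j) mod p))"
    using window_ascent[of "q - h" M "p - 1"] h h_pos by simp
  have "window M (q - h) (p - 1) = (\<Sum>j\<in>{0..<p}. of_bool (j \<in> {h..<2 * h}))"
    unfolding *
  proof (intro sum.cong refl)
    fix j assume "j \<in> {0..<p}"
    then have j: "0 \<le> j" "j < p" by auto
    note sj = shift_range[OF j] shift_eq[OF j]
    have r: "(p - 1 - j) mod p = p - 1 - j" using j by (intro mod_pos_pos_trivial) auto
    have lo: "x * p + b * q \<le> M + h * p" if "x < p" "b < p - h" for x b
    proof -
      have "x * p \<le> p * p" using that p_pos by (intro mult_right_mono) auto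
      moreover have "b * q \<le> (p - h - 1) * q" using that q_pos by (intro mult_right_mono) auto
      moreover have "h * p > 0" using h_pos p_pos by simp
      ultimately show ?thesis using q unfolding M_def power2_eq_square
        by (simp add: algebra_simps)
    qed
    have hi: "\<not> x * p + b * q \<le> M + h * p" if "x \<ge> 0" "b \<ge> p - h" for x b
    proof -
      have "x * p \<ge> 0" using that p_pos by simp
      moreover have "b * q \<ge> (p - h) * q" using that q_pos by (intro mult_right_mono) auto
      moreover have "h * p < p * p" using h_pos h p_pos by (intro mult_strict_right_mono) auto
      ultimately show ?thesis unfolding M_def power2_eq_square by linarith
    qed
    have "lam \<ge> p - h" using e lam by simp
    then show "ascent (M + h * p) h j ((p - 1 - j) mod p) - ascent (M + h * p) h (shift j) ((p - 1 - j) mod p)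
        = of_bool (j \<in> {h..<2 * h})"
      unfolding r using lo[of j "p - 1 - j"] lo[of "shift j" "p - 1 - j"] hi[of j "p - 1 - j"] hi[of "shift j" "p - 1 - j"]
        j sj h h_pos by (auto simp: ascent_def split: if_splits)
  qed
  also have "\<dots> = int (card ({0..<p} \<inter> {h..<2 * h}))"
    by (simp only: sum_of_bool_eq finite_atLeastLessThan_int Collect_mem_eq)
  also have "{0..<p} \<inter> {h..<2 * h} = {h..<2 * h}" using h h_pos by auto
  finally show ?thesis using h_pos by (simp add: M_def)
qed

text \<open>The cutoff is placed inside row h, between the positions p - 2 and p - 1. The first h
  positions lie in complete rows below h and are partnered with positions after the wrap, which
  gives -1 each. The last position lies in row h, just beyond the cutoff, while its partner p - 1 -
  h is within it; this is the extra -1.\<close>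

lemma window_attains_lower: "window ((p - 2 - h) * p + h * q) (q - h) (h - 1) = - h - 1"
proof -
  define M where "M = (p - 2 - h) * p + h * q"
  have *: "window M (q - h) (h - 1) = (\<Sum>j\<in>{0..<p}. ascent (M + h * p) h j ((h - 1 - j) mod p)
      - ascent (M + h * p) h (shift j) ((h - 1 - j) mod p))"
    using window_ascent[of "q - h" M "h - 1"] h h_pos by simp
  have M': "M + h * p = (p - 2) * p + h * q" by (simp add: M_def algebra_simps)
  have "window M (q - h) (h - 1) = (\<Sum>j\<in>{0..<p}. - of_bool (j \<in> insert (p - 1) {0..<h}))"
    unfolding * M'
  proof (intro sum.cong refl)
    fix j assume "j \<in> {0..<p}"
    then have j: "0 \<le> j" "j < p" by auto
    note sj = shift_range[OF j] shift_eq[OF j]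
    have r: "(h - 1 - j) mod p = (if j < h then h - 1 - j else h - 1 - j + p)"
    proof (cases "j < h")
      case False
      have "(h - 1 - j) mod p = (h - 1 - j + p) mod p" by simp
      also have "\<dots> = h - 1 - j + p" using False j h_pos by (intro mod_pos_pos_trivial) auto
      finally show ?thesis using False by simp
    qed (use j h h_pos in \<open>auto intro: mod_pos_pos_trivial\<close>)
    have lo: "x * p + b * q \<le> (p - 2) * p + h * q" if "x < p" "b < h" for x b
      using mult_q_gap[of b h x "p - 2"] that p_pos by simp
    have hi: "\<not> x * p + b * q \<le> (p - 2) * p + h * q" if "x \<ge> 0" "b > h" for x b
    proof -
      have "x * p \<ge> 0" using that p_pos by simp
      moreover have "b * q \<ge> (h + 1) * q" using that q_pos by (intro mult_right_mono) auto
      moreover have "(h + 1) * q = h * q + q" "(p - 2) * p = p * p - 2 * p" by (auto simp: algebra_simps)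
      ultimately show ?thesis using pp_q p_pos by linarith
    qed
    have eq: "x * p + h * q \<le> (p - 2) * p + h * q \<longleftrightarrow> x \<le> p - 2" for x using p_pos by simp
    have lam': "lam \<ge> p - h" using e lam by simp
    show "ascent ((p - 2) * p + h * q) h j ((h - 1 - j) mod p) - ascent ((p - 2) * p + h * q) h (shift j) ((h - 1 - j) mod p)
        = - of_bool (j \<in> insert (p - 1) {0..<h})"
    proof (cases "j = p - 1")
      case True
      then show ?thesis unfolding r using eq[of "p - 1"] eq[of "p - 1 - h"] sj h h_pos lam'
        by (auto simp: ascent_def)
    next
      case False
      then show ?thesis
        unfolding r using lo[of j "h - 1 - j"] lo[of "shift j" "h - 1 - j"]
          hi[of j "h - 1 - j + p"] hi[of "shift j" "h - 1 - j + p"]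
          j sj h h_pos lam' by (auto simp: ascent_def split: if_splits)
    qed
  qed
  also have "\<dots> = - int (card ({0..<p} \<inter> insert (p - 1) {0..<h}))"
    by (simp only: sum_negf sum_of_bool_eq finite_atLeastLessThan_int Collect_mem_eq)
  also have "{0..<p} \<inter> insert (p - 1) {0..<h} = insert (p - 1) {0..<h}" using h h_pos by auto
  also have "card \<dots> = nat h + 1" using h h_pos by simp
  finally show ?thesis using h_pos by (simp add: M_def)
qed

end

section \<open>Ternary cyclotomic polynomials\<close>

lemma prod_cyclotomic:
  assumes "n > 0"
  shows "(\<Prod>d\<in>{d. d dvd n}. cyclotomic d) = Polynomial.monom 1 n - 1"
proof (rule inj_to_complex_poly)
  have "to_complex_poly (\<Prod>d\<in>{d. d dvd n}. cyclotomic d) = (\<Prod>d\<in>{d. d dvd n}. complex_cyclotomic d)"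
    using assms by (auto simp: to_complex_poly_prod intro!: prod.cong of_int_cyclotomic dest: dvd_pos_nat)
  also have "\<dots> = to_complex_poly (Polynomial.monom 1 n - 1)"
    unfolding prod_complex_cyclotomic[OF assms]
    by (rule poly_eqI) (simp add: coeff_map_poly coeff_1)
  finally show "to_complex_poly (\<Prod>d\<in>{d. d dvd n}. cyclotomic d) = to_complex_poly (Polynomial.monom 1 n - 1)" .
qed

lemma divisors_prime_mult:
  fixes p m :: nat
  assumes "prime p" "m > 0"
  shows "{d. d dvd p * m} = {d. d dvd m} \<union> (*) p ` {d. d dvd m}"
proof (intro equalityI subsetI)
  fix d assume d: "d \<in> {d. d dvd p * m}"
  show "d \<in> {d. d dvd m} \<union> (*) p ` {d. d dvd m}"
  proof (cases "p dvd d")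
    case True
    then show ?thesis using d assms by (auto elim!: dvdE simp: prime_gt_0_nat)
  next
    case False
    then have "coprime d p" using assms by (metis coprime_commute prime_imp_coprime)
    then show ?thesis using d by (simp add: coprime_dvd_mult_right_iff)
  qed
qed auto

lemma prod_divisors_prime_mult:
  fixes p m :: nat and f :: "nat \<Rightarrow> 'a :: comm_monoid_mult"
  assumes "prime p" "m > 0" "\<not> p dvd m"
  shows "(\<Prod>d\<in>{d. d dvd p * m}. f d) = (\<Prod>d\<in>{d. d dvd m}. f d) * (\<Prod>d\<in>{d. d dvd m}. f (p * d))"
proof -
  have "{d. d dvd m} \<inter> (*) p ` {d. d dvd m} = {}"
    using assms(3) by (auto dest: dvd_mult_left)
  then have "(\<Prod>d\<in>{d. d dvd p * m}. f d) = (\<Prod>d\<in>{d. d dvd m}. f d) * prod f ((*) p ` {d. d dvd m})"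
    unfolding divisors_prime_mult[OF assms(1,2)]
    using assms(2) by (intro prod.union_disjoint) auto
  also have "prod f ((*) p ` {d. d dvd m}) = (\<Prod>d\<in>{d. d dvd m}. f (p * d))"
    using assms by (intro prod.reindex_cong[where l = "(*) p"]) (auto intro!: inj_onI simp: prime_gt_0_nat)
  finally show ?thesis .
qed

text \<open>Moebius inversion of the factorisation of X^n - 1 over the divisors of n, with
  denominators multiplied out so that the identity stays inside the polynomial ring.\<close>

lemma cyclotomic_three_primes:
  fixes p q r :: nat
  assumes "prime p" "prime q" "prime r" "p \<noteq> q" "p \<noteq> r" "q \<noteq> r"
  defines "F \<equiv> \<lambda>n. Polynomial.monom 1 n - 1 :: int poly"
  shows "cyclotomic (p * q * r) * F (p * q) * F (p * r) * F (q * r) * F 1 = F (p * q * r) * F p * F q * F r"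
proof -
  have pos: "p > 0" "q > 0" "r > 0" using assms by (auto simp: prime_gt_0_nat)
  have nd: "\<not> p dvd q" "\<not> p dvd r" "\<not> q dvd r" "\<not> p dvd q * r"
    using assms by (auto simp: primes_dvd_imp_eq prime_dvd_mult_iff)
  have F: "(\<Prod>d\<in>{d. d dvd n}. cyclotomic d) = F n" if "n > 0" for n
    unfolding F_def using that by (rule prod_cyclotomic)
  have div1: "{d. d dvd (1::nat)} = {1}" by auto
  have divp: "{d. d dvd x} = {1, x}" if "prime x" for x :: nat
    using that by (auto simp: prime_nat_iff)
  have Fm: "F (x * m) = F m * (\<Prod>d\<in>{d. d dvd m}. cyclotomic (x * d))" if "prime x" "m > 0" "\<not> x dvd m" for x m
    using prod_divisors_prime_mult[OF that, of cyclotomic] F[of m] F[of "x * m"] that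
    by (simp add: prime_gt_0_nat)
  have ne: "p \<noteq> 1" "q \<noteq> 1" "r \<noteq> 1" using assms by auto
  have 1: "F p = F 1 * cyclotomic p" using Fm[of p 1] assms(1) ne(1) div1 by simp
  have 2: "F (p * q) = F q * (cyclotomic p * cyclotomic (p * q))"
    using Fm[of p q] assms(1-6) pos nd divp[of q] ne by simp
  have 3: "F (p * r) = F r * (cyclotomic p * cyclotomic (p * r))"
    using Fm[of p r] assms(1-6) pos nd divp[of r] ne by simp
  have "(\<Prod>d\<in>{d. d dvd q * r}. cyclotomic (p * d)) =
     (\<Prod>d\<in>{d. d dvd r}. cyclotomic (p * d)) * (\<Prod>d\<in>{d. d dvd r}. cyclotomic (p * (q * d)))"
    using assms pos nd by (intro prod_divisors_prime_mult) auto
  also have "\<dots> = cyclotomic p * cyclotomic (p * r) * (cyclotomic (p * q) * cyclotomic (p * q * r))"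
    using assms divp[of r] ne by (simp add: mult_ac)
  finally have 4: "F (p * q * r) = F (q * r) * (cyclotomic p * cyclotomic (p * r) * (cyclotomic (p * q) * cyclotomic (p * q * r)))"
    using Fm[of p "q * r"] assms(1-6) pos nd by (simp add: mult.assoc)
  show ?thesis unfolding 1 2 3 4 by (simp add: mult_ac)
qed

lemma sum_powers_geometric:
  fixes y :: "'a :: comm_ring_1"
  assumes "m \<le> n"
  shows "(\<Sum>i\<in>{m..<n}. y ^ (i * k)) * (1 - y ^ k) = y ^ (m * k) - y ^ (n * k)"
  using assms
proof (induction n rule: dec_induct)
  case (step n)
  have "(\<Sum>i\<in>{m..<Suc n}. y ^ (i * k)) * (1 - y ^ k) = y ^ (m * k) - y ^ (n * k) + y ^ (n * k) * (1 - y ^ k)"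
    using step by (simp add: distrib_right)
  also have "\<dots> = y ^ (m * k) - y ^ (Suc n * k)"
    by (simp add: algebra_simps power_add)
  finally show ?case .
qed simp

text \<open>The two rectangles of exponents of the binary cyclotomic polynomial, found by Lam and Leung.\<close>
lemma binary_rectangles:
  fixes y :: "'a :: comm_ring_1" and p q u l :: nat
  assumes ul: "u * p + l * q = p * q + 1" and "u \<le> q" "l \<le> p"
  shows "((\<Sum>a\<in>{0..<u}. \<Sum>b\<in>{0..<l}. y ^ (a * p + b * q))
        - (\<Sum>a\<in>{u..<q}. \<Sum>b\<in>{l..<p}. y ^ (a * p + b * q - p * q))) * (1 - y ^ p) * (1 - y ^ q)
       = (1 - y) * (1 - y ^ (p * q))"
proof -
  have le: "p * q \<le> a * p + b * q" if "a \<ge> u" "b \<ge> l" for a b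
    using add_mono[OF mult_le_mono1[OF that(1), of p] mult_le_mono1[OF that(2), of q]] ul by linarith
  \<comment> \<open>The corner of the negative rectangle has exponent u * p + l * q - p * q = 1, so
    that sum is \<open>y\<close> times a sum over a rectangle starting at the origin.\<close>
  have split: "a * p + b * q - p * q = (a - u) * p + (b - l) * q + 1" if "a \<ge> u" "b \<ge> l" for a b
  proof -
    have "(u + x) * p + (l + y) * q = x * p + y * q + (p * q + 1)" for x y
      unfolding add_mult_distrib ul[symmetric] by linarith
    from this[of "a - u" "b - l"] show ?thesis using that by simp
  qed
  have G: "(\<Sum>i\<in>{0..<n}. y ^ (i * k)) * (1 - y ^ k) = 1 - y ^ (n * k)" for n k
    using sum_powers_geometric[of 0 n y k] by simp
  have "(\<Sum>a\<in>{0..<u}. \<Sum>b\<in>{0..<l}. y ^ (a * p + b * q)) = (\<Sum>a\<in>{0..<u}. y ^ (a * p)) * (\<Sum>b\<in>{0..<l}. y ^ (b * q))"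
    by (simp add: sum_product power_add)
  then have A: "(\<Sum>a\<in>{0..<u}. \<Sum>b\<in>{0..<l}. y ^ (a * p + b * q)) * (1 - y ^ p) * (1 - y ^ q)
     = ((\<Sum>a\<in>{0..<u}. y ^ (a * p)) * (1 - y ^ p)) * ((\<Sum>b\<in>{0..<l}. y ^ (b * q)) * (1 - y ^ q))"
    by (simp add: mult_ac)
  have "(\<Sum>a\<in>{u..<q}. \<Sum>b\<in>{l..<p}. y ^ (a * p + b * q - p * q))
     = (\<Sum>a\<in>{u..<q}. \<Sum>b\<in>{l..<p}. y ^ ((a - u) * p) * y ^ ((b - l) * q) * y)"
    by (intro sum.cong refl) (simp add: split power_add)
  also have "\<dots> = (\<Sum>a\<in>{u..<q}. y ^ ((a - u) * p)) * (\<Sum>b\<in>{l..<p}. y ^ ((b - l) * q)) * y"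
    unfolding sum_product by (simp only: sum_distrib_right)
  also have "(\<Sum>a\<in>{u..<q}. y ^ ((a - u) * p)) = (\<Sum>a\<in>{0..<q - u}. y ^ (a * p))"
    by (rule sum.reindex_bij_witness[of _ "\<lambda>a. a + u" "\<lambda>a. a - u"]) auto
  also have "(\<Sum>b\<in>{l..<p}. y ^ ((b - l) * q)) = (\<Sum>b\<in>{0..<p - l}. y ^ (b * q))"
    by (rule sum.reindex_bij_witness[of _ "\<lambda>a. a + l" "\<lambda>a. a - l"]) auto
  finally have B: "(\<Sum>a\<in>{u..<q}. \<Sum>b\<in>{l..<p}. y ^ (a * p + b * q - p * q)) * (1 - y ^ p) * (1 - y ^ q)
     = ((\<Sum>a\<in>{0..<q - u}. y ^ (a * p)) * (1 - y ^ p)) * ((\<Sum>b\<in>{0..<p - l}. y ^ (b * q)) * (1 - y ^ q)) * y"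
    by (simp add: mult_ac)
  have "(q - u) * p + u * p = p * q" "(p - l) * q + l * q = p * q"
    unfolding add_mult_distrib[symmetric] using assms(2,3) by simp_all
  then have e1: "(q - u) * p + 1 = l * q" "(p - l) * q + 1 = u * p"
    and "(q - u) * p + (p - l) * q + 1 = p * q"
    using ul by linarith+
  then have y3: "y ^ ((q - u) * p) * y ^ ((p - l) * q) * y = y ^ (p * q)" by (metis power_add power_one_right)
  have y12: "y ^ ((q - u) * p) * y = y ^ (l * q)" "y ^ ((p - l) * q) * y = y ^ (u * p)"
    using e1 by (metis power_add power_one_right)+
  have y4: "y ^ (u * p) * y ^ (l * q) = y ^ (p * q) * y"
    using ul by (metis power_add power_one_right)
  have "((\<Sum>a\<in>{0..<u}. \<Sum>b\<in>{0..<l}. y ^ (a * p + b * q))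
        - (\<Sum>a\<in>{u..<q}. \<Sum>b\<in>{l..<p}. y ^ (a * p + b * q - p * q))) * (1 - y ^ p) * (1 - y ^ q)
     = (1 - y ^ (u * p)) * (1 - y ^ (l * q)) - (1 - y ^ ((q - u) * p)) * (1 - y ^ ((p - l) * q)) * y"
    unfolding left_diff_distrib A B G by simp
  also have "\<dots> = (1 - y ^ (u * p) - y ^ (l * q) + y ^ (u * p) * y ^ (l * q))
       - (y - y ^ ((q - u) * p) * y - y ^ ((p - l) * q) * y + y ^ ((q - u) * p) * y ^ ((p - l) * q) * y)"
    by (simp add: algebra_simps)
  also have "\<dots> = (1 - y) * (1 - y ^ (p * q))"
    unfolding y12 y3 y4 by (simp add: algebra_simps)
  finally show ?thesis .
qed


lemma fps_of_poly_monom_minus_1: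
  "fps_of_poly (Polynomial.monom 1 n - 1 :: int poly) = fps_X ^ n - 1"
  by (simp add: fps_of_poly_diff fps_of_poly_monom)

text \<open>The coefficients of \<open>(1 - X\<^sup>p) * (1 - X\<^sup>q) / ((1 - X) * (1 - X\<^bsup>p * q\<^esup>))\<close>.\<close>
definition periodic_window :: "nat \<Rightarrow> nat \<Rightarrow> nat \<Rightarrow> int" where
  "periodic_window p q j = (\<Sum>i<p. of_bool (j mod (p * q) = i) - of_bool (j mod (p * q) = q + i))"

text \<open>The quotient is (1 + ... + X^(p - 1)) * (1 - X^q) times the geometric series
  \<open>G\<close> in X^(p * q); p + q \<le> p * q keeps the exponents q + i below the
  period.\<close>

lemma periodic_window_fps:
  assumes "p > 0" "p + q \<le> p * q"
  shows "Abs_fps (periodic_window p q) * (1 - fps_X) * (1 - fps_X ^ (p * q)) = (1 - fps_X ^ p) * (1 - fps_X ^ q)"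
proof -
  define N where "N = p * q"
  define G :: "int fps" where "G = Abs_fps (\<lambda>n. of_bool (N dvd n))"
  have N: "N > 0" using assms by (cases q) (simp_all add: N_def)
  have G: "G * (1 - fps_X ^ N) = 1"
  proof (rule fps_ext)
    fix n
    have "N dvd n \<longleftrightarrow> N dvd n - N" if "N \<le> n" using that by (simp add: dvd_minus_self)
    moreover have "\<not> N dvd n" if "n < N" "n \<noteq> 0" using that by (auto dest: dvd_imp_le)
    ultimately show "(G * (1 - fps_X ^ N)) $ n = 1 $ n"
      using N by (auto simp: right_diff_distrib G_def fps_X_power_mult_right_nth)
  qed
  have coeff: "(G * fps_X ^ k) $ j = of_bool (j mod N = k)" if "k < N" for k j
  proof (cases "j < k")
    case True
    then show ?thesis using that by (simp add: fps_X_power_mult_right_nth)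
  next
    case False
    then have "N dvd j - k \<longleftrightarrow> j mod N = k"
      using that by (metis mod_eq_dvd_iff_nat mod_less not_less)
    then show ?thesis using False by (simp add: fps_X_power_mult_right_nth G_def)
  qed
  have "Abs_fps (periodic_window p q) = (\<Sum>i<p. G * fps_X ^ i - G * fps_X ^ (q + i))"
    using assms N_def
    by (intro fps_ext) (simp add: fps_sum_nth coeff periodic_window_def)
  also have "\<dots> = G * (\<Sum>i<p. fps_X ^ i) * (1 - fps_X ^ q)"
    by (simp add: sum_distrib_left sum_distrib_right power_add algebra_simps sum_subtractf)
  finally have "Abs_fps (periodic_window p q) * (1 - fps_X) * (1 - fps_X ^ (p * q))
      = (G * (1 - fps_X ^ N)) * ((1 - fps_X) * (\<Sum>i<p. fps_X ^ i)) * (1 - fps_X ^ q)"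
    by (simp add: N_def mult_ac)
  then show ?thesis unfolding G one_diff_power_eq[symmetric] by simp
qed

lemma fps_X_power_neq_1: "n > 0 \<Longrightarrow> 1 - fps_X ^ n \<noteq> (0 :: int fps)"
proof
  assume "n > 0" and 0: "1 - fps_X ^ n = (0 :: int fps)"
  have "(1 - fps_X ^ n :: int fps) $ 0 = 1"
    using \<open>n > 0\<close> by (simp add: fps_X_power_iff)
  then show False unfolding 0 by simp
qed

text \<open>The identity for three primes is cancelled in the integral domain of power series:
  \<open>binary_rectangles\<close> at \<open>fps_X ^ r\<close> accounts for the factors involving r,
  \<open>periodic_window_fps\<close> for the rest.\<close>

lemma fps_of_ternary_cyclotomic:
  fixes p q r u l :: nat
  assumes "prime p" "prime q" "prime r" "p \<noteq> q" "p \<noteq> r" "q \<noteq> r"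
    and ul: "u * p + l * q = p * q + 1" "u \<le> q" "l \<le> p"
  shows "fps_of_poly (cyclotomic (p * q * r)) =
    ((\<Sum>a\<in>{0..<u}. \<Sum>b\<in>{0..<l}. fps_X ^ (r * (a * p + b * q)))
      - (\<Sum>a\<in>{u..<q}. \<Sum>b\<in>{l..<p}. fps_X ^ (r * (a * p + b * q - p * q))))
    * Abs_fps (periodic_window p q)" (is "?P = ?A * ?E")
proof -
  have pos: "p > 0" "q > 0" "r > 0" "p \<ge> 2" "q \<ge> 2"
    using assms(1-3) by (auto simp: prime_gt_0_nat prime_ge_2_nat)
  obtain i j where "p = 2 + i" "q = 2 + j" using pos by (metis le_iff_add)
  then have "p + q \<le> p * q" by simp
  note E = periodic_window_fps[OF pos(1) this]
  let ?Y = "fps_X ^ r :: int fps"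
  have A: "?A * (1 - ?Y ^ p) * (1 - ?Y ^ q) = (1 - ?Y) * (1 - ?Y ^ (p * q))"
    using binary_rectangles[OF ul, of ?Y] by (simp only: power_mult[symmetric])
  have "?P * (fps_X ^ (p * q) - 1) * (fps_X ^ (p * r) - 1) * (fps_X ^ (q * r) - 1) * (fps_X ^ 1 - 1)
     = (fps_X ^ (p * q * r) - 1) * (fps_X ^ p - 1) * (fps_X ^ q - 1) * (fps_X ^ r - 1)"
    using arg_cong[OF cyclotomic_three_primes[OF assms(1-6)], of fps_of_poly]
    by (simp only: fps_of_poly_mult fps_of_poly_monom_minus_1)
  moreover have "x - 1 = - (1 - x)" for x :: "int fps" by simp
  ultimately have "?P * ((1 - fps_X) * (1 - fps_X ^ (p * q)) * ((1 - ?Y ^ p) * (1 - ?Y ^ q)))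
     = (1 - fps_X ^ p) * (1 - fps_X ^ q) * ((1 - ?Y) * (1 - ?Y ^ (p * q)))"
    by (simp only: mult_minus_left mult_minus_right minus_minus power_one_right power_mult[symmetric]
        mult.assoc mult.commute mult.left_commute)
  also have "\<dots> = ?A * ?E * ((1 - fps_X) * (1 - fps_X ^ (p * q)) * ((1 - ?Y ^ p) * (1 - ?Y ^ q)))"
    unfolding A[symmetric] E[symmetric] by (simp only: mult_ac)
  finally show ?thesis
    using fps_X_power_neq_1[of 1] fps_X_power_neq_1[of "p * q"] fps_X_power_neq_1[of "r * p"] fps_X_power_neq_1[of "r * q"] pos
    by (simp add: power_mult)
qed


section \<open>Coefficients as windows\<close>

text \<open>\<open>u\<close> exists exactly when p divides e * q + 1, hence when p divides h * e +
  1. The congruence for \<open>r\<close> decouples the two coordinates, and p * q < r decouples both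
  from the truncation.\<close>

locale cyclotomic_window =
  fixes p q r h e u :: nat
  assumes primes: "prime p" "prime q" "prime r"
    and pe: "0 < e" "e \<le> h" "2 * h < p" "2 * p ^ 2 \<le> q" "p * q < r"
    and u: "u * p = e * q + 1"
    and q_cong: "[q = h] (mod p)"
    and r_cong: "[int r * (int q - int p) = 1] (mod (int p * int q))"
begin

sublocale binary_window "int p" "int q" "int h" "int e" "int p - int e" "int u"
proof
  show "2 * (int p)\<^sup>2 \<le> int q" using pe(4) by (metis of_nat_le_iff of_nat_mult of_nat_numeral of_nat_power)
  have "int u * int p = int e * int q + 1" using u by (metis of_nat_1 of_nat_add of_nat_mult)
  then show "int u * int p + (int p - int e) * int q = int p * int q + 1" by (simp add: algebra_simps)
qed (use pe in auto)

lemma p_less_q: "p < q" and pq_pos: "p > 0" "q > 0"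
proof -
  show "p > 0" using pe by simp
  then have "p \<le> p * p" by simp
  then show "p < q" using pe(4) \<open>p > 0\<close> unfolding power2_eq_square by linarith
  then show "q > 0" by simp
qed

lemma coprime_pq: "coprime (int p) (int q)"
  using primes p_less_q by (simp add: primes_coprime)

lemma rectangle: "u * p + (p - e) * q = p * q + 1" "u \<le> q" "p - e \<le> p"
proof -
  show "u * p + (p - e) * q = p * q + 1" using u pe
    by (simp add: diff_mult_distrib)
  show "u \<le> q" using mu_bounds by simp
qed simp

definition trunc_exponent :: "nat \<Rightarrow> nat \<Rightarrow> nat" where
  "trunc_exponent a b = (if a < u \<and> b < p - e then a * p + b * q else a * p + b * q - p * q)"

text \<open>A term X^(r * v) reaches degree n only if v \<le> n div r; this is the truncation in
  \<open>trunc\<close>. Both rectangles can then be summed over the whole q by p grid, with zeros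
  elsewhere.\<close>

lemma coeff_rectangles:
  "poly.coeff (cyclotomic (p * q * r)) n =
    (\<Sum>a\<in>{0..<q}. \<Sum>b\<in>{0..<p}. trunc (int (n div r)) (int a) (int b)
        * periodic_window p q (n - r * trunc_exponent a b))"
proof -
  define M where "M = n div r"
  have r: "r > 0" using primes by (simp add: prime_gt_0_nat)
  have le: "r * v \<le> n \<longleftrightarrow> v \<le> M" for v
    unfolding M_def using r by (simp add: less_eq_div_iff_mult_less_eq mult.commute)
  have "int (u * p + (p - e) * q) = int (p * q + 1)" using rectangle(1) by simp
  have large: "p * q \<le> a * p + b * q" if "a \<ge> u" "b \<ge> p - e" for a b
    using add_mono[OF mult_le_mono1[OF that(1), of p] mult_le_mono1[OF that(2), of q]] rectangle(1) by linarith
  have nth: "(fps_X ^ k * Abs_fps (periodic_window p q)) $ n = of_bool (k \<le> n) * periodic_window p q (n - k)" for k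
    by (simp add: fps_X_power_mult_nth)
  have plus: "trunc (int M) (int a) (int b) = of_bool (r * trunc_exponent a b \<le> n)" "trunc_exponent a b = a * p + b * q"
    if "a < u" "b < p - e" for a b
  proof -
    show *: "trunc_exponent a b = a * p + b * q" using that by (simp add: trunc_exponent_def)
    have "int a * int p + int b * int q \<le> int M \<longleftrightarrow> a * p + b * q \<le> M"
      by (metis of_nat_add of_nat_le_iff of_nat_mult)
    moreover have "int b < int p - int e" using that by linarith
    ultimately show "trunc (int M) (int a) (int b) = of_bool (r * trunc_exponent a b \<le> n)"
      unfolding * le using that by (simp add: trunc_def)
  qed
  have minus: "trunc (int M) (int a) (int b) = - of_bool (r * trunc_exponent a b \<le> n)" "trunc_exponent a b = a * p + b * q - p * q"
    if "u \<le> a" "p - e \<le> b" for a b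
  proof -
    show *: "trunc_exponent a b = a * p + b * q - p * q" using that by (simp add: trunc_exponent_def)
    have "int a * int p + int b * int q \<le> int M + int p * int q \<longleftrightarrow> a * p + b * q \<le> M + p * q"
      by (metis of_nat_add of_nat_le_iff of_nat_mult)
    then show "trunc (int M) (int a) (int b) = - of_bool (r * trunc_exponent a b \<le> n)"
      unfolding * le using that large[OF that] pe by (auto simp: trunc_def of_nat_diff)
  qed
  have zero: "trunc (int M) (int a) (int b) = 0" if "(a < u) \<noteq> (b < p - e)" for a b
    using that pe by (auto simp: trunc_def)
  define T where "T = (\<lambda>a b. trunc (int M) (int a) (int b) * periodic_window p q (n - r * trunc_exponent a b))"
  have "poly.coeff (cyclotomic (p * q * r)) n = fps_of_poly (cyclotomic (p * q * r)) $ n" by simp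
  also have "\<dots> = (\<Sum>a\<in>{0..<u}. \<Sum>b\<in>{0..<p - e}. T a b) + (\<Sum>a\<in>{u..<q}. \<Sum>b\<in>{p - e..<p}. T a b)"
    unfolding T_def
    by (subst fps_of_ternary_cyclotomic[OF primes _ _ _ rectangle])
      (use p_less_q pe in \<open>auto simp: left_diff_distrib sum_distrib_right fps_sum_nth nth plus minus sum_negf\<close>)
  also have "(\<Sum>a\<in>{0..<u}. \<Sum>b\<in>{0..<p - e}. T a b) = (\<Sum>a\<in>{0..<u}. \<Sum>b\<in>{0..<p}. T a b)"
    by (intro sum.cong refl sum.mono_neutral_left) (auto simp: T_def zero)
  also have "(\<Sum>a\<in>{u..<q}. \<Sum>b\<in>{p - e..<p}. T a b) = (\<Sum>a\<in>{u..<q}. \<Sum>b\<in>{0..<p}. T a b)"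
    by (intro sum.cong refl sum.mono_neutral_left) (auto simp: T_def zero)
  also have "(\<Sum>a\<in>{0..<u}. \<Sum>b\<in>{0..<p}. T a b) + (\<Sum>a\<in>{u..<q}. \<Sum>b\<in>{0..<p}. T a b) = (\<Sum>a\<in>{0..<q}. \<Sum>b\<in>{0..<p}. T a b)"
    using rectangle by (simp add: sum.atLeastLessThan_concat)
  finally show ?thesis by (simp add: T_def M_def)
qed

text \<open>They turn n - r * (a * p + b * q) into n - b modulo p and n + a modulo q, so a residue
  of the remaining degree fixes each coordinate by itself.\<close>

lemma r_mult_q: "[int r * int q = 1] (mod int p)" and r_mult_p: "[int r * int p = - 1] (mod int q)"
proof -
  have "int p dvd int r * (int q - int p) - 1" "int q dvd int r * (int q - int p) - 1"
    using r_cong by (auto simp: cong_iff_dvd_diff elim: dvd_mult_left dvd_mult_right)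
  then have "int p dvd (int r * (int q - int p) - 1) + int p * int r" "int q dvd - (int r * (int q - int p) - 1) + int q * int r"
    by (auto simp del: minus_diff_eq)
  then show "[int r * int q = 1] (mod int p)" "[int r * int p = - 1] (mod int q)"
    by (simp_all add: cong_iff_dvd_diff algebra_simps)
qed

lemma window_point:
  assumes "a < q" "b < p" "r * trunc_exponent a b \<le> n" "k < p * q" "a < u \<and> b < p - e \<or> a \<ge> u \<and> b \<ge> p - e"
  shows "(n - r * trunc_exponent a b) mod (p * q) = k \<longleftrightarrow>
    int a = (int k - int n) mod int q \<and> int b = (int n - int k) mod int p"
proof -
  define v where "v = trunc_exponent a b"
  have large: "p * q \<le> a * p + b * q" if "a \<ge> u" "b \<ge> p - e"
    using add_mono[OF mult_le_mono1[OF that(1), of p] mult_le_mono1[OF that(2), of q]] rectangle(1) by linarith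
  \<comment> \<open>The reduction by p * q in the negative rectangle is a multiple of the modulus,
    so it drops out of both congruences.\<close>
  obtain z where v: "int v = int a * int p + int b * int q - z * (int p * int q)"
  proof (cases "a < u \<and> b < p - e")
    case True
    then show ?thesis using that[of 0] by (simp add: v_def trunc_exponent_def)
  next
    case False
    then have "p * q \<le> a * p + b * q" using large assms(5) by auto
    then have "int v = int a * int p + int b * int q - 1 * (int p * int q)"
      using False by (auto simp: v_def trunc_exponent_def of_nat_diff)
    then show ?thesis by (rule that)
  qed
  define c where "c = int n - int r * int v"
  have c: "int (n - r * v) = c" using assms(3) by (simp add: c_def v_def of_nat_diff)
  have "(n - r * v) mod (p * q) = k \<longleftrightarrow> [n - r * v = k] (mod (p * q))"
    using assms(4) by (auto simp: cong_def)
  also have "\<dots> \<longleftrightarrow> [c = int k] (mod (int p * int q))"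
    unfolding c[symmetric] by (metis cong_int_iff of_nat_mult)
  also have "\<dots> \<longleftrightarrow> [c = int k] (mod int p) \<and> [c = int k] (mod int q)"
    using coprime_pq by (metis coprime_cong_mult cong_modulus_mult mult.commute)
  also have "[c = int k] (mod int q) \<longleftrightarrow> [int a = int k - int n] (mod int q)"
  proof -
    have "c = int n - int a * (int r * int p) - int q * (int r * (int b - z * int p))"
      unfolding c_def v by (simp add: algebra_simps)
    also have "[\<dots> = int n - int a * (- 1) - 0] (mod int q)"
      by (intro cong_diff cong_mult cong_refl r_mult_p) (simp add: cong_0_iff)
    finally have "[c = int n + int a] (mod int q)" by simp
    then have "[c = int k] (mod int q) \<longleftrightarrow> [int n + int a = int k] (mod int q)"
      by (meson cong_sym cong_trans)
    also have "\<dots> \<longleftrightarrow> [int a = int k - int n] (mod int q)"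
      by (simp add: cong_iff_dvd_diff algebra_simps)
    finally show ?thesis .
  qed
  also have "\<dots> \<longleftrightarrow> int a = (int k - int n) mod int q"
    using assms(1) by (auto simp: cong_def)
  also have "[c = int k] (mod int p) \<longleftrightarrow> [int b = int n - int k] (mod int p)"
  proof -
    have "c = int n - int b * (int r * int q) - int p * (int r * (int a - z * int q))"
      unfolding c_def v by (simp add: algebra_simps)
    also have "[\<dots> = int n - int b * 1 - 0] (mod int p)"
      by (intro cong_diff cong_mult cong_refl r_mult_q) (simp add: cong_0_iff)
    finally have "[c = int n - int b] (mod int p)" by simp
    then have "[c = int k] (mod int p) \<longleftrightarrow> [int n - int b = int k] (mod int p)"
      by (meson cong_sym cong_trans)
    also have "\<dots> \<longleftrightarrow> [int b = int n - int k] (mod int p)"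
      using dvd_minus_iff[of "int p" "int n - int b - int k"] by (simp add: cong_iff_dvd_diff algebra_simps)
    finally show ?thesis .
  qed
  also have "\<dots> \<longleftrightarrow> int b = (int n - int k) mod int p"
    using assms(2) by (auto simp: cong_def)
  finally show ?thesis unfolding v_def by blast
qed

text \<open>A nonzero \<open>trunc\<close> guarantees that the natural subtraction is genuine, so
  \<open>window_point\<close> applies and leaves a single grid point for each residue
  \<open>k\<close>.\<close>

lemma sum_window_point:
  assumes "k < p * q"
  shows "(\<Sum>a\<in>{0..<q}. \<Sum>b\<in>{0..<p}. trunc (int (n div r)) (int a) (int b)
        * of_bool ((n - r * trunc_exponent a b) mod (p * q) = k))
    = trunc (int (n div r)) ((int k - int n) mod int q) ((int n - int k) mod int p)"
proof -
  define T where "T = trunc (int (n div r))"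
  define a0 where "a0 = nat ((int k - int n) mod int q)"
  define b0 where "b0 = nat ((int n - int k) mod int p)"
  have a0: "int a0 = (int k - int n) mod int q" "a0 < q" using pq_pos by (auto simp: a0_def nat_less_iff)
  have b0: "int b0 = (int n - int k) mod int p" "b0 < p" using pq_pos by (auto simp: b0_def nat_less_iff)
  have r: "r > 0" using primes by (simp add: prime_gt_0_nat)
  have le: "r * v \<le> n \<longleftrightarrow> v \<le> n div r" for v
    using r by (simp add: less_eq_div_iff_mult_less_eq mult.commute)
  have pt: "T (int a) (int b) * of_bool ((n - r * trunc_exponent a b) mod (p * q) = k)
      = (if a = a0 then if b = b0 then T (int a0) (int b0) else 0 else 0)"
    if "a \<in> {0..<q}" "b \<in> {0..<p}" for a b
  proof (cases "T (int a) (int b) = 0")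
    case True
    then show ?thesis by auto
  next
    case False
    have ab: "a < u \<and> b < p - e \<or> a \<ge> u \<and> b \<ge> p - e"
      using False pe by (auto simp: T_def trunc_def split: if_splits)
    have "trunc_exponent a b \<le> n div r"
    proof (cases "a < u \<and> b < p - e")
      case True
      then have "int a * int p + int b * int q \<le> int (n div r)"
        using False by (auto simp: T_def trunc_def split: if_splits)
      then have "a * p + b * q \<le> n div r" by (metis of_nat_add of_nat_le_iff of_nat_mult)
      then show ?thesis using True by (simp add: trunc_exponent_def)
    next
      case False': False
      then have "int a * int p + int b * int q \<le> int (n div r) + int p * int q"
        using False ab by (auto simp: T_def trunc_def split: if_splits)
      then have "a * p + b * q \<le> n div r + p * q" by (metis of_nat_add of_nat_le_iff of_nat_mult)
      then show ?thesis using False' by (auto simp: trunc_exponent_def)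
    qed
    then have "(n - r * trunc_exponent a b) mod (p * q) = k \<longleftrightarrow> int a = int a0 \<and> int b = int b0"
      using window_point[of a b n k] that assms ab le a0 b0 by simp
    then show ?thesis by auto
  qed
  have "(\<Sum>a\<in>{0..<q}. \<Sum>b\<in>{0..<p}. T (int a) (int b) * of_bool ((n - r * trunc_exponent a b) mod (p * q) = k))
     = (\<Sum>a\<in>{0..<q}. \<Sum>b\<in>{0..<p}. if a = a0 then if b = b0 then T (int a0) (int b0) else 0 else 0)"
    by (intro sum.cong refl pt)
  also have "\<dots> = (\<Sum>a\<in>{0..<q}. if a = a0 then \<Sum>b\<in>{0..<p}. if b = b0 then T (int a0) (int b0) else 0 else 0)"
    by (intro sum.cong) auto
  also have "\<dots> = T (int a0) (int b0)" using a0 b0 by simp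
  finally show ?thesis using a0 b0 by (simp add: T_def)
qed

text \<open>Residue i < p picks the point (i - n, n - i), so the positive block of
  \<open>periodic_window\<close> runs along a diagonal. Residue q + i has the same first coordinate
  modulo q and, as q is congruent to h, a second coordinate smaller by h.\<close>

lemma coeff_eq_window:
  "poly.coeff (cyclotomic (p * q * r)) n = window (int (n div r)) ((- int n) mod int q) (int n)"
proof -
  define T where "T = trunc (int (n div r))"
  have small: "i < p * q" "q + i < p * q" if "i < p" for i
  proof -
    have "p \<ge> 2" using pe by simp
    then have "2 * q \<le> p * q" by simp
    then show "i < p * q" "q + i < p * q" using that p_less_q by linarith+
  qed
  have "poly.coeff (cyclotomic (p * q * r)) n
    = (\<Sum>i<p. (\<Sum>a\<in>{0..<q}. \<Sum>b\<in>{0..<p}. T (int a) (int b) * of_bool ((n - r * trunc_exponent a b) mod (p * q) = i))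
        - (\<Sum>a\<in>{0..<q}. \<Sum>b\<in>{0..<p}. T (int a) (int b) * of_bool ((n - r * trunc_exponent a b) mod (p * q) = q + i)))"
    unfolding coeff_rectangles periodic_window_def T_def sum_distrib_left sum_subtractf[symmetric] right_diff_distrib
    by (subst (2) sum.swap, subst sum.swap) simp
  also have "\<dots> = (\<Sum>i<p. T ((int i - int n) mod int q) ((int n - int i) mod int p)
        - T ((int (q + i) - int n) mod int q) ((int n - int (q + i)) mod int p))"
    unfolding T_def
    by (intro sum.cong refl arg_cong2[where f = minus] sum_window_point) (use small in auto)
  also have "\<dots> = (\<Sum>i<p. T (((- int n) mod int q + int i) mod int q) ((int n - int i) mod int p)
        - T (((- int n) mod int q + int i) mod int q) ((int n - int h - int i) mod int p))"
  proof (intro sum.cong refl arg_cong2[where f = minus] arg_cong2[where f = T])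
    fix i
    show "(int i - int n) mod int q = ((- int n) mod int q + int i) mod int q"
      by (simp add: mod_simps)
    have "(int (q + i) - int n) mod int q = (int q + (int i - int n)) mod int q"
      by (simp only: of_nat_add add_diff_eq)
    also have "\<dots> = (int i - int n) mod int q" by (rule mod_add_self1)
    finally show "(int (q + i) - int n) mod int q = ((- int n) mod int q + int i) mod int q"
      by (simp add: mod_simps)
    have "[int q = int h] (mod int p)" using q_cong by (simp add: cong_int_iff)
    then have "[int n - int q - int i = int n - int h - int i] (mod int p)"
      by (intro cong_diff cong_refl)
    then show "(int n - int (q + i)) mod int p = (int n - int h - int i) mod int p"
      by (simp add: cong_def algebra_simps)
  qed
  also have "\<dots> = window (int (n div r)) ((- int n) mod int q) (int n)"
    unfolding window_def T_def sum_subtractf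
    by (intro arg_cong2[where f = minus] sum.reindex_bij_witness[of _ nat int]) auto
  finally show ?thesis .
qed

lemma q_less_r: "q < r"
proof -
  have "q \<le> p * q" using pq_pos by simp
  then show ?thesis using pe(5) by linarith
qed

text \<open>Because p * q < r, the remainder of n modulo r can realise any residue modulo p * q
  while n div r stays fixed at \<open>M\<close>.\<close>

lemma exists_coeff_eq_window:
  assumes "M \<ge> 0"
  shows "\<exists>n. poly.coeff (cyclotomic (p * q * r)) n = window M ((- a) mod int q) b"
proof -
  define m where "m = nat M"
  have m: "int m = M" using assms by (simp add: m_def)
  obtain x where x: "[x = b] (mod int p)" "[x = a] (mod int q)"
    using binary_chinese_remainder_int[OF coprime_pq] by blast
  define k where "k = nat ((x - int (r * m)) mod (int p * int q))"
  have k: "int k = (x - int (r * m)) mod (int p * int q)" "k < p * q"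
    using pq_pos by (auto simp: k_def nat_less_iff)
  define n where "n = r * m + k"
  have "k < r" using k(2) pe(5) by linarith
  then have "n div r = m" by (simp add: n_def)
  have "[int k = x - int (r * m)] (mod (int p * int q))" using k(1) by (simp add: cong_def)
  then have "[int (r * m) + int k = int (r * m) + (x - int (r * m))] (mod (int p * int q))"
    by (intro cong_add cong_refl)
  then have nx: "[int n = x] (mod (int p * int q))" by (simp add: n_def)
  have np: "[int n = b] (mod int p)" using cong_trans[OF cong_modulus_mult[OF nx] x(1)] .
  have nq: "[int n = a] (mod int q)"
    using cong_trans[OF cong_modulus_mult[OF nx[unfolded mult.commute[of "int p"]]] x(2)] .
  have "(int n - j) mod int p = (b - j) mod int p" "(int n - int h - j) mod int p = (b - int h - j) mod int p" for j
    using cong_diff[OF np cong_refl[of j]] cong_diff[OF np cong_refl[of "int h + j"]]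
    by (simp_all add: cong_def diff_diff_eq)
  moreover have "(- int n) mod int q = (- a) mod int q"
    using cong_diff[OF cong_refl[of 0] nq] by (simp add: cong_def)
  ultimately have "poly.coeff (cyclotomic (p * q * r)) n = window M ((- a) mod int q) b"
    unfolding coeff_eq_window \<open>n div r = m\<close> m window_def by simp
  then show ?thesis ..
qed

lemma cyclotomic_diameter_eq: "cyclotomic_diameter (p * q * r) = 2 * int h + 1"
proof -
  let ?c = "poly.coeff (cyclotomic (p * q * r))"
  have h: "h > 0" using pe by simp
  have bounds: "?c n \<le> int h" "?c n \<ge> - int h - 1" for n
    using window_bounds[of "(- int n) mod int q"] pq_pos by (auto simp: coeff_eq_window)
  have neg_h: "(- int h) mod int q = int q - int h"
    using pe p_less_q h by (simp add: zmod_zminus1_eq_if)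
  have "int p * int p * 2 \<le> int q" using q by (simp add: power2_eq_square)
  moreover have "int q * 1 \<le> int q * (int p - int h)" using pe by (intro mult_left_mono) auto
  moreover have "int p * int p \<ge> 0" by simp
  ultimately have "(int p - int h) * int q - int p ^ 2 \<ge> 0" unfolding power2_eq_square
    by (simp only: mult.commute[of "int q"])
  from exists_coeff_eq_window[OF this, of "int h" "int p - 1"]
  obtain n1 where n1: "?c n1 = int h" unfolding neg_h window_attains_upper by blast
  have "(int p - 2 - int h) * int p + int h * int q \<ge> 0" using pe by simp
  from exists_coeff_eq_window[OF this, of "int h" "int h - 1"]
  obtain n2 where n2: "?c n2 = - int h - 1" unfolding neg_h window_attains_lower by blast
  \<comment> \<open>Both extremal values are nonzero because h > 0, which places their indices
    within the degree, as \<open>coeff_set\<close> requires.\<close>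
  have "n1 \<le> degree (cyclotomic (p * q * r))" "n2 \<le> degree (cyclotomic (p * q * r))"
    using n1 n2 h by (auto intro!: le_degree)
  then have mem: "int h \<in> coeff_set (cyclotomic (p * q * r))" "- int h - 1 \<in> coeff_set (cyclotomic (p * q * r))"
    unfolding coeff_set_def using n1 n2 by (metis atMost_iff imageI)+
  have "Max (coeff_set (cyclotomic (p * q * r))) = int h"
    using mem bounds by (intro Max_eqI) (auto simp: coeff_set_def)
  moreover have "Min (coeff_set (cyclotomic (p * q * r))) = - int h - 1"
    using mem bounds by (intro Min_eqI) (auto simp: coeff_set_def)
  ultimately show ?thesis by (simp add: cyclotomic_diameter_def)
qed

end

section \<open>The cyclotomic polynomial of order 105\<close>

text \<open>The exponents 15, 21 and 105 are multiples of 3, so factoring y^3 - 1 cancels most of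
  the three-prime identity; what remains is a product identity between explicit coefficient
  lists.\<close>

lemma cyclotomic_105:
  "cyclotomic (3 * 5 * 7) =
     [:1, 1, 1, 0, 0, - 1, - 1, - 2, - 1, - 1, 0, 0, 1, 1, 1, 1, 1, 1, 0, 0, - 1, 0, - 1, 0, - 1,
       0, - 1, 0, - 1, 0, 0, 1, 1, 1, 1, 1, 1, 0, 0, - 1, - 1, - 2, - 1, - 1, 0, 0, 1, 1, 1:]"
  (is "_ = ?C")
proof -
  define x where "x = (Polynomial.monom 1 1 :: int poly)"
  have m: "Polynomial.monom 1 n = x ^ n" for n unfolding x_def by (simp add: monom_power)
  have xs: "1 + x + x ^ 2 = [:1, 1, 1:]"
    "1 + x ^ 5 + x ^ 10 = [:1, 0, 0, 0, 0, 1, 0, 0, 0, 0, 1:]"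
    "1 + x ^ 7 + x ^ 14 = [:1, 0, 0, 0, 0, 0, 0, 1, 0, 0, 0, 0, 0, 0, 1:]"
    "x ^ 35 = [:0, 0, 0, 0, 0, 0, 0, 0, 0, 0, 0, 0, 0, 0, 0, 0, 0, 0, 0, 0, 0, 0, 0, 0, 0, 0, 0, 0, 0,
      0, 0, 0, 0, 0, 0, 1:]"
    unfolding m[symmetric] by (simp_all add: x_def numeral_eq_Suc monom_Suc one_pCons)
  have geo: "y ^ 3 - 1 = (y - 1) * (1 + y + y ^ 2)" for y :: "int poly"
    by (simp add: algebra_simps power2_eq_square power3_eq_cube)
  have nz: "x ^ n - 1 \<noteq> 0" if "n > 0" for n
  proof
    assume "x ^ n - 1 = 0"
    then have "poly (x ^ n - 1) 2 = 0" by simp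
    then show False using that by (simp add: x_def poly_monom poly_power)
  qed
  have "cyclotomic (3 * 5 * 7) * (x ^ 15 - 1) * (x ^ 21 - 1) * (x ^ 35 - 1) * (x - 1)
      = (x ^ 105 - 1) * (x ^ 3 - 1) * (x ^ 5 - 1) * (x ^ 7 - 1)"
    using cyclotomic_three_primes[of 3 5 7] by (simp add: m)
  moreover have "x ^ 15 - 1 = (x ^ 5 - 1) * (1 + x ^ 5 + x ^ 10)" 
    "x ^ 21 - 1 = (x ^ 7 - 1) * (1 + x ^ 7 + x ^ 14)" "x ^ 105 - 1 = (x ^ 35 - 1) * (1 + x ^ 35 + x ^ 35 * x ^ 35)"
    using geo[of "x ^ 5"] geo[of "x ^ 7"] geo[of "x ^ 35"] by (simp_all flip: power_mult power_add)
  ultimately have "((x ^ 5 - 1) * (x ^ 7 - 1) * (x ^ 35 - 1) * (x - 1)) *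
       (cyclotomic (3 * 5 * 7) * (1 + x ^ 5 + x ^ 10) * (1 + x ^ 7 + x ^ 14)) =
     ((x ^ 5 - 1) * (x ^ 7 - 1) * (x ^ 35 - 1) * (x - 1)) *
       ((1 + x ^ 35 + x ^ 35 * x ^ 35) * (1 + x + x ^ 2))"
    unfolding geo[of x] by (simp only: mult_ac)
  then have "cyclotomic (3 * 5 * 7) * (1 + x ^ 5 + x ^ 10) * (1 + x ^ 7 + x ^ 14) =
      (1 + x ^ 35 + x ^ 35 * x ^ 35) * (1 + x + x ^ 2)"
    using nz[of 1] nz[of 5] nz[of 7] nz[of 35] by simp
  also have "\<dots> = (1 + x + x ^ 2) * (1 + x ^ 35 + x ^ 35 * x ^ 35)" by (rule mult.commute)
  also have "\<dots> = (1 + x ^ 5 + x ^ 10) * ((1 + x ^ 7 + x ^ 14) * ?C)"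
    unfolding xs by (simp add: one_pCons)
  finally have "cyclotomic (3 * 5 * 7) * ((1 + x ^ 5 + x ^ 10) * (1 + x ^ 7 + x ^ 14)) =
      ?C * ((1 + x ^ 5 + x ^ 10) * (1 + x ^ 7 + x ^ 14))"
    by (simp only: mult_ac)
  moreover have "(1 + x ^ 5 + x ^ 10) * (1 + x ^ 7 + x ^ 14) \<noteq> 0" unfolding xs by simp
  ultimately show ?thesis by (metis mult_right_cancel)
qed

lemma coeff_set_eq_coeffs:
  assumes "P \<noteq> 0"
  shows "coeff_set P = set (coeffs P)"
  using assms unfolding coeff_set_def coeffs_def
  by (simp only: if_False set_map set_upt atLeast0LessThan lessThan_Suc_atMost)

lemma cyclotomic_diameter_105: "cyclotomic_diameter (3 * 5 * 7) = 3"
proof -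
  have "coeff_set (cyclotomic (3 * 5 * 7)) = set (coeffs (cyclotomic (3 * 5 * 7)))"
    by (rule coeff_set_eq_coeffs) (unfold cyclotomic_105, simp)
  also have "\<dots> = {- 2, - 1, 0, 1}" unfolding cyclotomic_105 by (simp add: insert_commute)
  finally show ?thesis unfolding cyclotomic_diameter_def by simp
qed

section \<open>A large prime factor in a progression\<close>

text \<open>Leaving out the last or the first term gives two shorter progressions whose products
  divide the same number M. With z the last term, M * z and M * a are then multiples of the full
  product, and so is their difference M * (n + 1) * d.\<close>

lemma prod_progression_dvd:
  fixes a d L :: int
  assumes "\<And>k. k \<le> n \<Longrightarrow> (a + int k * d) dvd L"
  shows "(\<Prod>k\<le>n. a + int k * d) dvd fact n * d ^ n * L"
  using assms
proof (induction n arbitrary: a)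
  case (Suc n)
  define B where "B = (\<Prod>k<n. a + int (Suc k) * d)"
  define M where "M = fact n * d ^ n * L"
  define z where "z = a + int (Suc n) * d"
  have "(\<Prod>k\<le>n. a + int k * d) dvd M" unfolding M_def
    by (rule Suc.IH) (use Suc.prems in auto)
  moreover have "(\<Prod>k\<le>n. a + int k * d) = a * B"
    by (simp only: B_def lessThan_Suc_atMost[symmetric] prod.lessThan_Suc_shift) simp
  ultimately obtain x where x: "M = a * B * x" by auto
  have "(\<Prod>k\<le>n. (a + d) + int k * d) dvd M" unfolding M_def
  proof (rule Suc.IH)
    fix k assume "k \<le> n"
    then show "(a + d) + int k * d dvd L" using Suc.prems[of "Suc k"] by (simp add: algebra_simps)
  qed
  moreover have "(\<Prod>k\<le>n. (a + d) + int k * d) = B * z"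
    by (simp add: B_def z_def lessThan_Suc_atMost[symmetric] algebra_simps)
  ultimately obtain y where y: "M = B * z * y" by auto
  have "fact (Suc n) * d ^ Suc n * L = M * (z - a)"
    by (simp add: M_def z_def algebra_simps)
  also have "\<dots> = M * z - M * a" by (simp add: algebra_simps)
  also have "\<dots> = (a * B * x) * z - (B * z * y) * a" by (subst x[symmetric], subst y[symmetric]) simp
  also have "\<dots> = (a * B * z) * (x - y)" by (simp add: algebra_simps)
  also have "a * B * z = (\<Prod>k\<le>Suc n. a + int k * d)"
    using \<open>_ = a * B\<close> by (simp add: z_def)
  finally show ?case by simp
qed simp

text \<open>Apart from 2, 3 and 5, primes lie in the 8 residue classes coprime to 30; the constant
  is 15 * (8 + 3).\<close>

lemma card_primes_le: "15 * card {p. prime p \<and> p \<le> n} \<le> 4 * n + 165"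
proof -
  define R :: "nat set" where "R = {1, 7, 11, 13, 17, 19, 23, 29}"
  have "{p. prime p \<and> p \<le> n} - {2, 3, 5} \<subseteq> (\<lambda>(i, r). 30 * i + r) ` ({..n div 30} \<times> R)"
  proof
    fix p assume p: "p \<in> {p. prime p \<and> p \<le> n} - {2, 3, 5}"
    have "\<not> k dvd p" if "k \<in> {2, 3, 5}" for k
      using p that by (auto simp: prime_nat_iff)
    from this[of 2] this[of 3] this[of 5] have "p mod 2 \<noteq> 0" "p mod 3 \<noteq> 0" "p mod 5 \<noteq> 0"
      by (simp_all add: dvd_eq_mod_eq_0)
    then have "p mod 30 mod 2 \<noteq> 0" "p mod 30 mod 3 \<noteq> 0" "p mod 30 mod 5 \<noteq> 0" by (simp_all add: mod_mod_cancel)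
    moreover have "p mod 30 < 30" by simp
    moreover have "\<forall>r<30. r mod 2 \<noteq> 0 \<longrightarrow> r mod 3 \<noteq> 0 \<longrightarrow> r mod 5 \<noteq> 0 \<longrightarrow> r \<in> R"
      unfolding R_def by code_simp
    ultimately have "p mod 30 \<in> R" by blast
    moreover have "p div 30 \<le> n div 30" using p by (auto intro: div_le_mono)
    ultimately show "p \<in> (\<lambda>(i, r). 30 * i + r) ` ({..n div 30} \<times> R)"
      by (intro image_eqI[of _ _ "(p div 30, p mod 30)"]) auto
  qed
  then have "card ({p. prime p \<and> p \<le> n} - {2, 3, 5}) \<le> card ((\<lambda>(i, r). 30 * i + r) ` ({..n div 30} \<times> R))"
    by (intro card_mono) (auto simp: R_def)
  also have "\<dots> \<le> card ({..n div 30} \<times> R)" by (intro card_image_le) (auto simp: R_def)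
  also have "\<dots> = 8 * (n div 30 + 1)" by (simp add: R_def card_cartesian_product)
  finally have "card {p. prime p \<and> p \<le> n} \<le> 8 * (n div 30 + 1) + card {2, 3, 5 :: nat}"
    using card_Diff_subset_Int[of "{p. prime p \<and> p \<le> n}" "{2, 3, 5}"] diff_card_le_card_Diff[of "{2, 3, 5}" "{p. prime p \<and> p \<le> n}"] by simp
  then show ?thesis by simp
qed

text \<open>
  Otherwise the least common multiple of the numbers \<open>h * e + 1\<close> is a product of \<open>\<pi>(2 * h)\<close> prime
  powers of size at most \<open>h\<^sup>2 + 1\<close>, while \<open>prod_progression_dvd\<close> bounds it below by \<open>h ^ (h + 1)\<close>.
\<close>
lemma large_prime_divisor_large:
  fixes h :: nat
  assumes h: "h \<ge> 206"
  shows "\<exists>e\<in>{1..h}. \<exists>p. prime p \<and> p > 2 * h \<and> p dvd h * e + 1"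
proof (rule ccontr)
  assume none: "\<not> ?thesis"
  define A where "A = (\<lambda>e. h * e + 1)"
  define P where "P = {p. prime p \<and> p \<le> 2 * h}"
  define K where "K = (\<lambda>p. Max ((\<lambda>e. multiplicity p (A e)) ` {1..h}))"
  \<comment> \<open>\<open>L\<close> is the least common multiple of all \<open>A e\<close>,
    assembled from the largest prime exponents.\<close>
  define L where "L = (\<Prod>p\<in>P. p ^ K p)"
  have finP: "finite P" unfolding P_def by (rule finite_subset[of _ "{..2 * h}"]) auto
  have A_le: "A e \<le> h ^ 2 + 1" if "e \<in> {1..h}" for e
    using that by (simp add: A_def power2_eq_square)
  have K_ge: "multiplicity p (A e) \<le> K p" if "e \<in> {1..h}" for p e
    unfolding K_def using that by (intro Max_ge) auto
  have pK: "p ^ K p \<le> h ^ 2 + 1" for p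
  proof -
    have "K p \<in> (\<lambda>e. multiplicity p (A e)) ` {1..h}"
      unfolding K_def using h by (intro Max_in) auto
    then obtain e where e: "e \<in> {1..h}" "K p = multiplicity p (A e)" by auto
    have "p ^ K p dvd A e" unfolding e(2) by (rule multiplicity_dvd)
    then have "p ^ K p \<le> A e" by (rule dvd_imp_le) (simp add: A_def)
    then show ?thesis using A_le[OF e(1)] by simp
  qed
  have A_dvd: "A e dvd L" if e: "e \<in> {1..h}" for e
  proof -
    have "A e = (\<Prod>p\<in>prime_factors (A e). p ^ multiplicity p (A e))"
      using prod_prime_factors[of "A e"] by (simp add: A_def)
    also have "\<dots> dvd L" unfolding L_def
    proof (rule prod_dvd_prod_subset2[OF finP])
      show "prime_factors (A e) \<subseteq> P"
      proof
        fix p assume "p \<in> prime_factors (A e)"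
        then have "prime p" "p dvd h * e + 1" by (auto simp: A_def)
        with none e show "p \<in> P" unfolding P_def by (metis (mono_tags, lifting) mem_Collect_eq not_less)
      qed
      fix p show "p ^ multiplicity p (A e) dvd p ^ K p" by (intro le_imp_power_dvd K_ge e)
    qed
    finally show ?thesis .
  qed
  have "(\<Prod>k\<le>h - 1. int (h + 1) + int k * int h) dvd fact (h - 1) * int h ^ (h - 1) * int L"
  proof (rule prod_progression_dvd)
    fix k assume "k \<le> h - 1"
    then have "A (Suc k) dvd L" using h by (intro A_dvd) (simp; linarith)
    then have "int (A (Suc k)) dvd int L" by simp
    then show "int (h + 1) + int k * int h dvd int L" by (simp add: A_def algebra_simps)
  qed
  also have "(\<Prod>k\<le>h - 1. int (h + 1) + int k * int h) = int (\<Prod>e\<in>{1..h}. A e)"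
    unfolding of_nat_prod A_def
    by (rule prod.reindex_bij_witness[of _ "\<lambda>e. e - 1" Suc]) (use h in \<open>auto simp: algebra_simps of_nat_diff\<close>)
  also have "fact (h - 1) * int h ^ (h - 1) * int L = int (h ^ (h - 1) * (fact (h - 1) * L))"
    by (simp add: mult_ac)
  finally have "(\<Prod>e\<in>{1..h}. A e) dvd h ^ (h - 1) * (fact (h - 1) * L)" by (simp only: of_nat_dvd_iff)
  \<comment> \<open>Each h * e + 1 is coprime to h, so the power of h coming from the common
    difference can be removed.\<close>
  moreover have "coprime (\<Prod>e\<in>{1..h}. A e) (h ^ (h - 1))"
  proof -
    have "coprime (A e) h" for e
    proof (rule coprimeI)
      fix c assume "c dvd A e" "c dvd h"
      then have "c dvd A e - h * e" by (intro dvd_diff_nat) auto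
      then show "is_unit c" by (simp add: A_def)
    qed
    then show ?thesis by (intro prod_coprime_left) auto
  qed
  ultimately have "(\<Prod>e\<in>{1..h}. A e) dvd fact (h - 1) * L"
    by (simp add: coprime_dvd_mult_right_iff)
  moreover have "L > 0" unfolding L_def P_def by (intro prod_pos) (auto simp: prime_gt_0_nat)
  ultimately have le: "(\<Prod>e\<in>{1..h}. A e) \<le> fact (h - 1) * L" by (intro dvd_imp_le) auto
  have "h * fact (h - 1) = \<Prod>{1..h}" using h fact_reduce[of h, where 'a = nat] by (simp add: fact_prod)
  then have "fact (h - 1) * (h ^ h * h) = (\<Prod>e\<in>{1..h}. h * e)"
    by (simp add: prod.distrib mult_ac)
  also have "\<dots> \<le> (\<Prod>e\<in>{1..h}. A e)" by (intro prod_mono) (auto simp: A_def)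
  also note le
  finally have "h ^ h * h \<le> L" by (simp only: mult_le_cancel1) simp
  then have hL: "h ^ (h + 1) \<le> L" by (simp add: mult.commute)
  \<comment> \<open>Primes above h occur at most to the first power, since (h + 1)^2 exceeds h^2 +
    1, and so contribute at most 2 * h; only primes up to h are charged 2 * h^2.\<close>
  define P1 where "P1 = {p. prime p \<and> p \<le> h}"
  have P1: "P1 \<subseteq> P" "finite P1" using finP by (auto simp: P1_def P_def intro: finite_subset)
  have "L = (\<Prod>p\<in>P1. p ^ K p) * (\<Prod>p\<in>P - P1. p ^ K p)"
    unfolding L_def using P1 finP by (metis mult.commute prod.subset_diff)
  also have "\<dots> \<le> (\<Prod>p\<in>P1. 2 * h ^ 2) * (\<Prod>p\<in>P - P1. 2 * h)"
  proof (intro mult_le_mono prod_mono conjI)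
    fix p show "p ^ K p \<le> 2 * h ^ 2" using pK[of p] h one_le_power[of h 2] by linarith
  next
    fix p assume p: "p \<in> P - P1"
    then have "p > h" "p \<le> 2 * h" by (auto simp: P_def P1_def)
    have "K p < 2"
    proof (rule ccontr)
      assume "\<not> K p < 2"
      then have "p ^ 2 \<le> p ^ K p" using \<open>p > h\<close> by (intro power_increasing) auto
      moreover have "(h + 1) ^ 2 \<le> p ^ 2" using \<open>p > h\<close> by (intro power_mono) auto
      ultimately have "(h + 1) ^ 2 \<le> h ^ 2 + 1" using pK[of p] by linarith
      then show False using h by (simp add: power2_eq_square)
    qed
    then have "K p = 0 \<or> K p = 1" by auto
    then show "p ^ K p \<le> 2 * h" using \<open>p \<le> 2 * h\<close> h by auto
  qed auto
  also have "\<dots> = 2 ^ card P * h ^ (card P1 + card P)"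
  proof -
    have c: "card P = card P1 + card (P - P1)" using P1 finP by (simp add: card_Diff_subset card_mono)
    show ?thesis unfolding c by (simp add: power_mult_distrib power_add power2_eq_square mult_ac)
  qed
  finally have "h ^ (h + 1) \<le> 2 ^ card P * h ^ (card P1 + card P)" using hL by simp
  \<comment> \<open>After the sixth power the factors of 2 become 64 \<le> h, so both sides are
    bounded by powers of h and exponents can be compared.\<close>
  then have "(h ^ (h + 1)) ^ 6 \<le> (2 ^ card P * h ^ (card P1 + card P)) ^ 6" by (intro power_mono) auto
  also have "\<dots> = (2 ^ 6) ^ card P * h ^ (6 * (card P1 + card P))"
    by (simp only: power_mult_distrib power_mult[symmetric] mult.commute)
  also have "\<dots> \<le> h ^ card P * h ^ (6 * (card P1 + card P))"
    using h by (intro mult_le_mono power_mono) auto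
  also have "(h ^ (h + 1)) ^ 6 = h ^ (6 * (h + 1))" by (simp only: power_mult[symmetric] mult.commute)
  finally have "h ^ (6 * (h + 1)) \<le> h ^ (card P + 6 * (card P1 + card P))"
    by (simp only: power_add[of h "card P"])
  then have "6 * (h + 1) \<le> card P + 6 * (card P1 + card P)"
    using h by (subst (asm) power_increasing_iff) auto
  then have "6 * h + 6 \<le> 7 * card P + 6 * card P1" by simp
  \<comment> \<open>Multiplied by 15 the estimates give 90 * h + 90 \<le> 80 * h + 2145, which fails
    from h = 206 on; this is the origin of the threshold.\<close>
  moreover have "15 * card P \<le> 8 * h + 165" "15 * card P1 \<le> 4 * h + 165"
    using card_primes_le[of "2 * h"] card_primes_le[of h] by (simp_all add: P_def P1_def)
  ultimately show False using h by linarith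
qed


section \<open>Large prime factors for small h\<close>

lemma primeI_trial_division:
  fixes n k :: nat
  assumes "n > 1" "n < k * k" "\<forall>d\<in>set [2..<k]. d dvd n \<longrightarrow> d = n"
  shows "prime n"
proof (rule ccontr)
  assume "\<not> prime n"
  obtain p where p: "prime p" "p dvd n" using prime_factor_nat[of n] assms by auto
  obtain m where m: "n = p * m" using p by auto
  have "m \<noteq> 1" "m \<noteq> 0" using m \<open>\<not> prime n\<close> p assms by auto
  define d where "d = min p m"
  have d: "d \<ge> 2" "d dvd n"
    using p m \<open>m \<noteq> 1\<close> \<open>m \<noteq> 0\<close> by (auto simp: d_def min_def prime_ge_2_nat)
  have dd: "d * d \<le> n" unfolding m d_def by (intro mult_le_mono) auto
  have "d < k" using dd assms(2) by (meson le_less_trans mult_le_mono not_less)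
  moreover have "d < d * d" using d by simp
  ultimately show False using assms(3) d dd by auto
qed

text \<open>All entries are below 32 * 32, so trial division by numbers below 32 settles
  them.\<close>

lemma small_primes: "list_all prime
    [5, 7, 13, 29, 41, 53, 61, 73, 163, 193, 277, 281, 353, 379, 409, 421, 461, 967 :: nat]"
  by (simp only: list.pred_inject simp_thms, intro conjI; rule primeI_trial_division[of _ 32]; simp)

text \<open>Triples (h, e, p) for the h below the threshold 206. The primes come from a pool of 18,
  so that few primality proofs cover all entries.\<close>

definition small_witnesses :: "(nat \<times> nat \<times> nat) list" where
  "small_witnesses = [
    (2, 2, 5), (3, 2, 7), (4, 3, 13), (5, 5, 13), (6, 2, 13), (7, 4, 29), (8, 5, 41), (9, 9, 41),
    (10, 4, 41), (11, 11, 61), (12, 12, 29), (13, 4, 53), (14, 2, 29), (15, 7, 53), (16, 12, 193),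
    (17, 12, 41), (18, 4, 73), (19, 16, 61), (20, 2, 41), (21, 5, 53), (22, 12, 53), (23, 23, 53),
    (24, 11, 53), (25, 13, 163), (26, 2, 53), (27, 9, 61), (28, 13, 73), (29, 21, 61),
    (30, 2, 61), (31, 21, 163), (32, 6, 193), (33, 17, 281), (34, 15, 73), (35, 25, 73),
    (36, 2, 73), (37, 22, 163), (38, 30, 163), (39, 36, 281), (40, 7, 281), (41, 27, 277),
    (42, 42, 353), (43, 19, 409), (44, 8, 353), (45, 30, 193), (46, 6, 277), (47, 15, 353),
    (48, 4, 193), (49, 36, 353), (50, 27, 193), (51, 38, 277), (52, 47, 163), (53, 53, 281),
    (54, 3, 163), (55, 7, 193), (56, 32, 163), (57, 20, 163), (58, 50, 967), (59, 58, 163),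
    (60, 19, 163), (61, 8, 163), (62, 28, 193), (63, 49, 193), (64, 28, 163), (65, 5, 163),
    (66, 38, 193), (67, 62, 277), (68, 39, 379), (69, 4, 277), (70, 4, 281), (71, 39, 277),
    (72, 43, 163), (73, 37, 193), (74, 11, 163), (75, 18, 193), (76, 15, 163), (77, 5, 193),
    (78, 47, 193), (79, 33, 163), (80, 55, 163), (81, 2, 163), (82, 40, 193), (83, 10, 277),
    (84, 21, 353), (85, 84, 193), (86, 49, 281), (87, 47, 409), (88, 4, 353), (89, 13, 193),
    (90, 15, 193), (91, 70, 277), (92, 86, 193), (93, 83, 193), (94, 39, 193), (95, 65, 193),
    (96, 2, 193), (97, 84, 281), (98, 65, 277), (99, 82, 353), (100, 36, 277), (101, 15, 379),
    (102, 19, 277), (103, 30, 281), (104, 85, 421), (105, 74, 409), (106, 81, 277),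
    (107, 44, 277), (108, 13, 281), (109, 68, 353), (110, 31, 379), (111, 81, 281),
    (112, 104, 353), (113, 92, 281), (114, 17, 277), (115, 32, 409), (116, 109, 281),
    (117, 116, 277), (118, 50, 281), (119, 85, 281), (120, 30, 277), (121, 35, 353),
    (122, 84, 277), (123, 9, 277), (124, 37, 353), (125, 48, 353), (126, 14, 353), (127, 98, 461),
    (128, 90, 281), (129, 73, 277), (130, 49, 277), (131, 74, 277), (132, 128, 277),
    (133, 69, 353), (134, 31, 277), (135, 119, 277), (136, 3, 409), (137, 93, 277), (138, 2, 277),
    (139, 106, 421), (140, 2, 281), (141, 5, 353), (142, 87, 353), (143, 53, 379), (144, 50, 379),
    (145, 115, 379), (146, 122, 379), (147, 12, 353), (148, 31, 353), (149, 117, 379),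
    (150, 40, 353), (151, 128, 379), (152, 36, 421), (153, 139, 409), (154, 41, 421),
    (155, 22, 379), (156, 17, 379), (157, 70, 379), (158, 105, 353), (159, 111, 353),
    (160, 45, 379), (161, 57, 353), (162, 154, 409), (163, 93, 379), (164, 104, 461),
    (165, 147, 379), (166, 121, 379), (167, 93, 353), (168, 97, 379), (169, 74, 379),
    (170, 166, 409), (171, 82, 379), (172, 130, 379), (173, 46, 379), (174, 71, 353),
    (175, 108, 461), (176, 2, 353), (177, 88, 421), (178, 66, 379), (179, 127, 421),
    (180, 40, 379), (181, 67, 379), (182, 177, 379), (183, 23, 421), (184, 138, 379),
    (185, 42, 409), (186, 43, 421), (187, 152, 379), (188, 127, 379), (189, 2, 379),
    (190, 127, 409), (191, 108, 421), (192, 12, 461), (193, 89, 409), (194, 78, 409),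
    (195, 26, 461), (196, 74, 967), (197, 191, 409), (198, 126, 409), (199, 55, 421),
    (200, 182, 409), (201, 178, 967), (202, 164, 409), (203, 137, 409), (204, 2, 409),
    (205, 115, 421)]"

lemma map_fst_small_witnesses: "map fst small_witnesses = [2..<206]"
  unfolding small_witnesses_def by simp

lemma small_witnesses_valid:
  "list_all (\<lambda>(h, e, p). 1 \<le> e \<and> e \<le> h \<and> 2 * h < p \<and> p dvd h * e + 1) small_witnesses"
  unfolding small_witnesses_def by simp

lemma small_witnesses_prime:
  assumes "(h, e, p) \<in> set small_witnesses"
  shows "prime p"
proof -
  have "p \<in> set (map (snd \<circ> snd) small_witnesses)" using assms by force
  also have "set (map (snd \<circ> snd) small_witnesses) \<subseteq>
      set [5, 7, 13, 29, 41, 53, 61, 73, 163, 193, 277, 281, 353, 379, 409, 421, 461, 967]"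
    unfolding small_witnesses_def by simp
  finally show ?thesis using small_primes unfolding list_all_iff by blast
qed

lemma large_prime_divisor:
  fixes h :: nat
  assumes h: "h \<ge> 2"
  shows "\<exists>e\<in>{1..h}. \<exists>p. prime p \<and> p > 2 * h \<and> p dvd h * e + 1"
proof (cases "h \<ge> 206")
  case False
  then have "h \<in> {2..<206}" using h by auto
  then have "h \<in> set (map fst small_witnesses)" by (simp only: map_fst_small_witnesses set_upt)
  then obtain e p where "(h, e, p) \<in> set small_witnesses"
    by (auto simp only: set_map image_iff fst_conv split_paired_all)
  moreover from this have "1 \<le> e \<and> e \<le> h \<and> 2 * h < p \<and> p dvd h * e + 1"
    using small_witnesses_valid unfolding list_all_iff by blast
  ultimately show ?thesis using small_witnesses_prime by (intro bexI[of _ e] exI[of _ p]) auto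
qed (rule large_prime_divisor_large)

section \<open>Mertens' estimates\<close>

text \<open>Pairs of n and a divisor d correspond to factorisations n = d * k with k \<le> N div
  d.\<close>

lemma sum_divisors_swap:
  fixes f :: "nat \<Rightarrow> nat \<Rightarrow> 'a :: comm_monoid_add"
  shows "(\<Sum>n\<in>{1..N}. \<Sum>d | d dvd n. f d (n div d)) = (\<Sum>d\<in>{1..N}. \<Sum>k\<in>{1..N div d}. f d k)"
proof -
  have "(\<Sum>n\<in>{1..N}. \<Sum>d | d dvd n. f d (n div d)) = (\<Sum>(n, d)\<in>(SIGMA n:{1..N}. {d. d dvd n}). f d (n div d))"
    by (intro sum.Sigma) auto
  also have "\<dots> = (\<Sum>(d, k)\<in>(SIGMA d:{1..N}. {1..N div d}). f d k)"
  proof (rule sum.reindex_bij_witness[of _ "\<lambda>(d, k). (d * k, d)" "\<lambda>(n, d). (d, n div d)"], goal_cases)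
    case (2 a)
    then obtain n d k where "a = (n, d)" "n = d * k" "1 \<le> n" "n \<le> N" by (auto elim!: dvdE)
    moreover from this have "1 \<le> d" "1 \<le> k" by (cases d; cases k; simp)+
    moreover from this have "d * 1 \<le> d * k" by (intro mult_le_mono2)
    moreover from this have "d \<le> N" using \<open>n = d * k\<close> \<open>n \<le> N\<close> by linarith
    ultimately show ?case using div_le_mono[of "d * k" N d] by auto
  next
    case (4 b)
    obtain d k where b: "b = (d, k)" "1 \<le> d" "1 \<le> k" "k \<le> N div d" using 4 by auto
    then have "d * k \<le> N" by (metis div_times_less_eq_dividend le_trans mult.commute mult_le_mono2)
    then show ?case using b by auto
  qed auto
  also have "\<dots> = (\<Sum>d\<in>{1..N}. \<Sum>k\<in>{1..N div d}. f d k)"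
    by (rule sum.Sigma[symmetric]) auto
  finally show ?thesis .
qed

lemma sum_by_parts:
  fixes f F :: "nat \<Rightarrow> complex" and g :: "nat \<Rightarrow> real"
  assumes "a \<le> b" "F a = 0" and F: "\<And>n. n \<ge> a \<Longrightarrow> F (Suc n) = F n + f n"
  shows "(\<Sum>n\<in>{a..<b}. f n * of_real (g n)) =
    F b * of_real (g b) + (\<Sum>n\<in>{a..<b}. F (Suc n) * of_real (g n - g (Suc n)))"
  using assms(1)
proof (induction b rule: dec_induct)
  case base
  then show ?case using assms(2) by simp
next
  case (step n)
  have "(\<Sum>n\<in>{a..<Suc n}. f n * of_real (g n)) = F n * of_real (g n)
      + (\<Sum>n\<in>{a..<n}. F (Suc n) * of_real (g n - g (Suc n))) + f n * of_real (g n)"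
    using step by simp
  also have "\<dots> = F (Suc n) * of_real (g (Suc n)) + (F (Suc n) * of_real (g n - g (Suc n))
      + (\<Sum>n\<in>{a..<n}. F (Suc n) * of_real (g n - g (Suc n))))"
  proof -
    have "x * u + S + y * u = (x + y) * v + ((x + y) * (u - v) + S)" for x y u v S :: complex
      by (simp add: algebra_simps)
    then show ?thesis by (simp only: F[OF step(1)] of_real_diff)
  qed
  also have "\<dots> = F (Suc n) * of_real (g (Suc n)) + (\<Sum>n\<in>{a..<Suc n}. F (Suc n) * of_real (g n - g (Suc n)))"
    using step(1) by (simp add: add.commute)
  finally show ?case .
qed

text \<open>Summation by parts moves the differences onto the monotone weight, where they telescope.
  It serves for character sums, whose partial sums stay bounded.\<close>

lemma norm_sum_decreasing_le:
  fixes f :: "nat \<Rightarrow> complex" and g :: "nat \<Rightarrow> real"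
  assumes "a \<le> b" and B: "\<And>c. norm (\<Sum>n\<in>{a..<c}. f n) \<le> B"
    and g: "\<And>n. n \<ge> a \<Longrightarrow> g (Suc n) \<le> g n" "\<And>n. n \<ge> a \<Longrightarrow> g n \<ge> 0"
  shows "norm (\<Sum>n\<in>{a..<b}. f n * of_real (g n)) \<le> B * g a"
proof -
  have "norm (\<Sum>n\<in>{a..<b}. f n * of_real (g n)) \<le> norm ((\<Sum>n\<in>{a..<b}. f n) * of_real (g b))
      + norm (\<Sum>n\<in>{a..<b}. (\<Sum>k\<in>{a..<Suc n}. f k) * of_real (g n - g (Suc n)))"
    by (subst sum_by_parts[OF assms(1), of "\<lambda>c. \<Sum>n\<in>{a..<c}. f n"]) (auto intro: norm_triangle_ineq)
  also have "\<dots> \<le> B * g b + (\<Sum>n\<in>{a..<b}. B * (g n - g (Suc n)))"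
  proof (intro add_mono sum_norm_le)
    show "norm ((\<Sum>n\<in>{a..<b}. f n) * of_real (g b)) \<le> B * g b"
      unfolding norm_mult norm_of_real using B[of b] g(2)[OF assms(1)] by (simp add: mult_right_mono)
    fix n assume "n \<in> {a..<b}"
    then have "g n - g (Suc n) \<ge> 0" using g(1)[of n] by simp
    then show "norm ((\<Sum>k\<in>{a..<Suc n}. f k) * of_real (g n - g (Suc n))) \<le> B * (g n - g (Suc n))"
      unfolding norm_mult norm_of_real using B[of "Suc n"] by (metis abs_of_nonneg mult_right_mono)
  qed
  also have "(\<Sum>n\<in>{a..<b}. B * (g n - g (Suc n))) = B * (g a - g b)"
    using sum_Suc_diff'[OF assms(1), of "\<lambda>n. - g n"] by (simp add: sum_distrib_left[symmetric])
  finally show ?thesis by (simp add: algebra_simps)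
qed

lemma ln_fact_bounds:
  assumes "N \<ge> 1"
  shows "ln (fact N) \<ge> real N * ln N - N" "ln (fact N :: real) \<le> real N * ln N"
proof -
  show "ln (fact N) \<ge> real N * ln N - N"
    using assms
  proof (induction N rule: dec_induct)
    case (step n)
    have "ln (1 + 1 / real n) \<le> 1 / real n" using step by (intro ln_add_one_self_le_self) auto
    also have "ln (1 + 1 / real n) = ln (real (Suc n)) - ln (real n)"
    proof -
      have "1 + 1 / real n = real (Suc n) / real n" using step by (simp add: field_simps)
      then show ?thesis using step by (simp add: ln_div del: of_nat_Suc)
    qed
    finally have "real n * ln (real (Suc n)) \<le> real n * ln (real n) + 1"
      using step by (simp add: field_simps)
    moreover have "ln (fact (Suc n) :: real) = ln (real (Suc n)) + ln (fact n)"
      by (simp add: ln_mult del: of_nat_Suc)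
    ultimately show ?case using step.IH by (simp add: algebra_simps)
  qed simp
  have "(fact N :: real) \<le> real N ^ N" using fact_le_power[of N, where ?'a = real] by simp
  then have "ln (fact N :: real) \<le> ln (real N ^ N)" using assms by (subst ln_le_cancel_iff) auto
  then show "ln (fact N :: real) \<le> real N * ln N" using assms by (simp add: ln_realpow)
qed

lemma sum_ln: "(\<Sum>n\<in>{1..N}. ln (real n)) = ln (fact N)"
  by (induction N) (simp_all add: ln_mult)

lemma sum_mangoldt_div: "(\<Sum>d\<in>{1..N}. mangoldt d * real (N div d)) = ln (fact N)"
proof -
  have "ln (fact N :: real) = (\<Sum>n\<in>{1..N}. \<Sum>d | d dvd n. mangoldt d)"
    unfolding sum_ln[symmetric] by (intro sum.cong refl) (simp add: mangoldt_sum)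
  also have "\<dots> = (\<Sum>d\<in>{1..N}. \<Sum>k\<in>{1..N div d}. mangoldt d)"
    by (rule sum_divisors_swap)
  finally show ?thesis by (simp add: mult.commute)
qed

text \<open>Chebyshev's argument with the central binomial coefficient, at most 4^K: the difference
  of \<open>2 * K div n\<close> and twice \<open>K div n\<close> is never negative and equals 1 for
  K < n \<le> 2 * K.\<close>

lemma sum_mangoldt_double: "(\<Sum>n\<in>{1..2 * K}. mangoldt n) \<le> (\<Sum>n\<in>{1..K}. mangoldt n) + 2 * real K"
proof -
  have "(\<Sum>n\<in>{K<..2 * K}. mangoldt n) \<le> (\<Sum>n\<in>{1..2 * K}. mangoldt n * (real (2 * K div n) - 2 * real (K div n)))"
  proof -
    have "(\<Sum>n\<in>{K<..2 * K}. mangoldt n) = (\<Sum>n\<in>{K<..2 * K}. mangoldt n * (real (2 * K div n) - 2 * real (K div n)))"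
    proof (intro sum.cong refl)
      fix n assume "n \<in> {K<..2 * K}"
      then have "K div n = 0" "2 * K div n = 1" by (auto intro: div_nat_eqI)
      then show "mangoldt n = mangoldt n * (real (2 * K div n) - 2 * real (K div n))" by simp
    qed
    also have "\<dots> \<le> (\<Sum>n\<in>{1..2 * K}. mangoldt n * (real (2 * K div n) - 2 * real (K div n)))"
    proof (intro sum_mono2 mult_nonneg_nonneg mangoldt_nonneg)
      fix n
      have "2 * (K div n) \<le> 2 * K div n" by (cases "n = 0") (auto simp: less_eq_div_iff_mult_less_eq)
      then show "0 \<le> real (2 * K div n) - 2 * real (K div n)" by linarith
    qed auto
    finally show ?thesis .
  qed
  also have "\<dots> = (\<Sum>n\<in>{1..2 * K}. mangoldt n * real (2 * K div n)) - 2 * (\<Sum>n\<in>{1..2 * K}. mangoldt n * real (K div n))"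
    by (simp add: right_diff_distrib sum_subtractf sum_distrib_left mult_ac)
  also have "(\<Sum>n\<in>{1..2 * K}. mangoldt n * real (K div n)) = (\<Sum>n\<in>{1..K}. mangoldt n * real (K div n))"
    by (rule sum.mono_neutral_right) auto
  also have "(\<Sum>n\<in>{1..2 * K}. mangoldt n * real (2 * K div n)) - 2 * \<dots> = ln (fact (2 * K)) - 2 * ln (fact K)"
    unfolding sum_mangoldt_div ..
  also have "\<dots> = ln (real (2 * K choose K))"
  proof -
    have "real (2 * K choose K) = fact (2 * K) / (fact K * fact K)"
      using binomial_fact[of K "2 * K", where ?'a = real] by simp
    then show ?thesis by (simp add: ln_div ln_mult)
  qed
  also have "\<dots> \<le> ln (2 ^ (2 * K))"
    using binomial_le_pow2[of "2 * K" K] by (subst ln_le_cancel_iff) (simp_all add: of_nat_le_numeral_power_cancel_iff)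
  also have "\<dots> = 2 * real K * ln 2" by (simp add: ln_realpow)
  also have "\<dots> \<le> 2 * real K * 1" using ln_2_less_1 by (intro mult_left_mono) auto
  finally have "(\<Sum>n\<in>{K<..2 * K}. mangoldt n) \<le> 2 * real K" by simp
  moreover have "(\<Sum>n\<in>{1..2 * K}. mangoldt n) = (\<Sum>n\<in>{1..K}. mangoldt n) + (\<Sum>n\<in>{K<..2 * K}. mangoldt n :: real)"
    by (subst sum.union_disjoint[symmetric]) (auto intro!: sum.cong)
  ultimately show ?thesis by simp
qed

lemma chebyshev_upper: "(\<Sum>n\<in>{1..N}. mangoldt n) \<le> 6 * real N"
proof (induction N rule: less_induct)
  case (less N)
  show ?case
  proof (cases "N \<ge> 2")
    case True
    \<comment> \<open>Rounding up costs one: 8 * K \<le> 4 * N + 4 \<le> 6 * N for N \<ge> 2, which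
      is where the constant 6 comes from.\<close>
    define K where "K = (N + 1) div 2"
    have K: "K < N" "N \<le> 2 * K" "2 * K \<le> N + 1" using True by (auto simp: K_def)
    have "(\<Sum>n\<in>{1..N}. mangoldt n) \<le> (\<Sum>n\<in>{1..2 * K}. mangoldt n :: real)"
      using K by (intro sum_mono2) (auto simp: mangoldt_nonneg)
    also have "\<dots> \<le> 6 * real K + 2 * real K" using sum_mangoldt_double[of K] less[OF K(1)] by linarith
    also have "\<dots> \<le> 6 * real N" using K True by linarith
    finally show ?thesis .
  next
    case False
    then have "N = 0 \<or> N = 1" by auto
    then show ?thesis by auto
  qed
qed

lemma mertens_lower: "N \<ge> 1 \<Longrightarrow> (\<Sum>n\<in>{1..N}. mangoldt n / real n) \<ge> ln N - 1"
proof -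
  assume N: "N \<ge> 1"
  have "real N * ln N - N \<le> ln (fact N)" using ln_fact_bounds[OF N] by simp
  also have "\<dots> = (\<Sum>d\<in>{1..N}. mangoldt d * real (N div d))" by (rule sum_mangoldt_div[symmetric])
  also have "\<dots> \<le> (\<Sum>d\<in>{1..N}. mangoldt d * (real N / real d))"
    by (intro sum_mono mult_left_mono mangoldt_nonneg) (rule of_nat_div_le_of_nat)
  also have "\<dots> = real N * (\<Sum>d\<in>{1..N}. mangoldt d / real d)"
    by (simp add: sum_distrib_left mult_ac)
  finally have "real N * (ln N - 1) \<le> real N * (\<Sum>d\<in>{1..N}. mangoldt d / real d)"
    by (simp add: algebra_simps)
  then show ?thesis using N by simp
qed

text \<open>Replacing N / d by its floor costs at most 1 for each d, in total the Chebyshev sum;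
  hence the constant 6.\<close>

lemma mertens_upper: "N \<ge> 1 \<Longrightarrow> (\<Sum>n\<in>{1..N}. mangoldt n / real n) \<le> ln N + 6"
proof -
  assume N: "N \<ge> 1"
  have "real N * (\<Sum>d\<in>{1..N}. mangoldt d / real d) = (\<Sum>d\<in>{1..N}. mangoldt d * (real N / real d))"
    by (simp add: sum_distrib_left mult_ac)
  also have "\<dots> \<le> (\<Sum>d\<in>{1..N}. mangoldt d * (real (N div d) + 1))"
  proof (intro sum_mono mult_left_mono mangoldt_nonneg)
    fix d show "real N / real d \<le> real (N div d) + 1" 
    proof (cases "d = 0")
      case False
      then have "N < (N div d + 1) * d" using dividend_less_div_times[of d N] by simp
      then have "real N < real ((N div d + 1) * d)" by (simp only: of_nat_less_iff)
      then show ?thesis using False by (simp add: divide_le_eq algebra_simps)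
    qed simp
  qed
  also have "\<dots> = ln (fact N) + (\<Sum>d\<in>{1..N}. mangoldt d)"
    by (simp only: distrib_left sum.distrib sum_mangoldt_div mult_1_right)
  also have "\<dots> \<le> real N * ln N + 6 * real N"
    using ln_fact_bounds(2)[OF N] chebyshev_upper[of N] by simp
  finally have "real N * (\<Sum>d\<in>{1..N}. mangoldt d / real d) \<le> real N * (ln N + 6)"
    by (simp add: algebra_simps)
  then show ?thesis using N by simp
qed

section \<open>The Moebius function\<close>

lemma sum_divisors_prime_mult:
  fixes p m :: nat and f :: "nat \<Rightarrow> 'a :: comm_monoid_add"
  assumes "prime p" "m > 0" "\<not> p dvd m"
  shows "(\<Sum>d | d dvd p * m. f d) = (\<Sum>d | d dvd m. f d) + (\<Sum>d | d dvd m. f (p * d))"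
proof -
  have "{d. d dvd m} \<inter> (*) p ` {d. d dvd m} = {}"
    using assms(3) by (auto dest: dvd_mult_left)
  then have "(\<Sum>d | d dvd p * m. f d) = (\<Sum>d | d dvd m. f d) + sum f ((*) p ` {d. d dvd m})"
    unfolding divisors_prime_mult[OF assms(1,2)]
    using assms(2) by (intro sum.union_disjoint) auto
  also have "sum f ((*) p ` {d. d dvd m}) = (\<Sum>d | d dvd m. f (p * d))"
    using assms by (intro sum.reindex_cong[where l = "(*) p"]) (auto intro!: inj_onI simp: prime_gt_0_nat)
  finally show ?thesis .
qed

definition moebius :: "nat \<Rightarrow> real" where
  "moebius n = (if squarefree n then (-1) ^ card (prime_factors n) else 0)"

lemma abs_moebius_le: "\<bar>moebius n\<bar> \<le> 1"
  by (simp add: moebius_def)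

lemma moebius_prime_mult:
  assumes "prime p" "\<not> p dvd d" "d > 0"
  shows "moebius (p * d) = - moebius d"
proof -
  have "coprime p d" using assms by (simp add: prime_imp_coprime)
  then have "squarefree (p * d) \<longleftrightarrow> squarefree d"
    using squarefree_mult_coprime[of p d] squarefree_prime[OF assms(1)] squarefree_multD(2)[of p d] by blast
  moreover have "prime_factors (p * d) = insert p (prime_factors d)"
    using assms by (subst prime_factors_product) (simp_all add: prime_prime_factors prime_gt_0_nat)
  moreover have "p \<notin> prime_factors d" using assms by auto
  ultimately show ?thesis by (simp add: moebius_def)
qed

text \<open>Fix a prime p dividing n and let m be the part of n prime to p. Divisors of n that do
  not divide p * m are not squarefree, and the others cancel in pairs d, p * d.\<close>

lemma sum_moebius_divisors:
  assumes "n > 0"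
  shows "(\<Sum>d | d dvd n. moebius d) = of_bool (n = 1)"
proof (cases "n = 1")
  case True
  then show ?thesis by (simp add: moebius_def)
next
  case False
  then obtain p where p: "prime p" "p dvd n" using prime_factor_nat by blast
  then obtain a m where n: "n = p ^ a * m" "\<not> p dvd m"
  proof -
    have "\<not> is_unit p" using p by auto
    then obtain y where "n = p ^ multiplicity p n * y" "\<not> p dvd y"
      using multiplicity_decompose'[of n p] assms by auto
    then show ?thesis using that by blast
  qed
  have m: "m > 0" using n assms by (intro Nat.gr0I) auto
  have a: "a > 0" using n p by (intro Nat.gr0I) auto
  have "(\<Sum>d | d dvd n. moebius d) = (\<Sum>d | d dvd p * m. moebius d)"
  proof (rule sum.mono_neutral_right)
    show "{d. d dvd p * m} \<subseteq> {d. d dvd n}" 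
    proof -
      have "p * m dvd n" unfolding n using a by (intro mult_dvd_mono dvd_power) auto
      then show ?thesis using dvd_trans by blast
    qed
    show "\<forall>d\<in>{d. d dvd n} - {d. d dvd p * m}. moebius d = 0"
    proof
      fix d assume d: "d \<in> {d. d dvd n} - {d. d dvd p * m}"
      have "\<not> squarefree d"
      proof
        assume sq: "squarefree d"
        obtain x y where xy: "d = x * y" "x dvd p ^ a" "y dvd m"
          using d division_decomp[of d "p ^ a" m] unfolding n by blast
        obtain i where i: "x = p ^ i" using xy(2) p(1) divides_primepow_nat by blast
        have "i \<le> 1"
        proof (rule ccontr)
          assume "\<not> i \<le> 1"
          then have "p\<^sup>2 dvd x" unfolding i by (intro le_imp_power_dvd) auto
          then have "p\<^sup>2 dvd d" unfolding xy by simp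
          then have "is_unit p" using sq by (auto simp: squarefree_def)
          then show False using p by simp
        qed
        then have "i = 0 \<or> i = 1" by auto
        then have "x dvd p" using i by auto
        then have "d dvd p * m" using xy by (auto intro: mult_dvd_mono)
        then show False using d by simp
      qed
      then show "moebius d = 0" by (simp add: moebius_def)
    qed
  qed (use assms in auto)
  also have "\<dots> = (\<Sum>d | d dvd m. moebius d) + (\<Sum>d | d dvd m. moebius (p * d))"
    by (rule sum_divisors_prime_mult) (use p n m in auto)
  also have "(\<Sum>d | d dvd m. moebius (p * d)) = (\<Sum>d | d dvd m. - moebius d)"
  proof (intro sum.cong refl moebius_prime_mult p)
    fix d assume "d \<in> {d. d dvd m}"
    then show "\<not> p dvd d" "d > 0" using n m by (auto intro: dvd_trans dvd_pos_nat)
  qed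
  finally show ?thesis using False by (simp add: sum_negf)
qed

text \<open>Moebius inversion expresses \<open>mangoldt n\<close> by the terms moebius d * ln (n /
  d). When the logarithm is split, the ln n part carries the factor [n = 1], and ln 1 = 0.\<close>

lemma sum_moebius_ln:
  assumes "n > 0"
  shows "(\<Sum>d | d dvd n. moebius d * ln d) = - mangoldt n"
proof -
  have fin: "finite {d. d dvd n}" using assms by simp
  have "(\<Sum>d | d dvd n. moebius d * ln (n div d)) = (\<Sum>d | d dvd n. \<Sum>k | k dvd n div d. moebius d * mangoldt k)"
  proof (intro sum.cong refl)
    fix d assume "d \<in> {d. d dvd n}"
    then have "n div d \<noteq> 0" using assms by (auto simp: dvd_div_eq_0_iff)
    then show "moebius d * ln (n div d) = (\<Sum>k | k dvd n div d. moebius d * mangoldt k)"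
      by (simp add: sum_distrib_left[symmetric] mangoldt_sum)
  qed
  also have "\<dots> = (\<Sum>k | k dvd n. \<Sum>d | d dvd n div k. moebius d * mangoldt k)"
  proof -
    have div: "{k. k dvd n div d} = {k \<in> {k. k dvd n}. d * k dvd n}" if "d dvd n" for d
    proof -
      have "k dvd n div d \<longleftrightarrow> k * d dvd n" for k
        using that assms by (intro dvd_div_iff_mult) auto
      moreover have "k dvd n" if "k * d dvd n" for k using that by (rule dvd_mult_left)
      ultimately show ?thesis by (auto simp: mult.commute[of d])
    qed
    have "(\<Sum>d | d dvd n. \<Sum>k | k dvd n div d. moebius d * mangoldt k)
        = (\<Sum>d | d dvd n. \<Sum>k\<in>{k \<in> {k. k dvd n}. d * k dvd n}. moebius d * mangoldt k)"
      by (intro sum.cong refl) (auto simp: div)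
    also have "\<dots> = (\<Sum>k | k dvd n. \<Sum>d\<in>{d \<in> {d. d dvd n}. d * k dvd n}. moebius d * mangoldt k)"
      by (rule sum.swap_restrict[OF fin fin])
    also have "\<dots> = (\<Sum>k | k dvd n. \<Sum>d | d dvd n div k. moebius d * mangoldt k)"
      by (intro sum.cong refl) (auto simp: div mult.commute)
    finally show ?thesis .
  qed
  also have "\<dots> = (\<Sum>k | k dvd n. if k = n then mangoldt n else 0)"
  proof (intro sum.cong refl)
    fix k assume k: "k \<in> {k. k dvd n}"
    then have "n div k > 0" using assms by (auto intro!: Nat.gr0I simp: dvd_div_eq_0_iff)
    then have "(\<Sum>d | d dvd n div k. moebius d * mangoldt k) = of_bool (n div k = 1) * mangoldt k"
      by (simp add: sum_distrib_right[symmetric] sum_moebius_divisors)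
    also have "n div k = 1 \<longleftrightarrow> k = n" using k assms by auto
    finally show "(\<Sum>d | d dvd n div k. moebius d * mangoldt k) = (if k = n then mangoldt n else 0)" by simp
  qed
  also have "\<dots> = mangoldt n" using fin by simp
  finally have 1: "(\<Sum>d | d dvd n. moebius d * ln (n div d)) = mangoldt n" .
  have "(\<Sum>d | d dvd n. moebius d * ln (n div d)) = (\<Sum>d | d dvd n. moebius d * ln n - moebius d * ln d)"
  proof (intro sum.cong refl)
    fix d assume "d \<in> {d. d dvd n}"
    then have "real (n div d) = real n / real d" "d > 0" using assms by (auto simp: real_of_nat_div dvd_pos_nat)
    then show "moebius d * ln (n div d) = moebius d * ln n - moebius d * ln d"
      using assms by (simp add: ln_div algebra_simps)
  qed
  also have "\<dots> = of_bool (n = 1) * ln n - (\<Sum>d | d dvd n. moebius d * ln d)"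
    using sum_moebius_divisors[OF assms] by (simp add: sum_subtractf sum_distrib_right[symmetric])
  also have "of_bool (n = 1) * ln (real n) = 0" by simp
  finally show ?thesis using 1 by simp
qed

section \<open>Primes in arithmetic progressions\<close>

text \<open>The norm clause combines vanishing off the units with modulus 1 on them, so closure
  under products and conjugates is a computation with norms.\<close>

definition characters :: "nat \<Rightarrow> (nat \<Rightarrow> complex) set" where
  "characters m = {\<chi>. \<chi> 1 = 1 \<and> (\<forall>a b. \<chi> (a * b) = \<chi> a * \<chi> b) \<and> (\<forall>a. \<chi> (a mod m) = \<chi> a)
     \<and> (\<forall>a. norm (\<chi> a) = of_bool (coprime a m))}"

locale dirichlet_character =
  fixes m :: nat and \<chi> :: "nat \<Rightarrow> complex"
  assumes m: "m > 0" and \<chi>: "\<chi> \<in> characters m"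
begin

lemma one: "\<chi> 1 = 1" and mult: "\<chi> (a * b) = \<chi> a * \<chi> b" and mod_eq: "\<chi> (a mod m) = \<chi> a"
  and norm_eq: "norm (\<chi> a) = of_bool (coprime a m)"
  using \<chi> by (auto simp: characters_def)

lemma norm_le: "norm (\<chi> a) \<le> 1"
  by (simp add: norm_eq)

lemma cong_eq: "[a = b] (mod m) \<Longrightarrow> \<chi> a = \<chi> b"
  by (metis cong_def mod_eq)

lemma power: "\<chi> (a ^ k) = \<chi> a ^ k"
  by (induction k) (simp_all add: mult one[simplified])

end

locale nontrivial_character = dirichlet_character +
  assumes nontrivial: "\<exists>a. coprime a m \<and> \<chi> a \<noteq> 1"
begin

lemma sum_period: "(\<Sum>a<m. \<chi> a) = 0"
proof -
  obtain b where b: "coprime b m" "\<chi> b \<noteq> 1" using nontrivial by blast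
  have inj: "inj_on (\<lambda>a. (b * a) mod m) {..<m}"
  proof (rule inj_onI)
    fix x y assume xy: "x \<in> {..<m}" "y \<in> {..<m}" "(b * x) mod m = (b * y) mod m"
    then have "[x = y] (mod m)" using b(1) by (simp add: cong_def[symmetric] cong_mult_lcancel_nat)
    then show "x = y" using xy by (simp add: cong_def)
  qed
  have sub: "(\<lambda>a. (b * a) mod m) ` {..<m} \<subseteq> {..<m}" using m by auto
  have "bij_betw (\<lambda>a. (b * a) mod m) {..<m} {..<m}"
    unfolding bij_betw_def using endo_inj_surj[OF finite_lessThan sub inj] inj by simp
  then have "(\<Sum>a<m. \<chi> a) = (\<Sum>a<m. \<chi> ((b * a) mod m))"
    by (rule sum.reindex_bij_betw[symmetric])
  also have "\<dots> = \<chi> b * (\<Sum>a<m. \<chi> a)"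
    by (simp add: mod_eq mult sum_distrib_left)
  finally show ?thesis using b(2) by simp
qed

lemma norm_sum_interval_le: "norm (\<Sum>n\<in>{a..<b}. \<chi> n) \<le> 2 * real m"
proof -
  have per: "(\<Sum>n<k * m. \<chi> n) = 0" for k
  proof (induction k)
    case (Suc k)
    have "(\<Sum>n<Suc k * m. \<chi> n) = (\<Sum>n<k * m. \<chi> n) + (\<Sum>n\<in>{k * m..<k * m + m}. \<chi> n)"
      by (simp add: lessThan_atLeast0 sum.atLeastLessThan_concat add.commute)
    also have "(\<Sum>n\<in>{k * m..<k * m + m}. \<chi> n) = (\<Sum>n<m. \<chi> (n + k * m))"
      using sum.shift_bounds_nat_ivl[of \<chi> 0 "k * m" m] by (simp add: lessThan_atLeast0 add.commute)
    also have "\<dots> = (\<Sum>n<m. \<chi> n)"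
      by (intro sum.cong refl cong_eq) (simp add: cong_def)
    finally show ?case using Suc sum_period by simp
  qed simp
  have init: "norm (\<Sum>n<c. \<chi> n) \<le> real m" for c
  proof -
    have "(\<Sum>n<c. \<chi> n) = (\<Sum>n<(c div m) * m. \<chi> n) + (\<Sum>n\<in>{(c div m) * m..<c}. \<chi> n)"
      by (simp add: lessThan_atLeast0 sum.atLeastLessThan_concat)
    then have "norm (\<Sum>n<c. \<chi> n) \<le> (\<Sum>n\<in>{(c div m) * m..<c}. 1)"
      unfolding per by (simp only: add_0_left) (intro sum_norm_le norm_le)
    also have "\<dots> = real (c mod m)" by (simp add: modulo_nat_def)
    also have "\<dots> \<le> real m" using m by (simp add: less_imp_le)
    finally show ?thesis .
  qed
  show ?thesis
  proof (cases "a \<le> b")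
    case True
    then have "(\<Sum>n\<in>{a..<b}. \<chi> n) = (\<Sum>n<b. \<chi> n) - (\<Sum>n<a. \<chi> n)"
      using sum.atLeastLessThan_concat[of 0 a b \<chi>] by (simp add: lessThan_atLeast0 algebra_simps)
    then show ?thesis using norm_triangle_ineq4[of "\<Sum>n<b. \<chi> n" "\<Sum>n<a. \<chi> n"] init[of a] init[of b] by simp
  qed (use m in simp)
qed

lemma norm_sum_decreasing_le':
  assumes "\<And>n. n \<ge> a \<Longrightarrow> g (Suc n) \<le> g n" "\<And>n. n \<ge> a \<Longrightarrow> (g n :: real) \<ge> 0"
  shows "norm (\<Sum>n\<in>{a..<b}. \<chi> n * of_real (g n)) \<le> 2 * real m * g a"
proof (cases "a \<le> b")
  case True
  then show ?thesis by (intro norm_sum_decreasing_le norm_sum_interval_le assms)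
qed (use assms(2)[of a] in simp)

definition harmonic_sum :: "nat \<Rightarrow> complex" where
  "harmonic_sum N = (\<Sum>n\<in>{1..N}. \<chi> n * of_real (1 / n))"

lemma norm_harmonic_sum_diff: "N \<le> N' \<Longrightarrow> norm (harmonic_sum N' - harmonic_sum N) \<le> 2 * real m / (real N + 1)"
proof -
  assume "N \<le> N'"
  then have "harmonic_sum N' - harmonic_sum N = (\<Sum>n\<in>{Suc N..<Suc N'}. \<chi> n * of_real (1 / n))"
    using sum.atLeastLessThan_concat[of 1 "Suc N" "Suc N'" "\<lambda>n. \<chi> n * of_real (1 / n)"]
    by (simp only: harmonic_sum_def atLeastLessThanSuc_atLeastAtMost[symmetric]) (simp add: algebra_simps)
  also have "norm \<dots> \<le> 2 * real m * (1 / real (Suc N))"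
    by (rule norm_sum_decreasing_le') (auto simp: frac_le)
  finally show ?thesis by (simp add: add.commute)
qed

definition L1 :: complex where "L1 = lim harmonic_sum"

lemma harmonic_sum_tendsto: "harmonic_sum \<longlonglongrightarrow> L1"
proof -
  have "Cauchy harmonic_sum"
  proof (rule CauchyI)
    fix e :: real assume e: "e > 0"
    obtain M where M: "2 * (2 * real m) / e < real M" using reals_Archimedean2 by blast
    have close: "norm (harmonic_sum M - harmonic_sum N) < e / 2" if "N \<ge> M" for N
    proof -
      have "norm (harmonic_sum M - harmonic_sum N) \<le> 2 * real m / (real M + 1)"
        using norm_harmonic_sum_diff[OF that] by (simp add: norm_minus_commute)
      also have "\<dots> < e / 2" using M e by (simp add: field_simps)
      finally show ?thesis .
    qed
    show "\<exists>M. \<forall>k\<ge>M. \<forall>n\<ge>M. norm (harmonic_sum k - harmonic_sum n) < e"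
    proof (intro exI allI impI)
      fix k n assume "k \<ge> M" "n \<ge> M"
      then show "norm (harmonic_sum k - harmonic_sum n) < e"
        using close[of k] close[of n] norm_triangle_ineq4[of "harmonic_sum M - harmonic_sum n" "harmonic_sum M - harmonic_sum k"]
        by (simp add: norm_minus_commute)
    qed
  qed
  then show ?thesis unfolding L1_def
    using Cauchy_convergent_iff convergent_LIMSEQ_iff by blast
qed

text \<open>The rate 1 / N of this tail, rather than mere convergence, is what makes the errors
  below sum to a constant.\<close>

lemma norm_L1_diff: "norm (L1 - harmonic_sum N) \<le> 2 * real m / (real N + 1)"
proof (rule LIMSEQ_le_const2)
  show "(\<lambda>N'. norm (harmonic_sum N' - harmonic_sum N)) \<longlonglongrightarrow> norm (L1 - harmonic_sum N)"
    by (intro tendsto_intros harmonic_sum_tendsto)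
  show "\<exists>K. \<forall>n\<ge>K. norm (harmonic_sum n - harmonic_sum N) \<le> 2 * real m / (real N + 1)"
    using norm_harmonic_sum_diff by blast
qed

text \<open>Partial sums of the Dirichlet series of - L' / L at 1.\<close>

definition mangoldt_sum' :: "nat \<Rightarrow> complex" where
  "mangoldt_sum' N = (\<Sum>d\<in>{1..N}. \<chi> d * of_real (mangoldt d / d))"

lemma ln_div_self_decreasing:
  assumes "n \<ge> 3"
  shows "ln (real (Suc n)) / real (Suc n) \<le> ln (real n) / real n"
proof -
  have n: "real n \<ge> 3" using assms by simp
  have "exp 1 \<le> real n" using exp_le n by linarith
  then have "1 \<le> ln (real n)" using n by (subst ln_ge_iff) auto
  have "real n * ln (1 + 1 / real n) \<le> real n * (1 / real n)"
    using n by (intro mult_left_mono ln_add_one_self_le_self) auto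
  then have "real n * ln (1 + 1 / real n) \<le> ln (real n)" using n \<open>1 \<le> ln (real n)\<close> by simp
  moreover have "ln (real (Suc n)) = ln (real n) + ln (1 + 1 / real n)"
  proof -
    have "real (Suc n) = real n * (1 + 1 / real n)" using n by (simp add: field_simps)
    moreover have "1 + 1 / real n > 0" using n by (simp add: add_pos_pos)
    ultimately show ?thesis using n by (simp add: ln_mult del: of_nat_Suc)
  qed
  ultimately have "real n * ln (real (Suc n)) \<le> real (Suc n) * ln (real n)"
    by (simp add: algebra_simps)
  then show ?thesis using n by (simp add: frac_le_eq divide_le_cancel field_simps)
qed

text \<open>The weight ln n / n decreases only from n = 3 on, so the first two terms are treated
  separately.\<close>

lemma sum_ln_bounded: "\<exists>C. \<forall>N. norm (\<Sum>n\<in>{1..N}. \<chi> n * of_real (ln n / n)) \<le> C"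
proof -
  define g where "g = (\<lambda>n::nat. ln n / n)"
  define C where "C = norm (\<Sum>n\<in>{1..<3}. \<chi> n * of_real (g n)) + norm (\<Sum>n\<in>{1..<2}. \<chi> n * of_real (g n)) + 2 * real m * g 3"
  have g3: "g 3 \<ge> 0" by (simp add: g_def)
  have "norm (\<Sum>n\<in>{1..N}. \<chi> n * of_real (g n)) \<le> C" for N
  proof (cases "N \<ge> 2")
    case True
    have "(\<Sum>n\<in>{1..N}. \<chi> n * of_real (g n)) = (\<Sum>n\<in>{1..<3}. \<chi> n * of_real (g n)) + (\<Sum>n\<in>{3..<Suc N}. \<chi> n * of_real (g n))"
      using True by (subst sum.atLeastLessThan_concat) (auto simp: atLeastLessThanSuc_atLeastAtMost)
    moreover have "norm (\<Sum>n\<in>{3..<Suc N}. \<chi> n * of_real (g n)) \<le> 2 * real m * g 3"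
      by (rule norm_sum_decreasing_le') (use ln_div_self_decreasing in \<open>auto simp: g_def\<close>)
    ultimately show ?thesis unfolding C_def
      by (smt (verit) norm_ge_zero norm_triangle_ineq)
  next
    case False
    then have "N = 0 \<or> N = 1" by auto
    then show ?thesis using g3 by (auto simp: C_def g_def intro!: add_nonneg_nonneg)
  qed
  then show ?thesis unfolding g_def by blast
qed

lemma sum_ln_eq:
  "(\<Sum>n\<in>{1..N}. \<chi> n * of_real (ln n / n)) = (\<Sum>d\<in>{1..N}. \<chi> d * of_real (mangoldt d / d) * harmonic_sum (N div d))"
proof -
  have "(\<Sum>n\<in>{1..N}. \<chi> n * of_real (ln n / n))
     = (\<Sum>n\<in>{1..N}. \<Sum>d | d dvd n. \<chi> d * of_real (mangoldt d / d) * (\<chi> (n div d) * of_real (1 / (n div d))))"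
  proof (intro sum.cong refl)
    fix n assume n: "n \<in> {1..N}"
    have "\<chi> n * of_real (ln n / n) = (\<Sum>d | d dvd n. \<chi> n * of_real (mangoldt d / n))"
      using n by (simp add: sum_distrib_left[symmetric] sum_divide_distrib[symmetric] mangoldt_sum flip: of_real_sum of_real_divide)
    also have "\<dots> = (\<Sum>d | d dvd n. \<chi> d * of_real (mangoldt d / d) * (\<chi> (n div d) * of_real (1 / (n div d))))"
    proof (intro sum.cong refl)
      fix d assume "d \<in> {d. d dvd n}"
      then obtain k where "n = d * k" by auto
      then show "\<chi> n * of_real (mangoldt d / n) = \<chi> d * of_real (mangoldt d / d) * (\<chi> (n div d) * of_real (1 / (n div d)))"
        using n by (cases "d = 0") (auto simp: mult)
    qed
    finally show "\<chi> n * of_real (ln n / n) = \<dots>" .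
  qed
  also have "\<dots> = (\<Sum>d\<in>{1..N}. \<Sum>k\<in>{1..N div d}. \<chi> d * of_real (mangoldt d / d) * (\<chi> k * of_real (1 / k)))"
    by (rule sum_divisors_swap)
  finally show ?thesis by (simp only: harmonic_sum_def sum_distrib_left)
qed

text \<open>As ln is the convolution of \<open>mangoldt\<close> with 1, the bounded sum of the
  \<chi> n * ln n / n has inner sums \<open>harmonic_sum (N div d)\<close>. Replacing each by
  \<open>L1\<close> costs at most 2 * m * d / N, and Chebyshev's bound turns the total into 12 *
  m.\<close>

lemma L1_mangoldt_sum_bounded: "\<exists>C. \<forall>N. norm (L1 * mangoldt_sum' N) \<le> C"
proof -
  obtain C where C: "norm (\<Sum>n\<in>{1..N}. \<chi> n * of_real (ln n / n)) \<le> C" for N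
    using sum_ln_bounded by blast
  have "norm (L1 * mangoldt_sum' N) \<le> C + 12 * real m" for N
  proof (cases "N = 0")
    case True
    then show ?thesis using C[of 0] by (simp add: mangoldt_sum'_def)
  next
    case False
    have "L1 * mangoldt_sum' N - (\<Sum>n\<in>{1..N}. \<chi> n * of_real (ln n / n))
        = (\<Sum>d\<in>{1..N}. \<chi> d * of_real (mangoldt d / d) * (L1 - harmonic_sum (N div d)))"
      unfolding sum_ln_eq mangoldt_sum'_def 
      by (simp only: mult.commute[of L1] sum_distrib_right right_diff_distrib sum_subtractf)
    also have "norm \<dots> \<le> (\<Sum>d\<in>{1..N}. mangoldt d * (2 * real m / N))"
    proof (rule sum_norm_le)
      fix d assume d: "d \<in> {1..N}"
      have "N < (N div d + 1) * d" using dividend_less_div_times[of d N] d by simp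
      then have N: "real N \<le> real (N div d + 1) * real d" by (metis less_imp_le of_nat_le_iff of_nat_mult)
      have "2 * real m / (real (N div d) + 1) \<le> 2 * real m * (real d / N)"
      proof -
        have "2 * real m * real N \<le> 2 * real m * (real (N div d + 1) * real d)" using N by (intro mult_left_mono) auto
        then show ?thesis using False by (simp add: field_simps)
      qed
      then have "norm (L1 - harmonic_sum (N div d)) \<le> 2 * real m * (real d / N)"
        using norm_L1_diff[of "N div d"] by linarith
      then have "norm (\<chi> d) * (mangoldt d / d) * norm (L1 - harmonic_sum (N div d))
          \<le> 1 * (mangoldt d / d) * (2 * real m * (real d / N))"
        using norm_le[of d] by (intro mult_mono) (auto simp: mangoldt_nonneg)
      also have "\<dots> = mangoldt d * (2 * real m / N)" using d by simp
      finally show "norm (\<chi> d * of_real (mangoldt d / d) * (L1 - harmonic_sum (N div d))) \<le> mangoldt d * (2 * real m / N)"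
        by (simp add: norm_mult mangoldt_nonneg norm_divide)
    qed
    also have "\<dots> = (\<Sum>d\<in>{1..N}. mangoldt d) * (2 * real m / N)" by (rule sum_distrib_right[symmetric])
    also have "\<dots> \<le> 6 * real N * (2 * real m / N)" using chebyshev_upper by (intro mult_right_mono) auto
    also have "\<dots> = 12 * real m" using False by simp
    finally show ?thesis using C[of N] norm_triangle_sub by (smt (verit))
  qed
  then show ?thesis by blast
qed

text \<open>Convolving moebius d * ln (N / d) with 1 gives ln N at n = 1 plus
  \<open>mangoldt n\<close>. When \<open>L1\<close> = 0 the inner sums are themselves at most 2 * m
  * d / N, and the sum of ln (N / d) over d \<le> N is at most N by the lower bound for ln
  (N!).\<close>

lemma mangoldt_sum_of_L1_zero:
  assumes L1: "L1 = 0"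
  shows "\<exists>C. \<forall>N\<ge>1. norm (mangoldt_sum' N + of_real (ln N)) \<le> C"
proof (intro exI allI impI)
  fix N :: nat assume N: "N \<ge> 1"
  have "(\<Sum>n\<in>{1..N}. \<Sum>d | d dvd n. \<chi> d * of_real (moebius d / d * ln (N / d)) * (\<chi> (n div d) * of_real (1 / (n div d))))
     = (\<Sum>n\<in>{1..N}. \<chi> n * of_real ((of_bool (n = 1) * ln N + mangoldt n) / n))"
  proof (intro sum.cong refl)
    fix n assume n: "n \<in> {1..N}"
    have "(\<Sum>d | d dvd n. \<chi> d * of_real (moebius d / d * ln (N / d)) * (\<chi> (n div d) * of_real (1 / (n div d))))
        = (\<Sum>d | d dvd n. \<chi> n * of_real ((moebius d * ln N - moebius d * ln d) / n))"
    proof (intro sum.cong refl)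
      fix d assume "d \<in> {d. d dvd n}"
      then obtain k where k: "n = d * k" by auto
      then have "d > 0" using n by (cases "d = 0") auto
      then have ln: "ln (N / d) = ln N - ln d" using N by (simp add: ln_div)
      show "\<chi> d * of_real (moebius d / d * ln (N / d)) * (\<chi> (n div d) * of_real (1 / (n div d)))
          = \<chi> n * of_real ((moebius d * ln N - moebius d * ln d) / n)"
        unfolding ln right_diff_distrib[symmetric] using k \<open>d > 0\<close> by (simp add: mult del: of_real_diff)
    qed
    also have "\<dots> = \<chi> n * of_real (((\<Sum>d | d dvd n. moebius d) * ln N - (\<Sum>d | d dvd n. moebius d * ln d)) / n)"
      by (simp only: sum_distrib_left[symmetric] of_real_sum[symmetric] sum_divide_distrib[symmetric] sum_subtractf sum_distrib_right[symmetric])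
    also have "\<dots> = \<chi> n * of_real ((of_bool (n = 1) * ln N + mangoldt n) / n)"
      using n sum_moebius_divisors[of n] sum_moebius_ln[of n] by simp
    finally show "(\<Sum>d | d dvd n. \<chi> d * of_real (moebius d / d * ln (N / d)) * (\<chi> (n div d) * of_real (1 / (n div d))))
        = \<chi> n * of_real ((of_bool (n = 1) * ln N + mangoldt n) / n)" .
  qed
  also have "\<dots> = (\<Sum>n\<in>{1..N}. \<chi> n * of_real (of_bool (n = 1) * ln N / n)) + mangoldt_sum' N"
    by (simp add: mangoldt_sum'_def add_divide_distrib distrib_left sum.distrib)
  also have "(\<Sum>n\<in>{1..N}. \<chi> n * of_real (of_bool (n = 1) * ln N / n)) = (\<Sum>n\<in>{1..N}. if n = 1 then of_real (ln N) else 0)"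
    by (intro sum.cong) (auto simp: one[simplified])
  also have "\<dots> = of_real (ln N)" using N by simp
  finally have "mangoldt_sum' N + of_real (ln N) = (\<Sum>n\<in>{1..N}. \<Sum>d | d dvd n. \<chi> d * of_real (moebius d / d * ln (N / d)) * (\<chi> (n div d) * of_real (1 / (n div d))))"
    by (simp add: add.commute)
  also have "\<dots> = (\<Sum>d\<in>{1..N}. \<Sum>k\<in>{1..N div d}. \<chi> d * of_real (moebius d / d * ln (N / d)) * (\<chi> k * of_real (1 / k)))"
    by (rule sum_divisors_swap)
  also have "\<dots> = (\<Sum>d\<in>{1..N}. \<chi> d * of_real (moebius d / d * ln (N / d)) * harmonic_sum (N div d))"
    by (simp only: harmonic_sum_def sum_distrib_left)
  also have "norm \<dots> \<le> (\<Sum>d\<in>{1..N}. ln (N / d) * (2 * real m / N))"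
  proof (rule sum_norm_le)
    fix d assume d: "d \<in> {1..N}"
    have "N < (N div d + 1) * d" using dividend_less_div_times[of d N] d by simp
    then have N': "real N \<le> real (N div d + 1) * real d" by (metis less_imp_le of_nat_le_iff of_nat_mult)
    have "2 * real m / (real (N div d) + 1) \<le> 2 * real m * (real d / N)"
    proof -
      have "2 * real m * real N \<le> 2 * real m * (real (N div d + 1) * real d)" using N' by (intro mult_left_mono) auto
      then show ?thesis using N by (simp add: field_simps)
    qed
    then have H: "norm (harmonic_sum (N div d)) \<le> 2 * real m * (real d / N)"
      using norm_L1_diff[of "N div d"] by (simp add: L1)
    have l: "ln (real N / real d) \<ge> 0" using d by (intro ln_ge_zero) (simp add: le_divide_eq)
    have "norm (\<chi> d) * (\<bar>moebius d\<bar> / d * ln (N / d)) * norm (harmonic_sum (N div d))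
        \<le> 1 * (1 / d * ln (N / d)) * (2 * real m * (real d / N))"
      using norm_le[of d] l H abs_moebius_le[of d]
      by (intro mult_mono mult_nonneg_nonneg divide_right_mono) auto
    also have "\<dots> = ln (N / d) * (2 * real m / N)" using d by simp
    finally show "norm (\<chi> d * of_real (moebius d / d * ln (N / d)) * harmonic_sum (N div d)) \<le> ln (N / d) * (2 * real m / N)"
      using l by (simp add: norm_mult norm_divide abs_mult)
  qed
  also have "\<dots> = (\<Sum>d\<in>{1..N}. ln (N / d)) * (2 * real m / N)" by (rule sum_distrib_right[symmetric])
  also have "(\<Sum>d\<in>{1..N}. ln (N / d)) = (\<Sum>d\<in>{1..N}. ln N - ln (real d))"
    using N by (intro sum.cong refl) (simp add: ln_div)
  also have "\<dots> = N * ln N - ln (fact N)" by (simp only: sum_subtractf sum_ln) simp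
  also have "\<dots> * (2 * real m / N) \<le> N * (2 * real m / N)"
    using ln_fact_bounds(1)[OF N] by (intro mult_right_mono) auto
  also have "\<dots> = 2 * real m" using N by simp
  finally show "norm (mangoldt_sum' N + of_real (ln N)) \<le> 2 * real m" .
qed

end


section \<open>Nonvanishing of L(1, \<chi>) for real characters\<close>

lemma sum_divisors_prime_power_mult:
  fixes f :: "nat \<Rightarrow> 'a :: comm_ring_1"
  assumes p: "prime p" and m: "m > 0" "\<not> p dvd m" and f: "\<And>a b. f (a * b) = f a * f b" "f 1 = 1"
  shows "(\<Sum>d | d dvd p ^ k * m. f d) = (\<Sum>i\<le>k. f p ^ i) * (\<Sum>d | d dvd m. f d)"
proof -
  have fp: "f (p ^ i) = f p ^ i" for i using f by (induction i) simp_all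
  have bij: "bij_betw (\<lambda>(i, d). p ^ i * d) ({..k} \<times> {d. d dvd m}) {d. d dvd p ^ k * m}"
    proof (rule bij_betwI')
      fix x y assume xy: "x \<in> {..k} \<times> {d. d dvd m}" "y \<in> {..k} \<times> {d. d dvd m}"
      obtain i d j d' where e: "x = (i, d)" "y = (j, d')" by (cases x, cases y)
      have nd: "\<not> p dvd d" "\<not> p dvd d'" "d > 0" "d' > 0"
        using xy e m by (auto intro: dvd_trans dvd_pos_nat)
      have mu: "multiplicity p (p ^ i * d) = i" "multiplicity p (p ^ j * d') = j"
        using nd p by (auto simp: prime_elem_multiplicity_mult_distrib multiplicity_same_power not_dvd_imp_multiplicity_0)
      show "((case x of (i, d) \<Rightarrow> p ^ i * d) = (case y of (i, d) \<Rightarrow> p ^ i * d)) = (x = y)"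
        using mu p unfolding e by (auto dest: arg_cong[of _ _ "multiplicity p"])
    next
      fix x assume "x \<in> {..k} \<times> {d. d dvd m}"
      then show "(case x of (i, d) \<Rightarrow> p ^ i * d) \<in> {d. d dvd p ^ k * m}"
        by (auto intro: mult_dvd_mono le_imp_power_dvd)
    next
      fix y assume "y \<in> {d. d dvd p ^ k * m}"
      then obtain u v where uv: "y = u * v" "u dvd p ^ k" "v dvd m"
        using division_decomp[of y "p ^ k" m] by blast
      then obtain i where "i \<le> k" "u = p ^ i" using divides_primepow_nat p by blast
      then show "\<exists>x\<in>{..k} \<times> {d. d dvd m}. y = (case x of (i, d) \<Rightarrow> p ^ i * d)"
        using uv by (intro bexI[of _ "(i, v)"]) auto
    qed
  have "(\<Sum>d | d dvd p ^ k * m. f d) = (\<Sum>(i, d)\<in>{..k} \<times> {d. d dvd m}. f (p ^ i * d))"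
    using sum.reindex_bij_betw[OF bij, of f] by (simp add: case_prod_unfold)
  also have "\<dots> = (\<Sum>(i, d)\<in>{..k} \<times> {d. d dvd m}. f p ^ i * f d)"
    by (intro sum.cong refl) (auto simp: f(1) fp)
  also have "\<dots> = (\<Sum>i\<le>k. f p ^ i) * (\<Sum>d | d dvd m. f d)"
    by (simp only: sum.cartesian_product[symmetric] sum_product)
  finally show ?thesis .
qed

text \<open>With S n = 1 + ... + t^(n - 1), the decrease amounts to n * (n + 1) * t^n \<le> S n * S
  (n + 1). The product has n * (n + 1) terms, whose exponents pair up as a and 2 * n - 1 - a, and
  each pair sums to at least 2 * t^n.\<close>

lemma geometric_diff_decreasing:
  fixes t :: real
  assumes t: "0 < t" "t < 1" and n: "n \<ge> 1"
  defines "b \<equiv> \<lambda>n::nat. 1 / (n * (1 - t)) - t ^ n / (1 - t ^ n)"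
  shows "b (Suc n) \<le> b n" "b n \<ge> 0"
proof -
  define S where "S = (\<lambda>n. \<Sum>i<n. t ^ i)"
  have S1: "1 - t ^ n = (1 - t) * S n" for n by (simp add: S_def one_diff_power_eq)
  have Spos: "S n > 0" if "n \<ge> 1" for n
    unfolding S_def using t that by (intro sum_pos) (auto simp: lessThan_empty_iff)
  have b: "(1 - t) * b n = 1 / n - t ^ n / S n" if "n \<ge> 1" for n
  proof -
    have "c * (1 / (x * c) - y / (c * z)) = 1 / x - y / z" if "c \<noteq> 0" for c x y z :: real
      using that by (simp add: right_diff_distrib)
    then show ?thesis unfolding b_def S1 using t by simp
  qed
  have pair: "t ^ a + t ^ (2 * n - 1 - a) \<ge> 2 * t ^ n" if "a < n" for a
  proof -
    \<comment> \<open>Raising the larger exponent by one makes the mean of the two exponents exactly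
      n and leaves a square.\<close>
    have "t ^ (2 * n - a) \<le> t ^ (2 * n - 1 - a)" using t by (intro power_decreasing) auto
    moreover have "t ^ a + t ^ (2 * n - a) - 2 * t ^ n = t ^ a * (1 - t ^ (n - a)) ^ 2"
    proof -
      define k where "k = n - a"
      have k: "2 * n - a = a + (k + k)" "n - a = k" "n = a + k" using that by (auto simp: k_def)
      have "t ^ a + t ^ (a + (k + k)) - 2 * t ^ (a + k) = t ^ a * (1 - t ^ k)\<^sup>2"
        unfolding power_add power2_eq_square by (simp add: algebra_simps)
      then show ?thesis unfolding k(1,2) unfolding k(3) .
    qed
    moreover have "t ^ a * (1 - t ^ (n - a)) ^ 2 \<ge> 0" using t by simp
    ultimately show ?thesis by linarith
  qed
  have pair': "t ^ a + t ^ (2 * n - 1 - a) \<ge> 2 * t ^ n" if "a \<le> 2 * n - 1" for a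
  proof (cases "a < n")
    case False
    then show ?thesis using pair[of "2 * n - 1 - a"] that n by (simp add: add.commute)
  qed (rule pair)
  have SS: "S n * S (Suc n) = (\<Sum>i<n. \<Sum>j<Suc n. t ^ (i + j))"
    by (simp only: S_def sum_product power_add)
  have "(\<Sum>i<n. \<Sum>j<Suc n. t ^ (i + j)) = (\<Sum>i<n. \<Sum>j<Suc n. t ^ (i + (Suc n - Suc j)))"
    by (intro sum.cong refl sum.nat_diff_reindex[symmetric])
  also have "\<dots> = (\<Sum>i<n. \<Sum>j<Suc n. t ^ ((n - Suc i) + (Suc n - Suc j)))"
    by (rule sum.nat_diff_reindex[symmetric])
  also have "\<dots> = (\<Sum>i<n. \<Sum>j<Suc n. t ^ (2 * n - 1 - (i + j)))"
    by (intro sum.cong refl arg_cong[where f = "\<lambda>k. t ^ k"]) auto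
  finally have "2 * (S n * S (Suc n)) = (\<Sum>i<n. \<Sum>j<Suc n. t ^ (i + j) + t ^ (2 * n - 1 - (i + j)))"
    unfolding SS by (simp only: sum.distrib)
  also have "\<dots> \<ge> (\<Sum>i<n. \<Sum>j<Suc n. 2 * t ^ n)"
    by (intro sum_mono pair') auto
  finally have "real n * real (Suc n) * t ^ n \<le> S n * S (Suc n)" by (simp add: algebra_simps)
  moreover have "x / y \<le> 1 / z" if "z * x \<le> y" "y > 0" "z > 0" for x y z :: real
    using that by (simp add: field_simps)
  ultimately have key: "t ^ n / (S n * S (Suc n)) \<le> 1 / (real n * real (Suc n))"
    using Spos[OF n] Spos[of "Suc n"] n by simp
  have "S (Suc n) = 1 + t * S n" by (simp only: S_def sum.lessThan_Suc_shift power_0 power_Suc sum_distrib_left)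
  then have "t ^ n / S n - t ^ Suc n / S (Suc n) = t ^ n / (S n * S (Suc n))"
    using Spos[OF n] Spos[of "Suc n"] by (simp add: field_simps)
  moreover have "1 / real n - 1 / real (Suc n) = 1 / (real n * real (Suc n))"
    using n by (simp add: field_simps)
  ultimately have "(1 - t) * b (Suc n) \<le> (1 - t) * b n"
    using key b[OF n] b[of "Suc n"] by simp
  then show "b (Suc n) \<le> b n" using t by simp
  have "real n * t ^ n \<le> S n"
  proof -
    have "(\<Sum>i<n. t ^ n) \<le> S n" unfolding S_def using t by (intro sum_mono power_decreasing) auto
    then show ?thesis by simp
  qed
  then have "t ^ n / S n \<le> 1 / real n" using Spos[OF n] n by (simp add: field_simps)
  then have "(1 - t) * b n \<ge> 0" using b[OF n] by simp
  then show "b n \<ge> 0" using t by (simp add: zero_le_mult_iff)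
qed


locale real_character = nontrivial_character +
  assumes real: "\<And>a. \<chi> a \<in> \<real>"
begin

definition divisor_sum :: "nat \<Rightarrow> real" where
  "divisor_sum n = (\<Sum>d | d dvd n. Re (\<chi> d))"

lemma Re_mult: "Re (\<chi> (a * b)) = Re (\<chi> a) * Re (\<chi> b)"
  using real[of a] by (simp add: mult complex_is_Real_iff)

lemma Re_cases: "Re (\<chi> a) \<in> {-1, 0, 1}"
proof -
  have "norm (\<chi> a) = \<bar>Re (\<chi> a)\<bar>" using real[of a] by (simp add: complex_is_Real_iff cmod_eq_Re)
  then show ?thesis using norm_eq[of a] by (cases "coprime a m") auto
qed

lemma geometric_nonneg: "x \<in> {-1, 0, 1} \<Longrightarrow> (\<Sum>i\<le>k. x ^ i) \<ge> (of_bool (even k) :: real)"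
proof -
  have "(\<Sum>i\<le>k. (0::real) ^ i) = 1" by (induction k) auto
  moreover have "(\<Sum>i\<le>k. (-1::real) ^ i) = of_bool (even k)" by (induction k) auto
  ultimately show "x \<in> {-1, 0, 1} \<Longrightarrow> (\<Sum>i\<le>k. x ^ i) \<ge> (of_bool (even k) :: real)" by auto
qed

text \<open>The sum is multiplicative, and its factor at p^a is a sum of powers of a number in {-1,
  0, 1}: never negative, and at least 1 when a is even.\<close>

lemma divisor_sum_ge: "n > 0 \<Longrightarrow> divisor_sum n \<ge> of_bool (\<exists>k. n = k ^ 2)"
proof (induction n rule: less_induct)
  case (less n)
  show ?case
  proof (cases "n = 1")
    case True
    then show ?thesis by (simp add: divisor_sum_def one[simplified])
  next
    case False
    then obtain p where p: "prime p" "p dvd n" using prime_factor_nat by blast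
    have "\<not> is_unit p" using p by auto
    then obtain y where y: "n = p ^ multiplicity p n * y" "\<not> p dvd y"
      using multiplicity_decompose'[of n p] less.prems by auto
    define a where "a = multiplicity p n"
    have n: "n = p ^ a * y" using y by (simp add: a_def)
    have a: "a > 0" using p less.prems by (simp add: a_def prime_multiplicity_gt_zero_iff)
    have "y > 0" using n less.prems by (intro Nat.gr0I) auto
    have "p ^ a > 1" using a p by (intro one_less_power prime_gt_1_nat)
    then have "y < n" unfolding n using \<open>y > 0\<close> by simp
    have "divisor_sum n = (\<Sum>i\<le>a. Re (\<chi> p) ^ i) * divisor_sum y"
      unfolding divisor_sum_def n
      by (rule sum_divisors_prime_power_mult) (use p y \<open>y > 0\<close> in \<open>auto simp: Re_mult one[simplified]\<close>)
    moreover have g: "(\<Sum>i\<le>a. Re (\<chi> p) ^ i) \<ge> of_bool (even a)" by (rule geometric_nonneg[OF Re_cases])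
    moreover have d: "divisor_sum y \<ge> of_bool (\<exists>k. y = k ^ 2)" by (rule less.IH) fact+
    moreover have "even a \<and> (\<exists>k. y = k ^ 2)" if sq: "\<exists>k. n = k ^ 2"
    proof -
      obtain k where k: "n = k ^ 2" using sq by blast
      have "k > 0" using k less.prems by (intro Nat.gr0I) auto
      have "a = 2 * multiplicity p k" unfolding a_def k
        using p \<open>k > 0\<close> by (simp add: prime_elem_multiplicity_power_distrib)
      then obtain b where b: "a = 2 * b" by simp
      then have "(p ^ b) ^ 2 dvd k ^ 2" using n k by (metis dvd_triv_left power_mult mult.commute)
      then have "p ^ b dvd k" by simp
      then obtain z where "k = p ^ b * z" by auto
      then have "p ^ a * y = p ^ a * z ^ 2"
        using n k b by (metis power_mult power_mult_distrib mult.commute)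
      moreover have "p \<noteq> 0" using p by auto
      ultimately have "y = z ^ 2" by simp
      then show ?thesis using b by auto
    qed
    ultimately show ?thesis
      using mult_mono[OF g d] by (auto simp: of_bool_def split: if_splits)
  qed
qed

lemma Re_harmonic_sum: "Re (harmonic_sum N) = (\<Sum>n\<in>{1..N}. Re (\<chi> n) / n)"
  by (simp add: harmonic_sum_def)

text \<open>
  The Lambert series \<open>\<Sum>\<chi>(n) t\<^sup>n / (1 - t\<^sup>n)\<close> has the divisor sums of \<open>\<chi>\<close> as its coefficients; subtracting
  the multiple \<open>1 / (1 - t)\<close> of the partial sums of \<open>L(1, \<chi>)\<close> makes it uniformly bounded (Monsky).
\<close>
lemma lambert_bound:
  fixes t :: real
  assumes t: "0 < t" "t < 1"
  shows "(\<Sum>j\<in>{1..N}. divisor_sum j * t ^ j)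
     \<le> 2 * real m + Re (harmonic_sum N) / (1 - t) + real N * t ^ N / (1 - t)"
proof -
  define b where "b = (\<lambda>n::nat. 1 / (n * (1 - t)) - t ^ n / (1 - t ^ n))"
  have pow: "t ^ n < 1" if "n \<ge> 1" for n using t that by (simp add: power_less_one_iff)
  have "norm (\<Sum>n\<in>{1..<Suc N}. \<chi> n * of_real (b n)) \<le> 2 * real m * b 1"
    by (rule norm_sum_decreasing_le') (use geometric_diff_decreasing[OF t] in \<open>simp_all add: b_def\<close>)
  \<comment> \<open>The singularities at t = 1 cancel in the leading weight, so the bound is uniform
    in t.\<close>
  moreover have "b 1 = 1" using t by (simp add: b_def field_simps)
  moreover have "Re (\<Sum>n\<in>{1..<Suc N}. \<chi> n * of_real (b n)) = (\<Sum>n\<in>{1..N}. Re (\<chi> n) * b n)"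
    by (simp add: atLeastLessThanSuc_atLeastAtMost)
  ultimately have bound: "- (\<Sum>n\<in>{1..N}. Re (\<chi> n) * b n) \<le> 2 * real m"
    using abs_Re_le_cmod[of "\<Sum>n\<in>{1..<Suc N}. \<chi> n * of_real (b n)"] by simp
  have geo: "(\<Sum>k\<in>{1..K}. x ^ k) = x / (1 - x) - x ^ Suc K / (1 - x)" if "x < 1" for x :: real and K
  proof -
    have "(\<Sum>k\<in>{1..K}. x ^ k) * (1 - x) = x - x ^ Suc K"
    proof (induction K)
      case (Suc K)
      have "(\<Sum>k\<in>{1..Suc K}. x ^ k) * (1 - x) = (\<Sum>k\<in>{1..K}. x ^ k) * (1 - x) + x ^ Suc K * (1 - x)"
        by (simp add: distrib_right)
      also have "\<dots> = (x - x ^ Suc K) + (x ^ Suc K - x ^ Suc (Suc K))"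
        unfolding Suc.IH by (simp add: algebra_simps)
      finally show ?case by simp
    qed simp
    then show ?thesis using that by (simp add: divide_simps)
  qed
  have "(\<Sum>j\<in>{1..N}. divisor_sum j * t ^ j) = (\<Sum>j\<in>{1..N}. \<Sum>d | d dvd j. Re (\<chi> d) * t ^ (d * (j div d)))"
    by (intro sum.cong refl) (auto simp: divisor_sum_def sum_distrib_right intro!: sum.cong)
  also have "\<dots> = (\<Sum>d\<in>{1..N}. \<Sum>k\<in>{1..N div d}. Re (\<chi> d) * t ^ (d * k))"
    by (rule sum_divisors_swap)
  also have "\<dots> = (\<Sum>d\<in>{1..N}. Re (\<chi> d) * (t ^ d / (1 - t ^ d)) - Re (\<chi> d) * ((t ^ d) ^ Suc (N div d) / (1 - t ^ d)))"
  proof (intro sum.cong refl)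
    fix d assume "d \<in> {1..N}"
    then have "(\<Sum>k\<in>{1..N div d}. t ^ (d * k)) = t ^ d / (1 - t ^ d) - (t ^ d) ^ Suc (N div d) / (1 - t ^ d)"
      using geo[of "t ^ d" "N div d"] pow[of d] by (simp add: power_mult)
    then show "(\<Sum>k\<in>{1..N div d}. Re (\<chi> d) * t ^ (d * k))
        = Re (\<chi> d) * (t ^ d / (1 - t ^ d)) - Re (\<chi> d) * ((t ^ d) ^ Suc (N div d) / (1 - t ^ d))"
      by (simp only: sum_distrib_left[symmetric] right_diff_distrib)
  qed
  \<comment> \<open>Each truncated geometric series leaves a remainder of at most t^N / (1 - t),
    whatever the sign of \<chi>; N such remainders together still tend to 0.\<close>
  also have "\<dots> \<le> (\<Sum>d\<in>{1..N}. Re (\<chi> d) * (t ^ d / (1 - t ^ d)) + t ^ N / (1 - t))"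
  proof (rule sum_mono)
    fix d assume d: "d \<in> {1..N}"
    have "N \<le> d * Suc (N div d)" using dividend_less_div_times[of d N] d by (simp add: mult.commute)
    then have 1: "(t ^ d) ^ Suc (N div d) \<le> t ^ N"
      unfolding power_mult[symmetric] using t by (intro power_decreasing) auto
    have "t ^ d \<le> t ^ 1" using d t by (intro power_decreasing) auto
    then have "(t ^ d) ^ Suc (N div d) / (1 - t ^ d) \<le> t ^ N / (1 - t)"
      using 1 t by (intro frac_le) auto
    moreover have "(t ^ d) ^ Suc (N div d) / (1 - t ^ d) \<ge> 0" using t pow[of d] d by simp
    ultimately show "Re (\<chi> d) * (t ^ d / (1 - t ^ d)) - Re (\<chi> d) * ((t ^ d) ^ Suc (N div d) / (1 - t ^ d))
        \<le> Re (\<chi> d) * (t ^ d / (1 - t ^ d)) + t ^ N / (1 - t)"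
      using Re_cases[of d] by auto
  qed
  also have "\<dots> = (\<Sum>d\<in>{1..N}. Re (\<chi> d) / d * (1 / (1 - t)) - Re (\<chi> d) * b d + t ^ N / (1 - t))"
    by (intro sum.cong refl) (simp add: b_def right_diff_distrib)
  also have "\<dots> = Re (harmonic_sum N) / (1 - t) - (\<Sum>d\<in>{1..N}. Re (\<chi> d) * b d) + real N * t ^ N / (1 - t)"
    unfolding sum.distrib sum_subtractf sum_distrib_right[symmetric] Re_harmonic_sum by simp
  finally show ?thesis using bound by linarith
qed

text \<open>If \<open>L1\<close> = 0, the bound for the Lambert sum tends to 2 * m as N grows, for
  every fixed t. The squares alone contribute K / 2 when t is close to 1, and K = 4 * m + 1 makes
  this exceed 2 * m.\<close>

lemma L1_nonzero: "L1 \<noteq> 0"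
proof
  assume L1: "L1 = 0"
  define K where "K = 4 * m + 1"
  \<comment> \<open>This t is what Bernoulli's inequality asks for to give t^(k^2) \<ge> 1 / 2 for
    all k \<le> K.\<close>
  define t :: real where "t = 1 - 1 / (2 * real K ^ 2)"
  have K: "K \<ge> 1" by (simp add: K_def)
  have K2: "real K ^ 2 \<ge> 1" using K by simp
  have le: "1 / (2 * real K ^ 2) \<le> 1 / 2" "1 / (2 * real K ^ 2) > 0" using K K2 by (simp_all add: divide_simps)
  then have t: "0 < t" "t < 1" unfolding t_def by linarith+
  have half: "t ^ (k ^ 2) \<ge> 1 / 2" if "k \<le> K" for k
  proof -
    have "1 / 2 = 1 + real (K ^ 2) * (- (1 / (2 * real K ^ 2)))" using K by simp
    also have "\<dots> \<le> (1 + - (1 / (2 * real K ^ 2))) ^ (K ^ 2)"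
      using le by (intro Bernoulli_inequality) linarith
    also have "\<dots> = t ^ (K ^ 2)" by (simp add: t_def)
    also have "\<dots> \<le> t ^ (k ^ 2)" using t that by (intro power_decreasing) (auto simp: power_mono)
    finally show ?thesis .
  qed
  have "real K / 2 \<le> 2 * real m + Re (harmonic_sum N) / (1 - t) + real N * t ^ N / (1 - t)" if N: "N \<ge> K ^ 2" for N
  proof -
    have "real K / 2 = (\<Sum>k\<in>{1..K}. 1 / 2)" by simp
    also have "\<dots> \<le> (\<Sum>k\<in>{1..K}. divisor_sum (k ^ 2) * t ^ (k ^ 2))"
    proof (rule sum_mono)
      fix k assume k: "k \<in> {1..K}"
      then have "divisor_sum (k ^ 2) \<ge> 1" using divisor_sum_ge[of "k ^ 2"] by (auto simp: of_bool_def split: if_splits)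
      moreover have "t ^ (k ^ 2) \<ge> 1 / 2" using half k by simp
      ultimately have "1 * (1 / 2) \<le> divisor_sum (k ^ 2) * t ^ (k ^ 2)" by (intro mult_mono) auto
      then show "1 / 2 \<le> divisor_sum (k ^ 2) * t ^ (k ^ 2)" by simp
    qed
    also have "\<dots> = (\<Sum>j\<in>(\<lambda>k. k ^ 2) ` {1..K}. divisor_sum j * t ^ j)"
      by (subst sum.reindex) (auto intro!: inj_onI)
    also have "\<dots> \<le> (\<Sum>j\<in>{1..N}. divisor_sum j * t ^ j)"
    proof (rule sum_mono2)
      show "(\<lambda>k. k ^ 2) ` {1..K} \<subseteq> {1..N}"
      proof
        fix j assume "j \<in> (\<lambda>k. k ^ 2) ` {1..K}"
        then obtain k where "j = k ^ 2" "1 \<le> k" "k \<le> K" by auto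
        moreover from this have "k ^ 2 \<le> K ^ 2" by (intro power_mono) auto
        then have "k ^ 2 \<le> N" using N by (rule le_trans)
        ultimately show "j \<in> {1..N}" by auto
      qed
      fix j assume "j \<in> {1..N} - (\<lambda>k. k ^ 2) ` {1..K}"
      then have "divisor_sum j \<ge> 0" using divisor_sum_ge[of j] by (auto simp: of_bool_def split: if_splits)
      then show "0 \<le> divisor_sum j * t ^ j" using t by simp
    qed simp
    also have "\<dots> \<le> 2 * real m + Re (harmonic_sum N) / (1 - t) + real N * t ^ N / (1 - t)"
      by (rule lambert_bound[OF t])
    finally show ?thesis .
  qed
  moreover have "(\<lambda>N. 2 * real m + Re (harmonic_sum N) / (1 - t) + real N * t ^ N / (1 - t)) \<longlonglongrightarrow> 2 * real m + Re L1 / (1 - t) + 0 / (1 - t)"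
    using t by (intro tendsto_intros harmonic_sum_tendsto powser_times_n_limit_0) auto
  ultimately have "real K / 2 \<le> 2 * real m + Re L1 / (1 - t) + 0 / (1 - t)"
    by (meson LIMSEQ_le_const)
  then show False using m by (simp add: L1 K_def)
qed

end

section \<open>The bounded contribution of prime powers\<close>

text \<open>From ln n \<le> 2 * sqrt n the term is at most 2 / n^(3/2), which a difference of
  reciprocal square roots dominates; the series then telescopes.\<close>

lemma ln_div_square_le:
  assumes "n \<ge> 2"
  shows "ln (real n) / real n ^ 2 \<le> 4 * (1 / sqrt (real n - 1) - 1 / sqrt (real n))"
proof -
  define s where "s = sqrt (real n)"
  define r where "r = sqrt (real n - 1)"
  have s: "s > 0" "s ^ 2 = real n" using assms by (auto simp: s_def)
  have r: "r > 0" "r ^ 2 = real n - 1" "r \<le> s" using assms by (auto simp: s_def r_def)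
  have "(s - r) * (s + r) = 1" using s r by (simp add: algebra_simps power2_eq_square)
  have "ln (real n) = 2 * ln s" using s by (simp flip: s(2) add: ln_realpow)
  also have "\<dots> \<le> 2 * s" using ln_le_minus_one[OF s(1)] by simp
  finally have "ln (real n) / real n ^ 2 \<le> 2 * s / real n ^ 2" by (intro divide_right_mono) auto
  also have "\<dots> = 2 / s ^ 3" using s(1) unfolding s(2)[symmetric] by (simp add: field_simps power_numeral_reduce)
  also have "\<dots> = 4 * (1 / (s * s * (s + s)))" using s(1) by (simp add: field_simps power_numeral_reduce)
  also have "\<dots> \<le> 4 * (1 / (r * s * (s + r)))"
    using s(1) r(1,3) by (intro mult_left_mono divide_left_mono mult_mono) auto
  also have "1 / (r * s * (s + r)) = ((s - r) * (s + r)) / (r * s * (s + r))"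
    using \<open>(s - r) * (s + r) = 1\<close> by simp
  also have "\<dots> = (s - r) / (r * s)" using s(1) r(1) by (simp add: add_pos_pos less_imp_neq[symmetric])
  also have "\<dots> = 1 / r - 1 / s" using s(1) r(1) by (simp add: field_simps)
  finally show ?thesis by (simp add: s_def r_def)
qed

lemma sum_ln_div_square_le: "(\<Sum>n\<in>{2..N}. ln (real n) / real n ^ 2) \<le> 4"
proof (cases "N \<ge> 2")
  case True
  have "(\<Sum>n\<in>{2..N}. ln (real n) / real n ^ 2) \<le> (\<Sum>n\<in>{2..N}. 4 * (1 / sqrt (real n - 1) - 1 / sqrt (real n)))"
    by (intro sum_mono ln_div_square_le) auto
  also have "\<dots> = 4 * (1 - 1 / sqrt (real N))"
    using True by (induction N rule: dec_induct) (simp_all add: algebra_simps)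
  also have "\<dots> \<le> 4" by simp
  finally show ?thesis .
qed simp

text \<open>The geometric series in 1 / p \<le> 1 / 2 costs a factor of at most 2. With j = 1 this
  handles the powers of primes dividing m, with j = 2 the proper prime powers.\<close>

lemma sum_mangoldt_prime_powers_le:
  assumes P: "finite P" "\<And>p. p \<in> P \<Longrightarrow> prime p"
    and Q: "\<And>n. Q n \<Longrightarrow> primepow n \<Longrightarrow> n \<le> N \<Longrightarrow> \<exists>p\<in>P. \<exists>k\<ge>j. n = p ^ k" and j: "j > 0"
  shows "(\<Sum>n | n \<in> {1..N} \<and> Q n. mangoldt n / real n) \<le> (\<Sum>p\<in>P. 2 * (ln (real p) / real p ^ j))"
proof -
  define S where "S = {n \<in> {1..N}. Q n \<and> primepow n}"
  have "(\<Sum>n | n \<in> {1..N} \<and> Q n. mangoldt n / real n) = (\<Sum>n\<in>S. mangoldt n / real n)"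
    unfolding S_def by (rule sum.mono_neutral_right) (auto simp: mangoldt_def)
  also have "S \<subseteq> (\<lambda>(p, k). p ^ k) ` (P \<times> {j..N})"
  proof
    fix n assume n: "n \<in> S"
    then obtain p k where pk: "p \<in> P" "k \<ge> j" "n = p ^ k" using Q[of n] unfolding S_def by auto
    have "k < 2 ^ k" by simp
    also have "(2::nat) ^ k \<le> p ^ k" using P(2)[OF pk(1)] by (intro power_mono) (auto simp: prime_ge_2_nat)
    also have "\<dots> \<le> N" using n pk by (simp add: S_def)
    finally show "n \<in> (\<lambda>(p, k). p ^ k) ` (P \<times> {j..N})" using pk by force
  qed
  then have "(\<Sum>n\<in>S. mangoldt n / real n) \<le> (\<Sum>n\<in>(\<lambda>(p, k). p ^ k) ` (P \<times> {j..N}). mangoldt n / real n)"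
    using P(1) by (intro sum_mono2) (auto simp: mangoldt_nonneg)
  also have "\<dots> \<le> (\<Sum>x\<in>P \<times> {j..N}. ((\<lambda>n. mangoldt n / real n) \<circ> (\<lambda>(p, k). p ^ k)) x)"
    using P(1) by (intro sum_image_le) (auto simp: mangoldt_nonneg)
  also have "\<dots> = (\<Sum>p\<in>P. \<Sum>k\<in>{j..N}. mangoldt (p ^ k) / real (p ^ k))"
    by (simp add: sum.cartesian_product case_prod_unfold)
  also have "\<dots> \<le> (\<Sum>p\<in>P. 2 * (ln (real p) / real p ^ j))"
  proof (rule sum_mono)
    fix p assume "p \<in> P"
    then have p: "prime p" "real p \<ge> 2" using P(2) by (auto dest: prime_ge_2_nat)
    have geo: "(\<Sum>k\<in>{j..<M}. (1 / real p) ^ k) \<le> 2 * (1 / real p) ^ j - 2 * (1 / real p) ^ M" if "j \<le> M" for M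
      using that
    proof (induction M rule: dec_induct)
      case (step M)
      have "2 * (1 / real p) ^ Suc M \<le> (1 / real p) ^ M" using p(2) by (simp add: field_simps)
      moreover have "(\<Sum>k\<in>{j..<Suc M}. (1 / real p) ^ k) = (\<Sum>k\<in>{j..<M}. (1 / real p) ^ k) + (1 / real p) ^ M"
        using step(1) by simp
      ultimately show ?case using step.IH by linarith
    qed simp
    have "(\<Sum>k\<in>{j..N}. mangoldt (p ^ k) / real (p ^ k)) = (\<Sum>k\<in>{j..N}. ln (real p) * (1 / real p) ^ k)"
      using p(1) j by (intro sum.cong refl) (auto simp: power_one_over)
    also have "\<dots> = ln (real p) * (\<Sum>k\<in>{j..<Suc N}. (1 / real p) ^ k)"
      by (simp only: sum_distrib_left atLeastLessThanSuc_atLeastAtMost)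
    also have "(\<Sum>k\<in>{j..<Suc N}. (1 / real p) ^ k) \<le> 2 * (1 / real p) ^ j"
    proof (cases "j \<le> Suc N")
      case True
      have "(1 / real p) ^ Suc N \<ge> 0" by simp
      then show ?thesis using geo[OF True] by linarith
    qed simp
    finally show "(\<Sum>k\<in>{j..N}. mangoldt (p ^ k) / real (p ^ k)) \<le> 2 * (ln (real p) / real p ^ j)"
      using p(2) by (simp add: mult_left_mono power_one_over mult.commute)
  qed
  finally show ?thesis .
qed

lemma primepow_nat_cases:
  assumes "primepow (n :: nat)"
  obtains p k where "prime p" "k > 0" "n = p ^ k"
  using assms unfolding primepow_def by auto

lemma sum_mangoldt_not_coprime_le:
  assumes "m > 0"
  shows "(\<Sum>n | n \<in> {1..N} \<and> \<not> coprime n m. mangoldt n / real n) \<le> (\<Sum>p\<in>prime_factors m. 2 * (ln (real p) / real p ^ 1))"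
proof (rule sum_mangoldt_prime_powers_le)
  fix n assume n: "\<not> coprime n m" "primepow n"
  from n(2) obtain p k where pk: "prime p" "k > 0" "n = p ^ k" by (rule primepow_nat_cases)
  then have "\<not> coprime p m" using n(1) by (auto simp: coprime_power_left_iff)
  then have "p dvd m" using pk(1) prime_imp_coprime by blast
  then show "\<exists>p\<in>prime_factors m. \<exists>k\<ge>1. n = p ^ k"
    using pk assms by (intro bexI[of _ p] exI[of _ k]) (auto simp: prime_factors_dvd)
qed auto

lemma sum_mangoldt_not_prime_le:
  "(\<Sum>n | n \<in> {1..N} \<and> \<not> prime n. mangoldt n / real n) \<le> 8"
proof -
  have "(\<Sum>n | n \<in> {1..N} \<and> \<not> prime n. mangoldt n / real n) \<le> (\<Sum>p | p \<in> {2..N} \<and> prime p. 2 * (ln (real p) / real p ^ 2))"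
  proof (rule sum_mangoldt_prime_powers_le)
    fix n assume n: "\<not> prime n" "primepow n" "n \<le> N"
    from n(2) obtain p k where pk: "prime p" "k > 0" "n = p ^ k" by (rule primepow_nat_cases)
    then have "k \<noteq> 1" using n(1) by auto
    then have "k \<ge> 2" using pk by simp
    have "p ^ 1 \<le> p ^ k" using pk by (intro power_increasing) (auto simp: prime_gt_0_nat Suc_leI)
    then have "p \<in> {p \<in> {2..N}. prime p}" using pk n by (auto simp: prime_ge_2_nat)
    then show "\<exists>p\<in>{p. p \<in> {2..N} \<and> prime p}. \<exists>k\<ge>2. n = p ^ k" using pk \<open>k \<ge> 2\<close> by auto
  qed auto
  also have "\<dots> \<le> (\<Sum>p\<in>{2..N}. 2 * (ln (real p) / real p ^ 2))"
    by (intro sum_mono2) auto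
  also have "\<dots> = 2 * (\<Sum>p\<in>{2..N}. ln (real p) / real p ^ 2)" by (rule sum_distrib_left[symmetric])
  also have "\<dots> \<le> 8" using sum_ln_div_square_le[of N] by simp
  finally show ?thesis .
qed

lemma ln_nat_unbounded: "\<exists>N::nat. N \<ge> N0 \<and> ln (real N) > K"
proof -
  obtain N :: nat where N: "exp K < real N" using reals_Archimedean2 by blast
  have "exp K < real (max N N0)" using N by simp
  then have "K < ln (real (max N N0))" by (metis exp_gt_zero ln_exp ln_less_cancel_iff order_less_trans)
  then show ?thesis by (intro exI[of _ "max N N0"]) simp
qed

section \<open>Orthogonality and Dirichlet's theorem\<close>

text \<open>Separation of units from 1 is the structure of the character group that orthogonality
  rests on; the number of characters stays unevaluated throughout.\<close>

locale dirichlet_modulus =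
  fixes m :: nat
  assumes m: "m > 0"
    and separating: "\<And>b. coprime b m \<Longrightarrow> \<not> [b = 1] (mod m) \<Longrightarrow> \<exists>\<chi>\<in>characters m. \<chi> b \<noteq> 1"
begin

definition principal :: "nat \<Rightarrow> complex" where "principal a = of_bool (coprime a m)"

lemma principal: "principal \<in> characters m"
  using m by (auto simp: characters_def principal_def coprime_mod_left_iff)

lemma character_mult: "\<chi> \<in> characters m \<Longrightarrow> \<psi> \<in> characters m \<Longrightarrow> (\<lambda>a. \<chi> a * \<psi> a) \<in> characters m"
  by (auto simp: characters_def norm_mult)

lemma character_cnj: "\<chi> \<in> characters m \<Longrightarrow> (\<lambda>a. cnj (\<chi> a)) \<in> characters m"
  by (auto simp: characters_def)

text \<open>By Euler's theorem values are 0 or roots of unity of order dividing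
  \<open>totient m\<close>, and a character is determined by its values below m.\<close>

lemma finite_characters: "finite (characters m)"
proof -
  define V where "V = insert 0 {z::complex. z ^ totient m = 1}"
  have "finite V" unfolding V_def using m by (simp add: finite_roots_unity Suc_le_eq)
  have "\<chi> a \<in> V" if \<chi>: "\<chi> \<in> characters m" for \<chi> a
  proof -
    interpret dirichlet_character m \<chi> by standard (use m \<chi> in auto)
    show ?thesis
    proof (cases "coprime a m")
      case True
      then have "\<chi> (a ^ totient m) = \<chi> 1" by (intro cong_eq euler_theorem)
      then show ?thesis by (simp add: V_def power one[simplified])
    next
      case False
      then show ?thesis using norm_eq[of a] by (simp add: V_def)
    qed
  qed
  then have "(\<lambda>\<chi>. restrict \<chi> {..<m}) ` characters m \<subseteq> PiE {..<m} (\<lambda>_. V)"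
    by (intro image_subsetI) (simp add: restrict_PiE_iff)
  then have "finite ((\<lambda>\<chi>. restrict \<chi> {..<m}) ` characters m)"
    by (rule finite_subset) (use \<open>finite V\<close> in \<open>auto intro: finite_PiE\<close>)
  moreover have "inj_on (\<lambda>\<chi>. restrict \<chi> {..<m}) (characters m)"
  proof (rule inj_onI, rule ext)
    fix \<chi> \<psi> a assume *: "\<chi> \<in> characters m" "\<psi> \<in> characters m" "restrict \<chi> {..<m} = restrict \<psi> {..<m}"
    have "\<chi> (a mod m) = \<psi> (a mod m)" using fun_cong[OF *(3), of "a mod m"] m by simp
    then show "\<chi> a = \<psi> a" using * by (simp add: characters_def)
  qed
  ultimately show ?thesis by (rule finite_imageD)
qed

text \<open>Multiplication by a character \<psi> with \<psi> b \<noteq> 1 permutes all characters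
  and multiplies the sum by \<psi> b, so the sum vanishes.\<close>

lemma sum_characters:
  assumes "coprime b m"
  shows "(\<Sum>\<chi>\<in>characters m. \<chi> b) = (if [b = 1] (mod m) then of_nat (card (characters m)) else 0)"
proof (cases "[b = 1] (mod m)")
  case True
  have "\<chi> b = 1" if "\<chi> \<in> characters m" for \<chi>
  proof -
    interpret dirichlet_character m \<chi> by standard (use m that in auto)
    show ?thesis using cong_eq[OF True] one by simp
  qed
  then have "(\<Sum>\<chi>\<in>characters m. \<chi> b) = (\<Sum>\<chi>\<in>characters m. 1)" by (intro sum.cong refl)
  then show ?thesis using True by simp
next
  case False
  obtain \<psi> where \<psi>: "\<psi> \<in> characters m" "\<psi> b \<noteq> 1" using separating[OF assms False] by blast
  let ?f = "\<lambda>\<chi> a. \<chi> a * \<psi> a"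
  have inj: "inj_on ?f (characters m)"
  proof (rule inj_onI, rule ext)
    fix \<chi> \<chi>' a assume *: "\<chi> \<in> characters m" "\<chi>' \<in> characters m" "?f \<chi> = ?f \<chi>'"
    show "\<chi> a = \<chi>' a"
    proof (cases "coprime a m")
      case True
      then have "norm (\<psi> a) = 1" using \<psi>(1) by (simp add: characters_def)
      then have "\<psi> a \<noteq> 0" by auto
      then show ?thesis using fun_cong[OF *(3), of a] by simp
    next
      case False
      then have "norm (\<chi> a) = 0" "norm (\<chi>' a) = 0" using * by (auto simp: characters_def)
      then show ?thesis by simp
    qed
  qed
  have sub: "?f ` characters m \<subseteq> characters m" using character_mult \<psi> by auto
  have "bij_betw ?f (characters m) (characters m)"
    unfolding bij_betw_def using endo_inj_surj[OF finite_characters sub inj] inj by simp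
  then have "(\<Sum>\<chi>\<in>characters m. \<chi> b) = (\<Sum>\<chi>\<in>characters m. ?f \<chi> b)"
    using sum.reindex_bij_betw[of ?f "characters m" "characters m" "\<lambda>\<chi>. \<chi> b"] by simp
  also have "\<dots> = (\<Sum>\<chi>\<in>characters m. \<chi> b) * \<psi> b" by (simp add: sum_distrib_right)
  finally show ?thesis using \<psi>(2) False by simp
qed

definition msum :: "(nat \<Rightarrow> complex) \<Rightarrow> nat \<Rightarrow> complex" where
  "msum \<chi> N = (\<Sum>d\<in>{1..N}. \<chi> d * of_real (mangoldt d / d))"

lemma sum_msum:
  assumes ab: "[a * b = 1] (mod m)"
  shows "(\<Sum>\<chi>\<in>characters m. \<chi> b * msum \<chi> N)
    = of_real (real (card (characters m)) * (\<Sum>d | d \<in> {1..N} \<and> [d = a] (mod m). mangoldt d / d))"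
proof -
  have cop: "coprime a m" "coprime b m"
    using ab by (metis cong_imp_coprime coprime_1_left cong_sym coprime_mult_left_iff)+
  have "(\<Sum>\<chi>\<in>characters m. \<chi> b * msum \<chi> N) = (\<Sum>\<chi>\<in>characters m. \<Sum>d\<in>{1..N}. \<chi> (b * d) * of_real (mangoldt d / d))"
    unfolding msum_def sum_distrib_left by (intro sum.cong refl) (auto simp: characters_def)
  also have "\<dots> = (\<Sum>d\<in>{1..N}. (\<Sum>\<chi>\<in>characters m. \<chi> (b * d)) * of_real (mangoldt d / d))"
    by (subst sum.swap) (simp only: sum_distrib_right)
  also have "\<dots> = (\<Sum>d\<in>{1..N}. if [d = a] (mod m) then of_real (real (card (characters m)) * (mangoldt d / d)) else 0)"
  proof (intro sum.cong refl)
    fix d assume d: "d \<in> {1..N}"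
    show "(\<Sum>\<chi>\<in>characters m. \<chi> (b * d)) * of_real (mangoldt d / d)
        = (if [d = a] (mod m) then of_real (real (card (characters m)) * (mangoldt d / d)) else 0)"
    proof (cases "coprime d m")
      case True
      have "[b * d = 1] (mod m) \<longleftrightarrow> [d = a] (mod m)"
      proof
        assume "[d = a] (mod m)"
        then have "[b * d = b * a] (mod m)" by (intro cong_mult cong_refl)
        then show "[b * d = 1] (mod m)" using ab by (metis cong_trans mult.commute)
      next
        assume "[b * d = 1] (mod m)"
        then have "[b * d = b * a] (mod m)" using ab by (metis cong_trans cong_sym mult.commute)
        then show "[d = a] (mod m)" using cop by (simp add: cong_mult_lcancel_nat)
      qed
      then show ?thesis using sum_characters[of "b * d"] True cop by (simp add: coprime_mult_left_iff)
    next
      case False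
      then have "\<not> [d = a] (mod m)" using cop cong_imp_coprime cong_sym by blast
      moreover have "\<chi> (b * d) = 0" if "\<chi> \<in> characters m" for \<chi>
      proof -
        have "norm (\<chi> (b * d)) = 0" using that False by (auto simp: characters_def norm_mult)
        then show ?thesis by simp
      qed
      then have "(\<Sum>\<chi>\<in>characters m. \<chi> (b * d)) = 0" by (intro sum.neutral ballI)
      ultimately show ?thesis by simp
    qed
  qed
  also have "\<dots> = (\<Sum>d | d \<in> {1..N} \<and> [d = a] (mod m). of_real (real (card (characters m)) * (mangoldt d / d)))"
    by (rule sum.inter_filter[symmetric]) simp
  finally show ?thesis by (simp only: of_real_sum sum_distrib_left)
qed

lemma nontrivial_characterI:
  assumes "\<chi> \<in> characters m" "\<chi> \<noteq> principal"
  shows "nontrivial_character m \<chi>"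
proof
  show "\<exists>a. coprime a m \<and> \<chi> a \<noteq> 1"
  proof (rule ccontr)
    assume *: "\<not> ?thesis"
    have "\<chi> a = principal a" for a
    proof (cases "coprime a m")
      case False
      then have "norm (\<chi> a) = 0" using assms by (auto simp: characters_def)
      then show ?thesis using False by (simp add: principal_def)
    qed (use * in \<open>auto simp: principal_def\<close>)
    then show False using assms by auto
  qed
qed (use m assms in auto)

lemma msum_principal_bounds:
  "\<exists>C. \<forall>N\<ge>1. \<bar>Re (msum principal N) - ln N\<bar> \<le> C"
proof (intro exI allI impI)
  fix N :: nat assume N: "N \<ge> 1"
  define C where "C = (\<Sum>p\<in>prime_factors m. 2 * (ln (real p) / real p ^ 1))"
  have "Re (msum principal N) = (\<Sum>d\<in>{1..N}. if coprime d m then mangoldt d / d else 0)"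
    unfolding msum_def Re_sum by (intro sum.cong refl) (auto simp: principal_def)
  also have "\<dots> = (\<Sum>d | d \<in> {1..N} \<and> coprime d m. mangoldt d / d)"
    by (rule sum.inter_filter[symmetric]) simp
  finally have 1: "Re (msum principal N) = \<dots>" .
  have 2: "(\<Sum>d\<in>{1..N}. mangoldt d / real d) = (\<Sum>d | d \<in> {1..N} \<and> coprime d m. mangoldt d / d)
      + (\<Sum>d | d \<in> {1..N} \<and> \<not> coprime d m. mangoldt d / real d)"
    by (subst sum.union_disjoint[symmetric]) (auto intro!: sum.cong)
  have 3: "(\<Sum>d | d \<in> {1..N} \<and> \<not> coprime d m. mangoldt d / real d) \<ge> 0"
    by (intro sum_nonneg) (auto simp: mangoldt_nonneg)
  have "C \<ge> 0" unfolding C_def 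
    by (intro sum_nonneg mult_nonneg_nonneg divide_nonneg_nonneg ln_ge_zero)
      (auto dest!: in_prime_factors_imp_prime prime_ge_1_nat)
  then show "\<bar>Re (msum principal N) - ln N\<bar> \<le> 7 + C"
    using 1 2 3 sum_mangoldt_not_coprime_le[OF m, of N] mertens_lower[OF N] mertens_upper[OF N]
    unfolding C_def by linarith
qed

text \<open>Each nonprincipal sum is either bounded or - ln N + O(1), the latter only if
  \<open>L1\<close> = 0. An unbounded one belongs to a nonreal character, so its conjugate is a
  second one. Against the ln N of the principal character the sum over all characters would be at
  most - ln N + O(1), whereas orthogonality at 1 makes it nonnegative.\<close>

lemma msum_bounded:
  assumes \<chi>: "\<chi> \<in> characters m" "\<chi> \<noteq> principal"
  shows "\<exists>C. \<forall>N\<ge>1. norm (msum \<chi> N) \<le> C"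
proof -
  have dichotomy: "(\<exists>C. \<forall>N\<ge>1. norm (msum \<psi> N) \<le> C) \<or> (\<exists>C. \<forall>N\<ge>1. norm (msum \<psi> N + of_real (ln N)) \<le> C)"
    if "\<psi> \<in> characters m - {principal}" for \<psi>
  proof -
    interpret nontrivial_character m \<psi> by (rule nontrivial_characterI) (use that in auto)
    have [simp]: "mangoldt_sum' N = msum \<psi> N" for N by (simp add: mangoldt_sum'_def msum_def)
    show ?thesis
    proof (cases "L1 = 0")
      case True
      then show ?thesis using mangoldt_sum_of_L1_zero by simp
    next
      case False
      obtain C where "norm (L1 * msum \<psi> N) \<le> C" for N using L1_mangoldt_sum_bounded by auto
      then have "norm (msum \<psi> N) \<le> C / norm L1" for N
        using False by (simp add: norm_mult field_simps)
      then show ?thesis by blast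
    qed
  qed
  show ?thesis
  proof (rule ccontr)
    assume unb: "\<not> ?thesis"
    then obtain C where C: "\<And>N. N \<ge> 1 \<Longrightarrow> norm (msum \<chi> N + of_real (ln N)) \<le> C"
      using dichotomy[of \<chi>] \<chi> by blast
    interpret nontrivial_character m \<chi> by (rule nontrivial_characterI) (use \<chi> in auto)
    have "L1 = 0"
    proof (rule ccontr)
      assume False: "L1 \<noteq> 0"
      obtain C where "norm (L1 * mangoldt_sum' N) \<le> C" for N using L1_mangoldt_sum_bounded by auto
      then have "norm (msum \<chi> N) \<le> C / norm L1" for N
        using False by (simp add: norm_mult field_simps mangoldt_sum'_def msum_def)
      then show False using unb by blast
    qed
    have "\<exists>a. \<chi> a \<notin> \<real>"
    proof (rule ccontr)
      assume "\<not> ?thesis"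
      then interpret real_character m \<chi> by unfold_locales blast
      show False using L1_nonzero \<open>L1 = 0\<close> by simp
    qed
    then obtain a where a: "\<chi> a \<notin> \<real>" by blast
    define \<chi>' where "\<chi>' = (\<lambda>a. cnj (\<chi> a))"
    have \<chi>': "\<chi>' \<in> characters m" using character_cnj \<chi> by (simp add: \<chi>'_def)
    have "\<chi>' \<noteq> \<chi>" using a by (metis Reals_cnj_iff \<chi>'_def)
    have "\<chi>' \<noteq> principal"
    proof
      assume "\<chi>' = principal"
      then have "cnj (\<chi> a) = of_bool (coprime a m)" by (metis \<chi>'_def principal_def)
      then have "\<chi> a = cnj (of_bool (coprime a m))" by (metis complex_cnj_cnj)
      then show False using a by (cases "coprime a m") auto
    qed
    have msum': "msum \<chi>' N = cnj (msum \<chi> N)" for N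
      by (simp only: msum_def \<chi>'_def cnj_sum complex_cnj_mult complex_cnj_complex_of_real)
    obtain C0 where C0: "\<And>N. N \<ge> 1 \<Longrightarrow> \<bar>Re (msum principal N) - ln N\<bar> \<le> C0"
      using msum_principal_bounds by blast
    \<comment> \<open>The remaining characters may be of either kind; their real parts are bounded
      above in both cases.\<close>
    have "\<forall>\<psi>\<in>characters m - {principal}. \<exists>C. \<forall>N\<ge>1. Re (msum \<psi> N) \<le> C"
    proof
      fix \<psi> assume "\<psi> \<in> characters m - {principal}"
      from dichotomy[OF this] show "\<exists>C. \<forall>N\<ge>1. Re (msum \<psi> N) \<le> C"
      proof
        assume "\<exists>C. \<forall>N\<ge>1. norm (msum \<psi> N) \<le> C"
        then show ?thesis using complex_Re_le_cmod order_trans by blast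
      next
        assume "\<exists>C. \<forall>N\<ge>1. norm (msum \<psi> N + of_real (ln N)) \<le> C"
        then obtain C where C: "\<And>N. N \<ge> 1 \<Longrightarrow> norm (msum \<psi> N + of_real (ln N)) \<le> C" by blast
        have "Re (msum \<psi> N) \<le> C" if "N \<ge> 1" for N :: nat
        proof -
          have "ln (real N) \<ge> 0" using that by simp
          moreover have "Re (msum \<psi> N) + ln (real N) \<le> norm (msum \<psi> N + of_real (ln N))"
            using complex_Re_le_cmod[of "msum \<psi> N + of_real (ln N)"] by simp
          ultimately show ?thesis using C[OF that] by linarith
        qed
        then show ?thesis by blast
      qed
    qed
    then obtain D where D: "\<And>\<psi> N. \<psi> \<in> characters m - {principal} \<Longrightarrow> N \<ge> 1 \<Longrightarrow> Re (msum \<psi> N) \<le> D \<psi>" by metis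
    define R where "R = characters m - {principal, \<chi>, \<chi>'}"
    define T where "T = (\<Sum>\<psi>\<in>R. D \<psi>)"
    obtain N :: nat where N: "N \<ge> 1" "ln (real N) > C0 + 2 * C + T" using ln_nat_unbounded by blast
    have "0 \<le> Re (\<Sum>\<psi>\<in>characters m. \<psi> 1 * msum \<psi> N)"
      using sum_msum[of 1 1 N] by (auto intro!: mult_nonneg_nonneg sum_nonneg simp: mangoldt_nonneg)
    also have "(\<Sum>\<psi>\<in>characters m. \<psi> 1 * msum \<psi> N) = (\<Sum>\<psi>\<in>characters m. msum \<psi> N)"
      by (intro sum.cong) (auto simp: characters_def)
    also have "characters m = {principal, \<chi>, \<chi>'} \<union> R" using principal \<chi> \<chi>' by (auto simp: R_def)
    also have "(\<Sum>\<psi>\<in>\<dots>. msum \<psi> N) = msum principal N + msum \<chi> N + msum \<chi>' N + (\<Sum>\<psi>\<in>R. msum \<psi> N)"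
      using finite_characters \<open>\<chi> \<noteq> principal\<close> \<open>\<chi>' \<noteq> \<chi>\<close> \<open>\<chi>' \<noteq> principal\<close>
      by (subst sum.union_disjoint) (auto simp: R_def)
    also have "Re \<dots> = Re (msum principal N) + 2 * Re (msum \<chi> N) + (\<Sum>\<psi>\<in>R. Re (msum \<psi> N))"
      by (simp add: msum')
    also have "\<dots> \<le> (ln N + C0) + 2 * (C - ln N) + T"
      unfolding T_def
    proof (intro add_mono mult_left_mono sum_mono)
      show "Re (msum principal N) \<le> ln N + C0" using C0[OF N(1)] by linarith
      show "Re (msum \<chi> N) \<le> C - ln N"
        using C[OF N(1)] complex_Re_le_cmod[of "msum \<chi> N + of_real (ln N)"] by simp
    qed (use D N(1) in \<open>auto simp: R_def\<close>)
    finally have "ln N \<le> C0 + 2 * C + T" by argo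
    then show False using N(2) by simp
  qed
qed

text \<open>The principal character contributes ln N and all others stay bounded, so the sum of
  mangoldt d / d over the progression is unbounded. If its primes were all at most B, that sum would
  be at most \<open>E\<close> plus the 8 from proper prime powers.\<close>

theorem primes_in_progression:
  assumes "coprime a m"
  shows "\<exists>r. prime r \<and> r > B \<and> [r = a] (mod m)"
proof (rule ccontr)
  assume none: "\<not> ?thesis"
  obtain b where b: "[a * b = 1] (mod m)" using cong_solve_coprime_nat[OF assms] by auto
  then have "coprime b m" by (metis cong_imp_coprime coprime_1_left cong_sym coprime_mult_left_iff)
  obtain C0 where C0: "\<And>N. N \<ge> 1 \<Longrightarrow> \<bar>Re (msum principal N) - ln N\<bar> \<le> C0"
    using msum_principal_bounds by blast
  have "\<forall>\<chi>\<in>characters m - {principal}. \<exists>C. \<forall>N\<ge>1. norm (msum \<chi> N) \<le> C" using msum_bounded by blast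
  then obtain D where D: "\<And>\<chi> N. \<chi> \<in> characters m - {principal} \<Longrightarrow> N \<ge> 1 \<Longrightarrow> norm (msum \<chi> N) \<le> D \<chi>" by metis
  define E where "E = (\<Sum>d\<in>{1..B}. mangoldt d / real d)"
  let ?c = "real (card (characters m))"
  obtain N :: nat where N: "N \<ge> 1" "ln (real N) > C0 + (\<Sum>\<chi>\<in>characters m - {principal}. D \<chi>) + ?c * (8 + E)"
    using ln_nat_unbounded by blast
  have "(\<Sum>d | d \<in> {1..N} \<and> [d = a] (mod m). mangoldt d / real d)
      \<le> (\<Sum>d\<in>{d. d \<in> {1..N} \<and> \<not> prime d} \<union> {1..B}. mangoldt d / real d)"
    by (rule sum_mono2) (use none in \<open>auto simp: mangoldt_nonneg not_less\<close>)
  also have "\<dots> \<le> (\<Sum>d | d \<in> {1..N} \<and> \<not> prime d. mangoldt d / real d) + E"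
    unfolding E_def by (subst sum_Un) (auto intro!: sum_nonneg simp: mangoldt_nonneg)
  also have "\<dots> \<le> 8 + E" using sum_mangoldt_not_prime_le[of N] by simp
  finally have upper: "?c * (\<Sum>d | d \<in> {1..N} \<and> [d = a] (mod m). mangoldt d / real d) \<le> ?c * (8 + E)"
    by (intro mult_left_mono) auto
  have "(\<Sum>\<chi>\<in>characters m. \<chi> b * msum \<chi> N) = principal b * msum principal N + (\<Sum>\<chi>\<in>characters m - {principal}. \<chi> b * msum \<chi> N)"
    using finite_characters principal by (rule sum.remove)
  moreover have "principal b = 1" using \<open>coprime b m\<close> by (simp add: principal_def)
  moreover have "Re (\<Sum>\<chi>\<in>characters m - {principal}. \<chi> b * msum \<chi> N) \<ge> - (\<Sum>\<chi>\<in>characters m - {principal}. D \<chi>)"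
  proof -
    have "norm (\<Sum>\<chi>\<in>characters m - {principal}. \<chi> b * msum \<chi> N) \<le> (\<Sum>\<chi>\<in>characters m - {principal}. D \<chi>)"
    proof (rule sum_norm_le)
      fix \<chi> assume \<chi>: "\<chi> \<in> characters m - {principal}"
      then have "norm (\<chi> b) = 1" using \<open>coprime b m\<close> by (simp add: characters_def)
      then show "norm (\<chi> b * msum \<chi> N) \<le> D \<chi>" using D[OF \<chi> N(1)] by (simp add: norm_mult)
    qed
    then show ?thesis using abs_Re_le_cmod[of "\<Sum>\<chi>\<in>characters m - {principal}. \<chi> b * msum \<chi> N"] by linarith
  qed
  moreover have "Re (\<Sum>\<chi>\<in>characters m. \<chi> b * msum \<chi> N) \<le> ?c * (8 + E)"
    unfolding sum_msum[OF b] Re_complex_of_real by (rule upper)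
  ultimately show False using C0[OF N(1)] N(2) by simp
qed

end


section \<open>Separating characters modulo p and p * q\<close>

lemma character_extend:
  assumes "\<chi> \<in> characters p" "p > 0" "q > 0"
  shows "(\<lambda>a. \<chi> a * of_bool (coprime a q)) \<in> characters (p * q)"
proof -
  have "\<chi> (a mod (p * q)) = \<chi> a" for a
  proof -
    have "\<chi> (a mod (p * q)) = \<chi> (a mod (p * q) mod p)" using assms by (simp add: characters_def)
    also have "a mod (p * q) mod p = a mod p" by (simp add: mod_mod_cancel)
    finally show ?thesis using assms by (simp add: characters_def)
  qed
  moreover have "coprime (a mod (p * q)) q \<longleftrightarrow> coprime a q" for a
    using assms coprime_mod_left_iff[of q "a mod (p * q)"] coprime_mod_left_iff[of q a] by (simp add: mod_mod_cancel)
  ultimately show ?thesis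
    using assms by (auto simp: characters_def norm_mult coprime_mult_right_iff)
qed

text \<open>The discrete logarithm to a primitive root, composed with k \<mapsto> exp (2 pi i k / (p
  - 1)), is a character that is injective on the units, so one character separates every b from
  1.\<close>

lemma prime_separating_character:
  assumes p: "prime p" "p > 2" and b: "coprime b p" "\<not> [b = 1] (mod p)"
  shows "\<exists>\<chi>\<in>characters p. \<chi> b \<noteq> 1"
proof -
  obtain g where g: "residue_primroot p g"
    using prime_primitive_root_exists[OF _ p(1)] p(2) by auto
  define n where "n = p - 1"
  have n: "n > 0" using p by (simp add: n_def)
  have bij: "bij_betw (\<lambda>i. g ^ i mod p) {..<n} (totatives p)"
    using residue_primroot_is_generator[OF _ g] p by (simp add: n_def totient_prime)
  define ind where "ind = (\<lambda>a. inv_into {..<n} (\<lambda>i. g ^ i mod p) (a mod p))"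
  have tot: "a mod p \<in> totatives p" if "coprime a p" for a
    using that p by (auto simp: totatives_def coprime_mod_left_iff prime_gt_0_nat intro!: Nat.gr0I)
  have ind: "ind a < n" "[g ^ ind a = a] (mod p)" if "coprime a p" for a
    using tot[OF that] bij_betw_inv_into_right[OF bij] bij_betw_apply[OF bij_betw_inv_into[OF bij]]
    by (auto simp: ind_def cong_def)
  have ind_unique: "k mod n = ind a" if "[g ^ k = a] (mod p)" "coprime a p" for k a
  proof -
    have "coprime g p" using g by (simp add: residue_primroot_def coprime_commute)
    then have "[g ^ n = 1] (mod p)" using euler_theorem[of g p] p by (simp add: n_def totient_prime)
    then have "[(g ^ n) ^ (k div n) * g ^ (k mod n) = 1 ^ (k div n) * g ^ (k mod n)] (mod p)"
      by (intro cong_mult cong_pow cong_refl)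
    then have "[g ^ k = g ^ (k mod n)] (mod p)" by (simp flip: power_mult power_add)
    then have "g ^ (k mod n) mod p = g ^ ind a mod p" using that ind(2)[OF that(2)] by (simp add: cong_def)
    moreover have "k mod n \<in> {..<n}" "ind a \<in> {..<n}" using n ind(1)[OF that(2)] by auto
    ultimately show ?thesis using bij_betw_imp_inj_on[OF bij] by (auto dest: inj_onD)
  qed
  define \<omega> where "\<omega> = (\<lambda>k::nat. cis (2 * pi * real k / real n))"
  have \<omega>: "bij_betw \<omega> {..<n} {z. z ^ n = 1}" unfolding \<omega>_def by (rule bij_betw_roots_unity[OF n])
  have \<omega>_add: "\<omega> (j + k) = \<omega> j * \<omega> k" for j k by (simp add: \<omega>_def cis_mult ring_distribs add_divide_distrib)
  have "\<omega> (n * k) = 1" for k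
  proof -
    have "2 * pi * real (n * k) / real n = 2 * pi * real k" using n by simp
    then show ?thesis unfolding \<omega>_def using cis_multiple_2pi[of "real k"] by (simp only: Ints_of_nat)
  qed
  then have \<omega>_mod: "\<omega> (k mod n) = \<omega> k" for k
    using \<omega>_add[of "n * (k div n)" "k mod n"] by simp
  define \<chi> where "\<chi> = (\<lambda>a. if coprime a p then \<omega> (ind a) else 0)"
  have ind1: "ind 1 = 0" using ind_unique[of 0 1] by simp
  have "\<chi> \<in> characters p" unfolding characters_def
  proof (safe, goal_cases)
    case 1
    then show ?case using ind1 by (simp add: \<chi>_def \<omega>_def)
  next
    case (2 a b)
    show ?case
    proof (cases "coprime a p \<and> coprime b p")
      case True
      then have "coprime (a * b) p" by simp
      have "[g ^ ind a * g ^ ind b = a * b] (mod p)" using True ind by (intro cong_mult) auto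
      then have "(ind a + ind b) mod n = ind (a * b)"
        by (intro ind_unique \<open>coprime (a * b) p\<close>) (simp add: power_add)
      then have "\<omega> (ind (a * b)) = \<omega> (ind a) * \<omega> (ind b)" by (metis \<omega>_add \<omega>_mod)
      then show ?thesis using True by (simp add: \<chi>_def)
    qed (auto simp: \<chi>_def)
  next
    case (3 a)
    show ?case using p by (simp add: \<chi>_def ind_def coprime_mod_left_iff prime_gt_0_nat)
  next
    case (4 a)
    show ?case by (simp add: \<chi>_def \<omega>_def)
  qed
  moreover have "\<chi> b \<noteq> 1"
  proof
    assume "\<chi> b = 1"
    then have "\<omega> (ind b) = \<omega> 0" using b(1) by (simp add: \<chi>_def \<omega>_def)
    then have "ind b = 0" using bij_betw_imp_inj_on[OF \<omega>] ind(1)[OF b(1)] n by (auto dest: inj_onD)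
    then show False using ind(2)[OF b(1)] b(2) by (simp add: cong_sym_eq)
  qed
  ultimately show ?thesis by blast
qed

lemma dirichlet_modulus_prime:
  assumes "prime p" "p > 2"
  shows "dirichlet_modulus p"
  using assms prime_separating_character by unfold_locales (auto simp: prime_gt_0_nat)

text \<open>A residue other than 1 modulo p * q differs from 1 modulo p or modulo q, and a character
  of that prime, set to 0 on multiples of the other one, separates it.\<close>

lemma dirichlet_modulus_two_primes:
  assumes p: "prime p" "p > 2" and q: "prime q" "q > 2" and "p \<noteq> q"
  shows "dirichlet_modulus (p * q)"
proof
  show "p * q > 0" using p q by simp
  fix b assume b: "coprime b (p * q)" "\<not> [b = 1] (mod (p * q))"
  have cop: "coprime p q" using assms by (simp add: primes_coprime)
  have "\<not> [b = 1] (mod p) \<or> \<not> [b = 1] (mod q)" using b(2) cop coprime_cong_mult_nat by blast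
  then show "\<exists>\<chi>\<in>characters (p * q). \<chi> b \<noteq> 1"
  proof
    assume "\<not> [b = 1] (mod p)"
    then obtain \<chi> where \<chi>: "\<chi> \<in> characters p" "\<chi> b \<noteq> 1" using prime_separating_character p b(1) by auto
    have "(\<lambda>a. \<chi> a * of_bool (coprime a q)) \<in> characters (p * q)"
      using character_extend[OF \<chi>(1)] p q by simp
    then show ?thesis using \<chi>(2) b(1) by (intro bexI) auto
  next
    assume "\<not> [b = 1] (mod q)"
    then obtain \<chi> where \<chi>: "\<chi> \<in> characters q" "\<chi> b \<noteq> 1" using prime_separating_character q b(1) by auto
    have "(\<lambda>a. \<chi> a * of_bool (coprime a p)) \<in> characters (p * q)"
      using character_extend[OF \<chi>(1), of p] p q by (simp add: mult.commute)
    then show ?thesis using \<chi>(2) b(1) by (intro bexI) auto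
  qed
qed

section \<open>Prescribed odd diameters\<close>

lemma exists_cyclotomic_diameter:
  fixes h :: nat
  assumes h: "h \<ge> 2"
  shows "\<exists>p q r :: nat. prime p \<and> odd p \<and> prime q \<and> prime r \<and> r > q \<and> q > p \<and>
           cyclotomic_diameter (p * q * r) = 2 * int h + 1"
proof -
  from large_prime_divisor[OF h] obtain e p where e: "e \<in> {1..h}" and p: "prime p" "p > 2 * h" "p dvd h * e + 1"
    by blast
  have p2: "p > 2" using p h by simp
  then have "odd p" using p prime_odd_nat by auto
  have "coprime h p"
    using p h by (intro prime_imp_coprime[THEN coprime_commute[THEN iffD1]]) (auto dest: dvd_imp_le)
  then obtain q where q: "prime q" "q > 2 * p ^ 2" "[q = h] (mod p)"
    using dirichlet_modulus.primes_in_progression[OF dirichlet_modulus_prime[OF p(1) p2]] by blast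
  have "p \<le> p ^ 2" by (simp add: power2_eq_square)
  with q have pq: "p < q" by linarith
  \<comment> \<open>Replacing q by h gives h * e + 1, a multiple of p by the choice of p; the
    quotient \<open>u\<close> is the width of the positive rectangle.\<close>
  have "[e * q + 1 = h * e + 1] (mod p)"
    using cong_scalar_left[OF q(3), of e] by (intro cong_add) (simp_all add: mult.commute)
  then have "p dvd e * q + 1" using p(3) cong_dvd_iff by blast
  then obtain u where u: "u * p = e * q + 1" by (metis dvd_def mult.commute)
  \<comment> \<open>A common divisor of q - p and either prime divides both primes; hence q - p is
    invertible modulo p * q and the residue class for r exists.\<close>
  have "coprime (q - p) c" if c: "c = p \<or> c = q" for c
  proof (rule coprimeI)
    fix k assume k: "k dvd q - p" "k dvd c"
    have "q = (q - p) + p" using pq by simp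
    then have "k dvd p" "k dvd q" using k c by (metis dvd_add dvd_add_right_iff)+
    moreover have "coprime p q" using p q pq by (simp add: primes_coprime)
    ultimately show "is_unit k" using coprime_common_divisor by blast
  qed
  then have "coprime (q - p) (p * q)" by simp
  then obtain a where a: "[(q - p) * a = 1] (mod (p * q))"
    using cong_solve_coprime_nat by (metis One_nat_def)
  have "coprime a (p * q)" using cong_imp_coprime[OF cong_sym[OF a]] by simp
  moreover have "q > 2" "p \<noteq> q" using pq p2 by simp_all
  ultimately obtain r where r: "prime r" "r > p * q" "[r = a] (mod (p * q))"
    using dirichlet_modulus.primes_in_progression[OF dirichlet_modulus_two_primes[OF p(1) p2 q(1)]] by blast
  have "[r * (q - p) = 1] (mod (p * q))"
    using cong_trans[OF cong_scalar_right[OF r(3), of "q - p"]] a by (simp add: mult.commute)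
  then have "[int (r * (q - p)) = int 1] (mod (int (p * q)))" by (simp only: cong_int_iff)
  then have r': "[int r * (int q - int p) = 1] (mod (int p * int q))" using pq by (simp add: of_nat_diff)
  have "0 < e" "e \<le> h" "2 * p ^ 2 \<le> q" using e q by simp_all
  then interpret cyclotomic_window p q r h e u
    by (rule cyclotomic_window.intro[OF p(1) q(1) r(1) _ _ p(2) _ r(2) u q(3) r'])
  show ?thesis
    by (rule exI[of _ p], rule exI[of _ q], rule exI[of _ r], intro conjI)
      (fact primes \<open>odd p\<close> p_less_q q_less_r cyclotomic_diameter_eq)+
qed

theorem corollary8:
  fixes d :: int
  assumes "odd d" and "d \<ge> 3"
  shows "\<exists>p q r :: nat. prime p \<and> odd p \<and> prime q \<and> prime r \<and> r > q \<and> q > p \<and>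
           cyclotomic_diameter (p * q * r) = d"
proof -
  obtain k where k: "d = 2 * k + 1" using assms(1) by (elim oddE)
  then have "k \<ge> 1" using assms(2) by simp
  show ?thesis
  proof (cases "k = 1")
    case True
    show ?thesis
      by (rule exI[of _ 3], rule exI[of _ 5], rule exI[of _ 7])
        (use cyclotomic_diameter_105 True k in simp)
  next
    case False
    then have "nat k \<ge> 2" "d = 2 * int (nat k) + 1" using k \<open>k \<ge> 1\<close> by simp_all
    then show ?thesis using exists_cyclotomic_diameter[of "nat k"] by simp
  qed
qed

end
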